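(* Let $(M,\varphi_1,\xi_1,\eta_1,g)$ be a pseudo-Riemannian manifold with an almost contact metric structure. The following statements are equivalent: (i) the manifold belongs to the class $\mathcal P_2\oplus\mathcal P_4\oplus\mathcal P_9\oplus\mathcal P_{10}\oplus\mathcal P_{11}$, determined by $$F_1(\varphi_1x,y,z)+F_1(\varphi_1y,x,z)+F_1(x,y,\varphi_1z)+F_1(y,x,\varphi_1z)=0;$$ (ii) the associated Nijenhuis tensor $\widehat N_1$ vanishes and $\xi_1$ is a Killing vector field; (iii) the tensor $\{\varphi_1,\varphi_1\}$ vanishes and $\xi_1$ is a Killing vector field; (iv) the Nijenhuis tensor $N_1$ is a 3-form and $\xi_1$ is a Killing vector field; (v) there exists a natural connection $\nabla^1$ with totally skew-symmetric torsion for the structure $(\varphi_1,\xi_1,\eta_1,g)$, and this connection is unique and determined by its torsion $$T_1(x,y,z)=F_1(x,y,\varphi_1z)-F_1(y,x,\varphi_1z)-F_1(\varphi_1z,x,y)+2F_1(x,\varphi_1y,\xi_1)\eta_1(z).$$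
   Context: $M$ has dimension $4n+3$. The almost contact metric structure satisfies $\varphi_1^2=-I+\xi_1\otimes\eta_1$, $\varphi_1\xi_1=0$, $\eta_1\circ\varphi_1=0$, $\eta_1(\xi_1)=1$ and the pseudo-Riemannian metric $g$ satisfies $g(\varphi_1x,\varphi_1y)=g(x,y)+\eta_1(x)\eta_1(y)$, $g(\xi_1,\xi_1)=-1$, $\eta_1(x)=-g(\xi_1,x)$. Let $\nabla$ be the Levi-Civita connection of $g$ and $F_1(x,y,z)=g((\nabla_x\varphi_1)y,z)$. A natural connection for the structure is an affine connection $\nabla^*$ with $\nabla^*\varphi_1=\nabla^*\xi_1=\nabla^*\eta_1=\nabla^*g=0$; its torsion is viewed as the $(0,3)$-tensor $T(x,y,z)=g(\nabla^*_xy-\nabla^*_yx-[x,y],z)$, totally skew-symmetric meaning it is a 3-form. $\{\varphi_1,\varphi_1\}(x,y)=\{\varphi_1x,\varphi_1y\}+\varphi_1^2\{x,y\}-\varphi_1\{\varphi_1x,y\}-\varphi_1\{x,\varphi_1y\}$ with $\{x,y\}=\nabla_xy+\nabla_yx$. The associated Nijenhuis tensor is $\widehat N_1=\{\varphi_1,\varphi_1\}-\xi_1\otimes\mathcal L_{\xi_1}g$ ($\mathcal L$ the Lie derivative). The Nijenhuis tensor is $N_1=[\varphi_1,\varphi_1]+\xi_1\otimes d\eta_1$, with $[\varphi_1,\varphi_1](x,y)=\varphi_1^2[x,y]+[\varphi_1x,\varphi_1y]-\varphi_1[\varphi_1x,y]-\varphi_1[x,\varphi_1y]$, $d\eta_1(x,y)=(\nabla_x\eta_1)y-(\nabla_y\eta_1)x$;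 "$N_1$ is a 3-form" refers to $N_1(x,y,z)=g(N_1(x,y),z)$. Basic classes (Alexiev–Ganchev classification), with $\theta_1(z)=g^{ij}F_1(e_i,e_j,z)$: $\mathcal P_2$: $F_1(x,y,z)=\frac{\theta_1(\xi_1)}{2(2n+1)}\{g(x,y)\eta_1(z)-g(x,z)\eta_1(y)\}$; $\mathcal P_4$: $F_1(x,y,z)=F_1(x,y,\xi_1)\eta_1(z)-F_1(x,z,\xi_1)\eta_1(y)$, $F_1(x,y,\xi_1)=F_1(y,x,\xi_1)=F_1(\varphi_1x,\varphi_1y,\xi_1)$, $\theta_1=0$; $\mathcal P_9$: $F_1(x,y,z)=\frac1{4n}\{g(\varphi_1x,y)\theta_1(\varphi_1z)-g(\varphi_1x,z)\theta_1(\varphi_1y)-g(\varphi_1x,\varphi_1y)\theta_1(\varphi_1^2z)+g(\varphi_1x,\varphi_1z)\theta_1(\varphi_1^2y)\}$; $\mathcal P_{10}$: $F_1(\xi_1,y,z)=F_1(x,y,\xi_1)=0$, $F_1(x,y,z)=F_1(\varphi_1x,\varphi_1y,z)$, $\theta_1=0$; $\mathcal P_{11}$: $F_1(\xi_1,y,z)=F_1(x,y,\xi_1)=0$, $F_1(x,y,z)=-F_1(y,x,z)$. A manifold belongs to a direct sum of classes if $F_1$ is a sum of tensors having the algebraic properties of $F_1$ (namely $F_1(x,y,z)=-F_1(x,z,y)=-F_1(x,\varphi_1y,\varphi_1z)+F_1(x,\xi_1,z)\eta_1(y)+F_1(x,y,\xi_1)\eta_1(z)$) and satisfying the respective class cond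itions.
   Formalization: The displayed equation in (i) does not force F_1(ξ_1,y,z)=0, which all five classes satisfy, so (i) as printed is inconsistent; (i) is taken as the equation, and membership in P2+P4+P9+P10+P11 is proved equivalent to the equation together with F_1(ξ_1,·,·)=0. *)

theory Defs
  imports "HOL-Analysis.Analysis"
begin

section \<open>Smooth manifolds, functions and vector fields\<close>

primrec Ck_on :: "nat \<Rightarrow> 'a::real_normed_vector set \<Rightarrow> ('a \<Rightarrow> 'b::real_normed_vector) \<Rightarrow> bool" where
  "Ck_on 0 S f \<longleftrightarrow> continuous_on S f"
| "Ck_on (Suc k) S f \<longleftrightarrow> (\<forall>x\<in>S. f differentiable (at x)) \<and>
     (\<forall>v. Ck_on k S (\<lambda>x. frechet_derivative f (at x) v))"

text \<open>Only used for open \<open>S\<close>.\<close>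

definition smooth_on :: "'a::real_normed_vector set \<Rightarrow> ('a \<Rightarrow> 'b::real_normed_vector) \<Rightarrow> bool" where
  "smooth_on S f \<longleftrightarrow> (\<forall>k. Ck_on k S f)"

text \<open>A chart is a pair (domain, coordinate map). The manifold is the whole type \<open>'m\<close>, which in
  the theorem is Hausdorff and second countable; its dimension is \<open>DIM('e)\<close>.\<close>

type_synonym ('m, 'e) chart = "'m set \<times> ('m \<Rightarrow> 'e)"

abbreviation chart_inv :: "('m, 'e) chart \<Rightarrow> 'e \<Rightarrow> 'm" where
  "chart_inv c \<equiv> inv_into (fst c) (snd c)"

abbreviation chart_img :: "('m, 'e) chart \<Rightarrow> 'e set" where
  "chart_img c \<equiv> snd c ` fst c"

definition smooth_atlas ::
    "('m::topological_space, 'e::euclidean_space) chart set \<Rightarrow> bool" where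
  "smooth_atlas A \<longleftrightarrow>
     (\<Union>c\<in>A. fst c) = UNIV \<and>
     (\<forall>c\<in>A. open (fst c) \<and> open (chart_img c) \<and>
        homeomorphism (fst c) (chart_img c) (snd c) (chart_inv c)) \<and>
     (\<forall>c\<in>A. \<forall>d\<in>A. smooth_on (snd c ` (fst c \<inter> fst d)) (snd d \<circ> chart_inv c))"

definition chart_at :: "('m, 'e) chart set \<Rightarrow> 'm \<Rightarrow> ('m, 'e) chart" where
  "chart_at A p = (SOME c. c \<in> A \<and> p \<in> fst c)"

text \<open>For every point \<open>p\<close> the tangent space at \<open>p\<close> is identified with \<open>'e\<close> through the chart
  \<open>chart_at A p\<close>. A field on the manifold is therefore a function of \<open>p\<close>, but since the
  identification changes from point to point, smoothness has to be tested on the coordinate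
  representatives with respect to one fixed chart at a time. The components of a tangent vector
  \<open>v\<close> at \<open>p\<close> in an arbitrary chart \<open>c\<close> are \<open>tangent_coord A c p v\<close>.\<close>

definition tangent_coord ::
    "('m, 'e::real_normed_vector) chart set \<Rightarrow> ('m, 'e) chart \<Rightarrow> 'm \<Rightarrow> 'e \<Rightarrow> 'e" where
  "tangent_coord A c p v =
     frechet_derivative (snd c \<circ> chart_inv (chart_at A p)) (at (snd (chart_at A p) p)) v"

definition local_rep ::
    "('m, 'e::real_normed_vector) chart set \<Rightarrow> ('m, 'e) chart \<Rightarrow> ('m \<Rightarrow> 'e) \<Rightarrow> 'e \<Rightarrow> 'e" where
  "local_rep A c X u = tangent_coord A c (chart_inv c u) (X (chart_inv c u))"

definition smooth_fun ::
    "('m, 'e::real_normed_vector) chart set \<Rightarrow> ('m \<Rightarrow> real) \<Rightarrow> bool" where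
  "smooth_fun A f \<longleftrightarrow> (\<forall>c\<in>A. smooth_on (chart_img c) (f \<circ> chart_inv c))"

definition vector_field ::
    "('m, 'e::real_normed_vector) chart set \<Rightarrow> ('m \<Rightarrow> 'e) \<Rightarrow> bool" where
  "vector_field A X \<longleftrightarrow> (\<forall>c\<in>A. smooth_on (chart_img c) (local_rep A c X))"

text \<open>The derivative \<open>X f\<close> of a function along a vector field.\<close>

definition vf_deriv ::
    "('m, 'e::real_normed_vector) chart set \<Rightarrow> ('m \<Rightarrow> 'e) \<Rightarrow> ('m \<Rightarrow> real) \<Rightarrow> 'm \<Rightarrow> real" where
  "vf_deriv A X f p =
     frechet_derivative (f \<circ> chart_inv (chart_at A p)) (at (snd (chart_at A p) p)) (X p)"

text \<open>The Lie bracket, by the coordinate formula \<open>[X,Y]\<^sup>i = X\<^sup>j \<partial>\<^sub>j Y\<^sup>i - Y\<^sup>j \<partial>\<^sub>j X\<^sup>i\<close> in the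
  chart \<open>chart_at A p\<close>.\<close>

definition lie_bracket ::
    "('m, 'e::real_normed_vector) chart set \<Rightarrow> ('m \<Rightarrow> 'e) \<Rightarrow> ('m \<Rightarrow> 'e) \<Rightarrow> 'm \<Rightarrow> 'e" where
  "lie_bracket A X Y p =
     frechet_derivative (local_rep A (chart_at A p) Y) (at (snd (chart_at A p) p)) (X p) -
     frechet_derivative (local_rep A (chart_at A p) X) (at (snd (chart_at A p) p)) (Y p)"

section \<open>Tensor fields, metrics and connections\<close>

text \<open>Fields of endomorphisms and one-forms have types \<open>'m \<Rightarrow> 'e \<Rightarrow> 'e\<close> and \<open>'m \<Rightarrow> 'e \<Rightarrow> real\<close>;
  \<open>ap1\<close> and \<open>ap2\<close> evaluate tensor fields on vector fields pointwise. Smoothness of a tensor field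
  means that it sends smooth vector fields to smooth objects.\<close>

definition ap1 :: "('m \<Rightarrow> 'e \<Rightarrow> 'b) \<Rightarrow> ('m \<Rightarrow> 'e) \<Rightarrow> 'm \<Rightarrow> 'b" where
  "ap1 T X = (\<lambda>p. T p (X p))"

definition ap2 :: "('m \<Rightarrow> 'e \<Rightarrow> 'e \<Rightarrow> 'b) \<Rightarrow> ('m \<Rightarrow> 'e) \<Rightarrow> ('m \<Rightarrow> 'e) \<Rightarrow> 'm \<Rightarrow> 'b" where
  "ap2 T X Y = (\<lambda>p. T p (X p) (Y p))"

definition endo_field ::
    "('m, 'e::real_normed_vector) chart set \<Rightarrow> ('m \<Rightarrow> 'e \<Rightarrow> 'e) \<Rightarrow> bool" where
  "endo_field A \<phi> \<longleftrightarrow> (\<forall>p. linear (\<phi> p)) \<and> (\<forall>X. vector_field A X \<longrightarrow> vector_field A (ap1 \<phi> X))"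

definition one_form ::
    "('m, 'e::real_normed_vector) chart set \<Rightarrow> ('m \<Rightarrow> 'e \<Rightarrow> real) \<Rightarrow> bool" where
  "one_form A \<eta> \<longleftrightarrow> (\<forall>p. linear (\<eta> p)) \<and> (\<forall>X. vector_field A X \<longrightarrow> smooth_fun A (ap1 \<eta> X))"

definition pseudo_riemannian_metric ::
    "('m, 'e::real_normed_vector) chart set \<Rightarrow> ('m \<Rightarrow> 'e \<Rightarrow> 'e \<Rightarrow> real) \<Rightarrow> bool" where
  "pseudo_riemannian_metric A g \<longleftrightarrow>
     (\<forall>p. bilinear (g p) \<and> (\<forall>v w. g p v w = g p w v) \<and>
          (\<forall>v. (\<forall>w. g p v w = 0) \<longrightarrow> v = 0)) \<and>
     (\<forall>X Y. vector_field A X \<longrightarrow> vector_field A Y \<longrightarrow> smooth_fun A (ap2 g X Y))"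

text \<open>A connection is only meaningful on (smooth) vector fields; its values on other functions are
  unconstrained.\<close>

type_synonym ('m, 'e) connection = "('m \<Rightarrow> 'e) \<Rightarrow> ('m \<Rightarrow> 'e) \<Rightarrow> 'm \<Rightarrow> 'e"

definition affine_connection ::
    "('m, 'e::real_normed_vector) chart set \<Rightarrow> ('m, 'e) connection \<Rightarrow> bool" where
  "affine_connection A D \<longleftrightarrow>
     (\<forall>X Y. vector_field A X \<longrightarrow> vector_field A Y \<longrightarrow> vector_field A (D X Y)) \<and>
     (\<forall>X X' Y. vector_field A X \<longrightarrow> vector_field A X' \<longrightarrow> vector_field A Y \<longrightarrow>
        D (\<lambda>p. X p + X' p) Y = (\<lambda>p. D X Y p + D X' Y p)) \<and>
     (\<forall>f X Y. smooth_fun A f \<longrightarrow> vector_field A X \<longrightarrow> vector_field A Y \<longrightarrow>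
        D (\<lambda>p. f p *\<^sub>R X p) Y = (\<lambda>p. f p *\<^sub>R D X Y p)) \<and>
     (\<forall>X Y Y'. vector_field A X \<longrightarrow> vector_field A Y \<longrightarrow> vector_field A Y' \<longrightarrow>
        D X (\<lambda>p. Y p + Y' p) = (\<lambda>p. D X Y p + D X Y' p)) \<and>
     (\<forall>f X Y. smooth_fun A f \<longrightarrow> vector_field A X \<longrightarrow> vector_field A Y \<longrightarrow>
        D X (\<lambda>p. f p *\<^sub>R Y p) = (\<lambda>p. vf_deriv A X f p *\<^sub>R Y p + f p *\<^sub>R D X Y p))"

definition cov_endo ::
    "('m, 'e::real_normed_vector) connection \<Rightarrow> ('m \<Rightarrow> 'e \<Rightarrow> 'e) \<Rightarrow>
     ('m \<Rightarrow> 'e) \<Rightarrow> ('m \<Rightarrow> 'e) \<Rightarrow> 'm \<Rightarrow> 'e" where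
  "cov_endo D \<phi> X Y = (\<lambda>p. D X (ap1 \<phi> Y) p - \<phi> p (D X Y p))"

definition cov_form ::
    "('m, 'e::real_normed_vector) chart set \<Rightarrow> ('m, 'e) connection \<Rightarrow> ('m \<Rightarrow> 'e \<Rightarrow> real) \<Rightarrow>
     ('m \<Rightarrow> 'e) \<Rightarrow> ('m \<Rightarrow> 'e) \<Rightarrow> 'm \<Rightarrow> real" where
  "cov_form A D \<eta> X Y = (\<lambda>p. vf_deriv A X (ap1 \<eta> Y) p - \<eta> p (D X Y p))"

definition cov_metric ::
    "('m, 'e::real_normed_vector) chart set \<Rightarrow> ('m, 'e) connection \<Rightarrow> ('m \<Rightarrow> 'e \<Rightarrow> 'e \<Rightarrow> real) \<Rightarrow>
     ('m \<Rightarrow> 'e) \<Rightarrow> ('m \<Rightarrow> 'e) \<Rightarrow> ('m \<Rightarrow> 'e) \<Rightarrow> 'm \<Rightarrow> real" where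
  "cov_metric A D g X Y Z =
     (\<lambda>p. vf_deriv A X (ap2 g Y Z) p - g p (D X Y p) (Z p) - g p (Y p) (D X Z p))"

definition parallel_metric ::
    "('m, 'e::real_normed_vector) chart set \<Rightarrow> ('m, 'e) connection \<Rightarrow>
     ('m \<Rightarrow> 'e \<Rightarrow> 'e \<Rightarrow> real) \<Rightarrow> bool" where
  "parallel_metric A D g \<longleftrightarrow>
     (\<forall>X Y Z. vector_field A X \<longrightarrow> vector_field A Y \<longrightarrow> vector_field A Z \<longrightarrow>
        cov_metric A D g X Y Z = (\<lambda>p. 0))"

definition torsion ::
    "('m, 'e::real_normed_vector) chart set \<Rightarrow> ('m, 'e) connection \<Rightarrow>
     ('m \<Rightarrow> 'e) \<Rightarrow> ('m \<Rightarrow> 'e) \<Rightarrow> 'm \<Rightarrow> 'e" where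
  "torsion A D X Y = (\<lambda>p. D X Y p - D Y X p - lie_bracket A X Y p)"

definition torsion3 ::
    "('m, 'e::real_normed_vector) chart set \<Rightarrow> ('m, 'e) connection \<Rightarrow> ('m \<Rightarrow> 'e \<Rightarrow> 'e \<Rightarrow> real) \<Rightarrow>
     ('m \<Rightarrow> 'e) \<Rightarrow> ('m \<Rightarrow> 'e) \<Rightarrow> ('m \<Rightarrow> 'e) \<Rightarrow> 'm \<Rightarrow> real" where
  "torsion3 A D g X Y Z = (\<lambda>p. g p (torsion A D X Y p) (Z p))"

definition levi_civita ::
    "('m, 'e::real_normed_vector) chart set \<Rightarrow> ('m \<Rightarrow> 'e \<Rightarrow> 'e \<Rightarrow> real) \<Rightarrow>
     ('m, 'e) connection \<Rightarrow> bool" where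
  "levi_civita A g D \<longleftrightarrow> affine_connection A D \<and> parallel_metric A D g \<and>
     (\<forall>X Y. vector_field A X \<longrightarrow> vector_field A Y \<longrightarrow> torsion A D X Y = (\<lambda>p. 0))"

definition lie_deriv_metric ::
    "('m, 'e::real_normed_vector) chart set \<Rightarrow> ('m \<Rightarrow> 'e) \<Rightarrow> ('m \<Rightarrow> 'e \<Rightarrow> 'e \<Rightarrow> real) \<Rightarrow>
     ('m \<Rightarrow> 'e) \<Rightarrow> ('m \<Rightarrow> 'e) \<Rightarrow> 'm \<Rightarrow> real" where
  "lie_deriv_metric A V g X Y =
     (\<lambda>p. vf_deriv A V (ap2 g X Y) p - g p (lie_bracket A V X p) (Y p)
          - g p (X p) (lie_bracket A V Y p))"

definition killing ::
    "('m, 'e::real_normed_vector) chart set \<Rightarrow> ('m \<Rightarrow> 'e \<Rightarrow> 'e \<Rightarrow> real) \<Rightarrow> ('m \<Rightarrow> 'e) \<Rightarrow> bool" where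
  "killing A g V \<longleftrightarrow> vector_field A V \<and>
     (\<forall>X Y. vector_field A X \<longrightarrow> vector_field A Y \<longrightarrow> lie_deriv_metric A V g X Y = (\<lambda>p. 0))"

text \<open>Total skew-symmetry of a (0,3)-tensor field given by its values on vector fields (all
  instances below are function-linear in each argument).\<close>

definition is_3form ::
    "('m, 'e::real_normed_vector) chart set \<Rightarrow>
     (('m \<Rightarrow> 'e) \<Rightarrow> ('m \<Rightarrow> 'e) \<Rightarrow> ('m \<Rightarrow> 'e) \<Rightarrow> 'm \<Rightarrow> real) \<Rightarrow> bool" where
  "is_3form A T \<longleftrightarrow>
     (\<forall>X Y Z. vector_field A X \<longrightarrow> vector_field A Y \<longrightarrow> vector_field A Z \<longrightarrow>
        (\<forall>p. T X Y Z p = - T Y X Z p \<and> T X Y Z p = - T X Z Y p))"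

section \<open>Almost contact metric structures\<close>

text \<open>The Reeb field is time-like: \<open>g(\<xi>,\<xi>) = -1\<close>, and \<open>g\<close> has the sign conventions below.\<close>

definition almost_contact_metric ::
    "('m, 'e::real_normed_vector) chart set \<Rightarrow> ('m \<Rightarrow> 'e \<Rightarrow> 'e) \<Rightarrow> ('m \<Rightarrow> 'e) \<Rightarrow>
     ('m \<Rightarrow> 'e \<Rightarrow> real) \<Rightarrow> ('m \<Rightarrow> 'e \<Rightarrow> 'e \<Rightarrow> real) \<Rightarrow> bool" where
  "almost_contact_metric A \<phi> \<xi> \<eta> g \<longleftrightarrow>
     endo_field A \<phi> \<and> vector_field A \<xi> \<and> one_form A \<eta> \<and> pseudo_riemannian_metric A g \<and>
     (\<forall>p v. \<phi> p (\<phi> p v) = - v + \<eta> p v *\<^sub>R \<xi> p) \<and>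
     (\<forall>p. \<phi> p (\<xi> p) = 0) \<and>
     (\<forall>p v. \<eta> p (\<phi> p v) = 0) \<and>
     (\<forall>p. \<eta> p (\<xi> p) = 1) \<and>
     (\<forall>p v w. g p (\<phi> p v) (\<phi> p w) = g p v w + \<eta> p v * \<eta> p w) \<and>
     (\<forall>p. g p (\<xi> p) (\<xi> p) = - 1) \<and>
     (\<forall>p v. \<eta> p v = - g p (\<xi> p) v)"

definition fund_F ::
    "('m, 'e::real_normed_vector) connection \<Rightarrow> ('m \<Rightarrow> 'e \<Rightarrow> 'e) \<Rightarrow> ('m \<Rightarrow> 'e \<Rightarrow> 'e \<Rightarrow> real) \<Rightarrow>
     ('m \<Rightarrow> 'e) \<Rightarrow> ('m \<Rightarrow> 'e) \<Rightarrow> ('m \<Rightarrow> 'e) \<Rightarrow> 'm \<Rightarrow> real" where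
  "fund_F D \<phi> g X Y Z = (\<lambda>p. g p (cov_endo D \<phi> X Y p) (Z p))"

definition sym_bracket ::
    "('m, 'e::real_normed_vector) connection \<Rightarrow> ('m \<Rightarrow> 'e) \<Rightarrow> ('m \<Rightarrow> 'e) \<Rightarrow> 'm \<Rightarrow> 'e" where
  "sym_bracket D X Y = (\<lambda>p. D X Y p + D Y X p)"

definition sym_phi_phi ::
    "('m, 'e::real_normed_vector) connection \<Rightarrow> ('m \<Rightarrow> 'e \<Rightarrow> 'e) \<Rightarrow>
     ('m \<Rightarrow> 'e) \<Rightarrow> ('m \<Rightarrow> 'e) \<Rightarrow> 'm \<Rightarrow> 'e" where
  "sym_phi_phi D \<phi> X Y =
     (\<lambda>p. sym_bracket D (ap1 \<phi> X) (ap1 \<phi> Y) p + \<phi> p (\<phi> p (sym_bracket D X Y p))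
          - \<phi> p (sym_bracket D (ap1 \<phi> X) Y p) - \<phi> p (sym_bracket D X (ap1 \<phi> Y) p))"

definition assoc_nijenhuis ::
    "('m, 'e::real_normed_vector) chart set \<Rightarrow> ('m, 'e) connection \<Rightarrow> ('m \<Rightarrow> 'e \<Rightarrow> 'e) \<Rightarrow>
     ('m \<Rightarrow> 'e) \<Rightarrow> ('m \<Rightarrow> 'e \<Rightarrow> 'e \<Rightarrow> real) \<Rightarrow> ('m \<Rightarrow> 'e) \<Rightarrow> ('m \<Rightarrow> 'e) \<Rightarrow> 'm \<Rightarrow> 'e" where
  "assoc_nijenhuis A D \<phi> \<xi> g X Y =
     (\<lambda>p. sym_phi_phi D \<phi> X Y p - lie_deriv_metric A \<xi> g X Y p *\<^sub>R \<xi> p)"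

definition phi_phi ::
    "('m, 'e::real_normed_vector) chart set \<Rightarrow> ('m \<Rightarrow> 'e \<Rightarrow> 'e) \<Rightarrow>
     ('m \<Rightarrow> 'e) \<Rightarrow> ('m \<Rightarrow> 'e) \<Rightarrow> 'm \<Rightarrow> 'e" where
  "phi_phi A \<phi> X Y =
     (\<lambda>p. \<phi> p (\<phi> p (lie_bracket A X Y p)) + lie_bracket A (ap1 \<phi> X) (ap1 \<phi> Y) p
          - \<phi> p (lie_bracket A (ap1 \<phi> X) Y p) - \<phi> p (lie_bracket A X (ap1 \<phi> Y) p))"

definition d_form ::
    "('m, 'e::real_normed_vector) chart set \<Rightarrow> ('m, 'e) connection \<Rightarrow> ('m \<Rightarrow> 'e \<Rightarrow> real) \<Rightarrow>
     ('m \<Rightarrow> 'e) \<Rightarrow> ('m \<Rightarrow> 'e) \<Rightarrow> 'm \<Rightarrow> real" where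
  "d_form A D \<eta> X Y = (\<lambda>p. cov_form A D \<eta> X Y p - cov_form A D \<eta> Y X p)"

definition nijenhuis ::
    "('m, 'e::real_normed_vector) chart set \<Rightarrow> ('m, 'e) connection \<Rightarrow> ('m \<Rightarrow> 'e \<Rightarrow> 'e) \<Rightarrow>
     ('m \<Rightarrow> 'e) \<Rightarrow> ('m \<Rightarrow> 'e \<Rightarrow> real) \<Rightarrow> ('m \<Rightarrow> 'e) \<Rightarrow> ('m \<Rightarrow> 'e) \<Rightarrow> 'm \<Rightarrow> 'e" where
  "nijenhuis A D \<phi> \<xi> \<eta> X Y = (\<lambda>p. phi_phi A \<phi> X Y p + d_form A D \<eta> X Y p *\<^sub>R \<xi> p)"

definition nijenhuis3 ::
    "('m, 'e::real_normed_vector) chart set \<Rightarrow> ('m, 'e) connection \<Rightarrow> ('m \<Rightarrow> 'e \<Rightarrow> 'e) \<Rightarrow>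
     ('m \<Rightarrow> 'e) \<Rightarrow> ('m \<Rightarrow> 'e \<Rightarrow> real) \<Rightarrow> ('m \<Rightarrow> 'e \<Rightarrow> 'e \<Rightarrow> real) \<Rightarrow>
     ('m \<Rightarrow> 'e) \<Rightarrow> ('m \<Rightarrow> 'e) \<Rightarrow> ('m \<Rightarrow> 'e) \<Rightarrow> 'm \<Rightarrow> real" where
  "nijenhuis3 A D \<phi> \<xi> \<eta> g X Y Z = (\<lambda>p. g p (nijenhuis A D \<phi> \<xi> \<eta> X Y p) (Z p))"

definition natural_connection ::
    "('m, 'e::real_normed_vector) chart set \<Rightarrow> ('m \<Rightarrow> 'e \<Rightarrow> 'e) \<Rightarrow> ('m \<Rightarrow> 'e) \<Rightarrow>
     ('m \<Rightarrow> 'e \<Rightarrow> real) \<Rightarrow> ('m \<Rightarrow> 'e \<Rightarrow> 'e \<Rightarrow> real) \<Rightarrow> ('m, 'e) connection \<Rightarrow> bool" where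
  "natural_connection A \<phi> \<xi> \<eta> g D \<longleftrightarrow>
     affine_connection A D \<and>
     (\<forall>X Y. vector_field A X \<longrightarrow> vector_field A Y \<longrightarrow> cov_endo D \<phi> X Y = (\<lambda>p. 0)) \<and>
     (\<forall>X. vector_field A X \<longrightarrow> D X \<xi> = (\<lambda>p. 0)) \<and>
     (\<forall>X Y. vector_field A X \<longrightarrow> vector_field A Y \<longrightarrow> cov_form A D \<eta> X Y = (\<lambda>p. 0)) \<and>
     parallel_metric A D g"

section \<open>The basic classes\<close>

text \<open>The classification is pointwise: the arguments \<open>f\<close>, \<open>x0\<close>, \<open>e\<close>, \<open>h\<close> below are the values of
  \<open>\<phi>\<close>, \<open>\<xi>\<close>, \<open>\<eta>\<close>, \<open>g\<close> at one point and \<open>S\<close> is a trilinear form on the tangent space there.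
  \<open>gram_inv h\<close> is the inverse \<open>g\<^sup>i\<^sup>j\<close> of the Gram matrix of \<open>h\<close> in the basis \<open>Basis\<close>.\<close>

definition gram_inv :: "('e::euclidean_space \<Rightarrow> 'e \<Rightarrow> real) \<Rightarrow> 'e \<Rightarrow> 'e \<Rightarrow> real" where
  "gram_inv h = (SOME m. \<forall>i\<in>Basis. \<forall>j\<in>Basis. (\<Sum>k\<in>Basis. m i k * h k j) = (if i = j then 1 else 0))"

definition theta ::
    "('e::euclidean_space \<Rightarrow> 'e \<Rightarrow> real) \<Rightarrow> ('e \<Rightarrow> 'e \<Rightarrow> 'e \<Rightarrow> real) \<Rightarrow> 'e \<Rightarrow> real" where
  "theta h S z = (\<Sum>i\<in>Basis. \<Sum>j\<in>Basis. gram_inv h i j * S i j z)"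

definition trilinear :: "('e::real_vector \<Rightarrow> 'e \<Rightarrow> 'e \<Rightarrow> real) \<Rightarrow> bool" where
  "trilinear S \<longleftrightarrow>
     (\<forall>y z. linear (\<lambda>x. S x y z)) \<and> (\<forall>x z. linear (\<lambda>y. S x y z)) \<and> (\<forall>x y. linear (\<lambda>z. S x y z))"

definition F_type ::
    "('e::real_vector \<Rightarrow> 'e) \<Rightarrow> 'e \<Rightarrow> ('e \<Rightarrow> real) \<Rightarrow> ('e \<Rightarrow> 'e \<Rightarrow> 'e \<Rightarrow> real) \<Rightarrow> bool" where
  "F_type f x0 e S \<longleftrightarrow> trilinear S \<and>
     (\<forall>x y z. S x y z = - S x z y) \<and>
     (\<forall>x y z. S x y z = - S x (f y) (f z) + S x x0 z * e y + S x y x0 * e z)"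

definition class_P2 ::
    "nat \<Rightarrow> 'e::euclidean_space \<Rightarrow> ('e \<Rightarrow> real) \<Rightarrow> ('e \<Rightarrow> 'e \<Rightarrow> real) \<Rightarrow>
     ('e \<Rightarrow> 'e \<Rightarrow> 'e \<Rightarrow> real) \<Rightarrow> bool" where
  "class_P2 n x0 e h S \<longleftrightarrow>
     (\<forall>x y z. S x y z = theta h S x0 / (2 * (2 * real n + 1)) * (h x y * e z - h x z * e y))"

definition class_P4 ::
    "('e::euclidean_space \<Rightarrow> 'e) \<Rightarrow> 'e \<Rightarrow> ('e \<Rightarrow> real) \<Rightarrow> ('e \<Rightarrow> 'e \<Rightarrow> real) \<Rightarrow>
     ('e \<Rightarrow> 'e \<Rightarrow> 'e \<Rightarrow> real) \<Rightarrow> bool" where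
  "class_P4 f x0 e h S \<longleftrightarrow>
     (\<forall>x y z. S x y z = S x y x0 * e z - S x z x0 * e y) \<and>
     (\<forall>x y. S x y x0 = S y x x0 \<and> S x y x0 = S (f x) (f y) x0) \<and>
     (\<forall>z. theta h S z = 0)"

text \<open>For \<open>n = 0\<close> the convention \<open>1 / 0 = 0\<close> makes the next class zero, which is its correct value
  in dimension 3.\<close>

definition class_P9 ::
    "nat \<Rightarrow> ('e::euclidean_space \<Rightarrow> 'e) \<Rightarrow> ('e \<Rightarrow> 'e \<Rightarrow> real) \<Rightarrow>
     ('e \<Rightarrow> 'e \<Rightarrow> 'e \<Rightarrow> real) \<Rightarrow> bool" where
  "class_P9 n f h S \<longleftrightarrow>
     (\<forall>x y z. S x y z = 1 / (4 * real n) *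
        (h (f x) y * theta h S (f z) - h (f x) z * theta h S (f y)
         - h (f x) (f y) * theta h S (f (f z)) + h (f x) (f z) * theta h S (f (f y))))"

definition class_P10 ::
    "('e::euclidean_space \<Rightarrow> 'e) \<Rightarrow> 'e \<Rightarrow> ('e \<Rightarrow> 'e \<Rightarrow> real) \<Rightarrow>
     ('e \<Rightarrow> 'e \<Rightarrow> 'e \<Rightarrow> real) \<Rightarrow> bool" where
  "class_P10 f x0 h S \<longleftrightarrow>
     (\<forall>y z. S x0 y z = 0) \<and> (\<forall>x y. S x y x0 = 0) \<and>
     (\<forall>x y z. S x y z = S (f x) (f y) z) \<and> (\<forall>z. theta h S z = 0)"

definition class_P11 :: "'e \<Rightarrow> ('e \<Rightarrow> 'e \<Rightarrow> 'e \<Rightarrow> real) \<Rightarrow> bool" where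
  "class_P11 x0 S \<longleftrightarrow>
     (\<forall>y z. S x0 y z = 0) \<and> (\<forall>x y. S x y x0 = 0) \<and> (\<forall>x y z. S x y z = - S y x z)"

definition in_class_P2_P4_P9_P10_P11 ::
    "nat \<Rightarrow> ('m, 'e::euclidean_space) chart set \<Rightarrow> ('m, 'e) connection \<Rightarrow> ('m \<Rightarrow> 'e \<Rightarrow> 'e) \<Rightarrow>
     ('m \<Rightarrow> 'e) \<Rightarrow> ('m \<Rightarrow> 'e \<Rightarrow> real) \<Rightarrow> ('m \<Rightarrow> 'e \<Rightarrow> 'e \<Rightarrow> real) \<Rightarrow> bool" where
  "in_class_P2_P4_P9_P10_P11 n A D \<phi> \<xi> \<eta> g \<longleftrightarrow>
     (\<forall>p. \<exists>S2 S4 S9 S10 S11.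
        (\<forall>S\<in>{S2, S4, S9, S10, S11}. F_type (\<phi> p) (\<xi> p) (\<eta> p) S) \<and>
        class_P2 n (\<xi> p) (\<eta> p) (g p) S2 \<and>
        class_P4 (\<phi> p) (\<xi> p) (\<eta> p) (g p) S4 \<and>
        class_P9 n (\<phi> p) (g p) S9 \<and>
        class_P10 (\<phi> p) (\<xi> p) (g p) S10 \<and>
        class_P11 (\<xi> p) S11 \<and>
        (\<forall>X Y Z. vector_field A X \<longrightarrow> vector_field A Y \<longrightarrow> vector_field A Z \<longrightarrow>
           fund_F D \<phi> g X Y Z p =
             S2 (X p) (Y p) (Z p) + S4 (X p) (Y p) (Z p) + S9 (X p) (Y p) (Z p) +
             S10 (X p) (Y p) (Z p) + S11 (X p) (Y p) (Z p)))"

text \<open>The equation that determines the class of manifolds in question. On an almost contact metric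
  manifold it does not force \<open>F(\<xi>,y,z) = 0\<close>, which holds in each of the five basic classes; so it is
  equivalent to the decomposition above only together with \<open>F(\<xi>,y,z) = 0\<close>.\<close>

definition F_equation ::
    "('m, 'e::real_normed_vector) chart set \<Rightarrow> ('m, 'e) connection \<Rightarrow> ('m \<Rightarrow> 'e \<Rightarrow> 'e) \<Rightarrow>
     ('m \<Rightarrow> 'e \<Rightarrow> 'e \<Rightarrow> real) \<Rightarrow> bool" where
  "F_equation A D \<phi> g \<longleftrightarrow>
     (\<forall>X Y Z. vector_field A X \<longrightarrow> vector_field A Y \<longrightarrow> vector_field A Z \<longrightarrow>
        (\<forall>p. fund_F D \<phi> g (ap1 \<phi> X) Y Z p + fund_F D \<phi> g (ap1 \<phi> Y) X Z p
           + fund_F D \<phi> g X Y (ap1 \<phi> Z) p + fund_F D \<phi> g Y X (ap1 \<phi> Z) p = 0))"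

definition T1_form ::
    "('m, 'e::real_normed_vector) connection \<Rightarrow> ('m \<Rightarrow> 'e \<Rightarrow> 'e) \<Rightarrow> ('m \<Rightarrow> 'e) \<Rightarrow>
     ('m \<Rightarrow> 'e \<Rightarrow> real) \<Rightarrow> ('m \<Rightarrow> 'e \<Rightarrow> 'e \<Rightarrow> real) \<Rightarrow>
     ('m \<Rightarrow> 'e) \<Rightarrow> ('m \<Rightarrow> 'e) \<Rightarrow> ('m \<Rightarrow> 'e) \<Rightarrow> 'm \<Rightarrow> real" where
  "T1_form D \<phi> \<xi> \<eta> g X Y Z =
     (\<lambda>p. fund_F D \<phi> g X Y (ap1 \<phi> Z) p - fund_F D \<phi> g Y X (ap1 \<phi> Z) p
          - fund_F D \<phi> g (ap1 \<phi> Z) X Y p + 2 * fund_F D \<phi> g X (ap1 \<phi> Y) \<xi> p * \<eta> p (Z p))"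

end

theory Submission
  imports Defs
begin

text \<open>Apart from the smoothness of the connection in (v), the theorem is about one trilinear form
  \<open>F\<close> on each tangent space, with \<open>F(x,y,z) = -F(x,z,y)\<close> and
  \<open>F(x, \<phi> y, z) = F(x, y, \<phi> z) + K(x,y) \<eta>(z) + \<eta>(y) K(x,z)\<close>, where
  \<open>K(x,y) = F(x, \<phi> y, \<xi>) = g(\<nabla>\<^sub>x \<xi>, y)\<close>; the field \<open>\<xi>\<close> is Killing iff \<open>K\<close> is skew.

  Condition (iii). Lowering the index of \<open>{\<phi>,\<phi>}\<close> gives exactly the left-hand side of the class equation,
  and the class equation forces \<open>K\<close> to be skew (\<open>class_equation_K_skew\<close>). For Killing \<open>\<xi>\<close>, (ii) is the same as (iii).

  Condition (iv). Put \<open>c(x,y,z) = F(\<phi> x, y, z) + F(x, y, \<phi> z) + K(x,y) \<eta>(z)\<close>. This is always skew in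
  \<open>y, z\<close>, and \<open>N(x,y,z) = c(x,y,z) - c(y,x,z)\<close>. For skew \<open>K\<close> the class equation says that \<open>c\<close> is skew in \<open>x, y\<close>,
  that is, alternating, and this is equivalent to \<open>N\<close> being alternating (\<open>class_equation_iff_Nij\<close>).

  Condition (v). A metric connection with skew torsion \<open>T\<close> is \<open>\<nabla> + T/2\<close>, and it preserves \<open>\<phi>\<close> iff
  \<open>2 F(x,y,z) + T(x, \<phi> y, z) + T(x, y, \<phi> z) = 0\<close>. Substituting this in the class equation makes everything
  cancel (\<open>natural_skew_imp_F_equation\<close>), and together with \<open>\<nabla>\<^sup>* \<xi> = 0\<close> it determines \<open>T\<close>
  (\<open>natural_skew_unique\<close>). Conversely the class equation makes \<open>T\<^sub>1\<close> a \<open>3\<close>-form (\<open>T1_skew23\<close>) that satisfies this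
  identity (\<open>T1_parallel\<close>). That \<open>\<nabla> + T\<^sub>1/2\<close> maps smooth fields to smooth fields rests on the smoothness of the
  inverse of the Gram matrix (\<open>vector_field_of_smooth_pairings\<close>).

  Condition (i). If \<open>F(\<xi>,\<cdot>,\<cdot>) = 0\<close> in addition, \<open>B = F(\<cdot>,\<cdot>,\<xi>)\<close> is symmetric and \<open>\<phi>\<close>-invariant. The multiple of
  the horizontal metric with the same trace as \<open>B\<close> gives the component in \<open>P\<^sub>2\<close>, and the trace-free rest of \<open>B\<close> the
  component in \<open>P\<^sub>4\<close>. What is left of \<open>F\<close> is horizontal; under \<open>(x,y) \<mapsto> (\<phi> x, \<phi> y)\<close> it splits into an anti-invariant
  part, which is a \<open>3\<close>-form (\<open>P\<^sub>1\<^sub>1\<close>), and an invariant part, which splits by its trace into \<open>P\<^sub>9\<close> and \<open>P\<^sub>1\<^sub>0\<close>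
  (\<open>five_classes_decomposition\<close>).

  To pass from fields to points one needs that every tangent vector is the value of a global smooth field and that forms
  linear over the smooth functions are pointwise. Both follow from bump functions supported in a chart.\<close>

section \<open>Calculus of smooth maps\<close>

lemma Ck_on_Suc_iff:
  "Ck_on (Suc k) S f \<longleftrightarrow> (\<forall>x\<in>S. f differentiable (at x)) \<and>
     (\<forall>v. Ck_on k S (\<lambda>x. frechet_derivative f (at x) v))"
  by (rule Ck_on.simps(2))

lemma Ck_on_Suc_frechet_derivative:
  "Ck_on (Suc k) S f \<Longrightarrow> Ck_on k S (\<lambda>x. frechet_derivative f (at x) v)"
  unfolding Ck_on_Suc_iff by blast

lemma has_derivative_cong_on_open:
  assumes "open S" "x \<in> S" "\<And>y. y \<in> S \<Longrightarrow> f y = g y"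
  shows "(f has_derivative D) (at x) \<longleftrightarrow> (g has_derivative D) (at x)"
proof
  show "(g has_derivative D) (at x)" if "(f has_derivative D) (at x)"
    using that assms by (rule has_derivative_transform_within_open)
  show "(f has_derivative D) (at x)" if "(g has_derivative D) (at x)"
    using that assms(1,2) by (rule has_derivative_transform_within_open) (rule assms(3)[symmetric])
qed

lemma frechet_derivative_cong_on_open:
  assumes "open S" "x \<in> S" "\<And>y. y \<in> S \<Longrightarrow> f y = g y"
  shows "frechet_derivative f (at x) = frechet_derivative g (at x)"
  unfolding frechet_derivative_def using has_derivative_cong_on_open[of S x f g, OF assms] by simp

lemma differentiable_cong_on_open:
  assumes "open S" "x \<in> S" "\<And>y. y \<in> S \<Longrightarrow> f y = g y"
  shows "f differentiable (at x) \<longleftrightarrow> g differentiable (at x)"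
  unfolding differentiable_def using has_derivative_cong_on_open[of S x f g, OF assms] by simp

lemma Ck_on_cong:
  assumes "open S" "\<And>x. x \<in> S \<Longrightarrow> f x = g x" "Ck_on k S f"
  shows "Ck_on k S g"
  using assms(2,3)
proof (induction k arbitrary: f g)
  case 0
  then show ?case using continuous_on_cong[OF refl, of S f g] by simp
next
  case (Suc k)
  note fg = Suc.prems(1)
  have "Ck_on k S (\<lambda>x. frechet_derivative g (at x) v)" for v
  proof (rule Suc.IH)
    show "frechet_derivative f (at x) v = frechet_derivative g (at x) v" if "x \<in> S" for x
      by (rule fun_cong[OF frechet_derivative_cong_on_open[of S _ f g, OF assms(1) that fg]])
    show "Ck_on k S (\<lambda>x. frechet_derivative f (at x) v)"
      by (rule Ck_on_Suc_frechet_derivative[OF Suc.prems(2)])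
  qed
  moreover have "g differentiable (at x)" if "x \<in> S" for x
    using differentiable_cong_on_open[of S _ f g, OF assms(1) that fg] Suc.prems(2) that
    unfolding Ck_on_Suc_iff by blast
  ultimately show ?case unfolding Ck_on_Suc_iff by blast
qed

lemma Ck_on_subset:
  assumes "Ck_on k S f" "T \<subseteq> S"
  shows "Ck_on k T f"
  using assms(1)
proof (induction k arbitrary: f)
  case 0
  then show ?case using assms(2) continuous_on_subset by simp
next
  case (Suc k)
  have "Ck_on k T (\<lambda>x. frechet_derivative f (at x) v)" for v
    by (rule Suc.IH[OF Ck_on_Suc_frechet_derivative[OF Suc.prems]])
  moreover have "\<forall>x\<in>T. f differentiable (at x)"
    using Suc.prems assms(2) unfolding Ck_on_Suc_iff by blast
  ultimately show ?case unfolding Ck_on_Suc_iff by blast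
qed

lemma Ck_on_local:
  assumes "\<And>x. x \<in> S \<Longrightarrow> \<exists>U. open U \<and> x \<in> U \<and> Ck_on k U f"
  shows "Ck_on k S f"
  using assms
proof (induction k arbitrary: f)
  case 0
  show ?case
    unfolding Ck_on.simps
  proof (rule continuous_at_imp_continuous_on, rule ballI)
    fix x assume "x \<in> S"
    then obtain U where "open U" "x \<in> U" "continuous_on U f"
      using 0 unfolding Ck_on.simps by blast
    then show "isCont f x" using continuous_on_eq_continuous_at by blast
  qed
next
  case (Suc k)
  have "Ck_on k S (\<lambda>x. frechet_derivative f (at x) v)" for v
  proof (rule Suc.IH)
    fix x assume "x \<in> S"
    then obtain U where "open U" "x \<in> U" "Ck_on (Suc k) U f" using Suc.prems by blast
    then show "\<exists>U. open U \<and> x \<in> U \<and> Ck_on k U (\<lambda>x. frechet_derivative f (at x) v)"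
      using Ck_on_Suc_frechet_derivative by blast
  qed
  moreover have "\<forall>x\<in>S. f differentiable (at x)"
    using Suc.prems unfolding Ck_on_Suc_iff by blast
  ultimately show ?case unfolding Ck_on_Suc_iff by blast
qed

lemma Ck_on_SucD: "Ck_on (Suc k) S f \<Longrightarrow> Ck_on k S f"
proof (induction k arbitrary: f)
  case 0
  then have "\<forall>x\<in>S. isCont f x"
    by (simp add: differentiable_imp_continuous_within)
  then show ?case by (simp add: continuous_at_imp_continuous_on)
next
  case (Suc k)
  have "Ck_on k S (\<lambda>x. frechet_derivative f (at x) v)" for v
    by (rule Suc.IH[OF Ck_on_Suc_frechet_derivative[OF Suc.prems]])
  moreover have "\<forall>x\<in>S. f differentiable (at x)"
    using Suc.prems unfolding Ck_on_Suc_iff[of "Suc k"] by blast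
  ultimately show ?case unfolding Ck_on_Suc_iff by blast
qed

lemma Ck_on_const: "Ck_on k S (\<lambda>x. c)"
  by (induction k arbitrary: c) (simp_all add: frechet_derivative_const)

lemma Ck_on_id: "Ck_on k S (\<lambda>x. x)"
  by (cases k) (simp_all add: Ck_on_const)

lemma Ck_on_Suc_has_derivative:
  assumes "Ck_on (Suc k) S f" "x \<in> S"
  shows "(f has_derivative frechet_derivative f (at x)) (at x)"
  using assms by (simp add: frechet_derivative_works)

text \<open>The way in which membership in \<open>C\<^sup>k\<^sup>+\<^sup>1\<close> is established below: exhibit the
  derivative by a formula whose directional values are \<open>C\<^sup>k\<close>.\<close>

lemma Ck_on_SucI:
  assumes "open S" "\<And>x. x \<in> S \<Longrightarrow> (f has_derivative f' x) (at x)"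
    and "\<And>v. Ck_on k S (\<lambda>x. f' x v)"
  shows "Ck_on (Suc k) S f"
proof -
  have "Ck_on k S (\<lambda>x. frechet_derivative f (at x) v)" for v
  proof (rule Ck_on_cong[OF assms(1) _ assms(3)[of v]])
    show "f' x v = frechet_derivative f (at x) v" if "x \<in> S" for x
      using frechet_derivative_at[OF assms(2)[OF that]] by (rule fun_cong)
  qed
  moreover have "\<forall>x\<in>S. f differentiable (at x)"
    using assms(2) unfolding differentiable_def by blast
  ultimately show ?thesis unfolding Ck_on_Suc_iff by blast
qed

lemma Ck_on_add:
  assumes "open S" "Ck_on k S f" "Ck_on k S g"
  shows "Ck_on k S (\<lambda>x. f x + g x)"
  using assms(2,3)
proof (induction k arbitrary: f g)
  case 0
  then show ?case by (simp add: continuous_on_add)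
next
  case (Suc k)
  show ?case
  proof (rule Ck_on_SucI[OF assms(1)])
    show "((\<lambda>x. f x + g x) has_derivative
        (\<lambda>v. frechet_derivative f (at x) v + frechet_derivative g (at x) v)) (at x)"
      if "x \<in> S" for x
      by (rule has_derivative_add[OF Ck_on_Suc_has_derivative Ck_on_Suc_has_derivative,
            OF Suc.prems(1) that Suc.prems(2) that])
    show "Ck_on k S (\<lambda>x. frechet_derivative f (at x) v + frechet_derivative g (at x) v)" for v
      by (rule Suc.IH[OF Ck_on_Suc_frechet_derivative Ck_on_Suc_frechet_derivative, OF Suc.prems])
  qed
qed

lemma Ck_on_bounded_bilinear:
  assumes B: "bounded_bilinear B" and "open S" "Ck_on k S f" "Ck_on k S g"
  shows "Ck_on k S (\<lambda>x. B (f x) (g x))"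
  using assms(3,4)
proof (induction k arbitrary: f g)
  case 0
  then show ?case by (simp add: bounded_bilinear.continuous_on[OF B])
next
  case (Suc k)
  show ?case
  proof (rule Ck_on_SucI[OF assms(2)])
    show "((\<lambda>x. B (f x) (g x)) has_derivative
        (\<lambda>v. B (f x) (frechet_derivative g (at x) v) + B (frechet_derivative f (at x) v) (g x))) (at x)"
      if "x \<in> S" for x
      by (rule bounded_bilinear.FDERIV[OF B Ck_on_Suc_has_derivative Ck_on_Suc_has_derivative,
            OF Suc.prems(1) that Suc.prems(2) that])
    show "Ck_on k S (\<lambda>x. B (f x) (frechet_derivative g (at x) v) + B (frechet_derivative f (at x) v) (g x))" for v
      by (intro Ck_on_add assms(2) Suc.IH Ck_on_Suc_frechet_derivative Suc.prems
          Ck_on_SucD[OF Suc.prems(1)] Ck_on_SucD[OF Suc.prems(2)])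
  qed
qed

lemmas Ck_on_scaleR = Ck_on_bounded_bilinear[OF bounded_bilinear_scaleR]
  and Ck_on_inner = Ck_on_bounded_bilinear[OF bounded_bilinear_inner]

lemma Ck_on_sum:
  assumes "open S" "finite I" "\<And>i. i \<in> I \<Longrightarrow> Ck_on k S (f i)"
  shows "Ck_on k S (\<lambda>x. \<Sum>i\<in>I. f i x)"
  using assms(2,3)
proof (induction rule: finite_induct)
  case empty
  then show ?case by (simp add: Ck_on_const)
next
  case (insert i I)
  then show ?case by (simp add: Ck_on_add[OF assms(1)])
qed

lemma linear_apply_Basis:
  fixes f :: "'a::euclidean_space \<Rightarrow> 'b::real_vector"
  assumes "linear f"
  shows "f v = (\<Sum>b\<in>Basis. (v \<bullet> b) *\<^sub>R f b)"
proof -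
  have "f v = f (\<Sum>b\<in>Basis. (v \<bullet> b) *\<^sub>R b)" by (simp add: euclidean_representation)
  then show ?thesis using assms by (simp add: linear_sum linear_scale)
qed

lemma Ck_on_compose:
  fixes f :: "'a::real_normed_vector \<Rightarrow> 'b::euclidean_space"
  assumes "open S" "open T" "f ` S \<subseteq> T" "Ck_on k S f" "Ck_on k T g"
  shows "Ck_on k S (\<lambda>x. g (f x))"
  using assms(4,5)
proof (induction k arbitrary: g)
  case 0
  then show ?case using continuous_on_compose2[of T g S f] assms(3) by simp
next
  case (Suc k)
  let ?f' = "\<lambda>x. frechet_derivative f (at x)" and ?g' = "\<lambda>y. frechet_derivative g (at y)"
  have fT: "f x \<in> T" if "x \<in> S" for x using that assms(3) by auto
  show ?case
  proof (rule Ck_on_SucI[OF assms(1)])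
    show "((\<lambda>x. g (f x)) has_derivative
        (\<lambda>v. \<Sum>b\<in>Basis. (?f' x v \<bullet> b) *\<^sub>R ?g' (f x) b)) (at x)"
      if "x \<in> S" for x
    proof -
      have g': "(g has_derivative ?g' (f x)) (at (f x))"
        using Suc.prems(2) fT[OF that] by (rule Ck_on_Suc_has_derivative)
      have "((\<lambda>x. g (f x)) has_derivative (\<lambda>v. ?g' (f x) (?f' x v))) (at x)"
        by (rule has_derivative_compose[OF Ck_on_Suc_has_derivative[OF Suc.prems(1) that] g'])
      moreover have "(\<lambda>v. ?g' (f x) (?f' x v)) = (\<lambda>v. \<Sum>b\<in>Basis. (?f' x v \<bullet> b) *\<^sub>R ?g' (f x) b)"
        by (rule ext, rule linear_apply_Basis[OF has_derivative_linear[OF g']])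
      ultimately show ?thesis by (simp only:)
    qed
    show "Ck_on k S (\<lambda>x. \<Sum>b\<in>Basis. (?f' x v \<bullet> b) *\<^sub>R ?g' (f x) b)" for v
    proof (intro Ck_on_sum Ck_on_scaleR Ck_on_inner Ck_on_const assms(1) finite_Basis)
      show "Ck_on k S (\<lambda>x. ?f' x v)"
        by (rule Ck_on_Suc_frechet_derivative[OF Suc.prems(1)])
      show "Ck_on k S (\<lambda>x. ?g' (f x) b)" for b
        by (rule Suc.IH[OF Ck_on_SucD[OF Suc.prems(1)]
              Ck_on_Suc_frechet_derivative[OF Suc.prems(2)]])
    qed
  qed
qed

lemma smooth_on_cong:
  "open S \<Longrightarrow> (\<And>x. x \<in> S \<Longrightarrow> f x = g x) \<Longrightarrow> smooth_on S f \<Longrightarrow> smooth_on S g"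
  unfolding smooth_on_def using Ck_on_cong by blast

lemma smooth_on_subset: "smooth_on S f \<Longrightarrow> T \<subseteq> S \<Longrightarrow> smooth_on T f"
  unfolding smooth_on_def using Ck_on_subset by blast

lemma smooth_on_local:
  assumes "\<And>x. x \<in> S \<Longrightarrow> \<exists>U. open U \<and> x \<in> U \<and> smooth_on U f"
  shows "smooth_on S f"
  unfolding smooth_on_def
proof
  show "Ck_on k S f" for k
    by (rule Ck_on_local) (use assms in \<open>auto simp: smooth_on_def\<close>)
qed

lemma smooth_on_const: "smooth_on S (\<lambda>x. c)"
  by (simp add: smooth_on_def Ck_on_const)

lemma smooth_on_id: "smooth_on S (\<lambda>x. x)"
  by (simp add: smooth_on_def Ck_on_id)

lemma smooth_on_add:
  "open S \<Longrightarrow> smooth_on S f \<Longrightarrow> smooth_on S g \<Longrightarrow> smooth_on S (\<lambda>x. f x + g x)"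
  by (simp add: smooth_on_def Ck_on_add)

lemma smooth_on_scaleR:
  "open S \<Longrightarrow> smooth_on S f \<Longrightarrow> smooth_on S g \<Longrightarrow> smooth_on S (\<lambda>x. f x *\<^sub>R g x)"
  by (simp add: smooth_on_def Ck_on_scaleR)

lemma smooth_on_mult:
  fixes f g :: "'a::real_normed_vector \<Rightarrow> real"
  shows "open S \<Longrightarrow> smooth_on S f \<Longrightarrow> smooth_on S g \<Longrightarrow> smooth_on S (\<lambda>x. f x * g x)"
  using smooth_on_scaleR[of S f g] by simp

lemma smooth_on_inner:
  "open S \<Longrightarrow> smooth_on S f \<Longrightarrow> smooth_on S g \<Longrightarrow> smooth_on S (\<lambda>x. f x \<bullet> g x)"
  by (simp add: smooth_on_def Ck_on_inner)

lemma smooth_on_sum: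
  "open S \<Longrightarrow> finite I \<Longrightarrow> (\<And>i. i \<in> I \<Longrightarrow> smooth_on S (f i)) \<Longrightarrow> smooth_on S (\<lambda>x. \<Sum>i\<in>I. f i x)"
  by (simp add: smooth_on_def Ck_on_sum)

lemma smooth_on_compose:
  fixes f :: "'a::real_normed_vector \<Rightarrow> 'b::euclidean_space"
  shows "open S \<Longrightarrow> open T \<Longrightarrow> f ` S \<subseteq> T \<Longrightarrow> smooth_on S f \<Longrightarrow> smooth_on T g \<Longrightarrow>
    smooth_on S (\<lambda>x. g (f x))"
  by (simp add: smooth_on_def Ck_on_compose)

lemma smooth_on_frechet_derivative:
  "smooth_on S f \<Longrightarrow> smooth_on S (\<lambda>x. frechet_derivative f (at x) v)"
  unfolding smooth_on_def
proof
  show "Ck_on k S (\<lambda>x. frechet_derivative f (at x) v)" if "\<forall>k. Ck_on k S f" for k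
    using that[rule_format, of "Suc k"] by simp
qed

lemma smooth_on_has_derivative:
  "smooth_on S f \<Longrightarrow> x \<in> S \<Longrightarrow> (f has_derivative frechet_derivative f (at x)) (at x)"
  unfolding smooth_on_def using Ck_on_Suc_has_derivative by blast

lemma smooth_on_continuous_on: "smooth_on S f \<Longrightarrow> continuous_on S f"
  unfolding smooth_on_def using Ck_on.simps(1) by blast

subsection \<open>Smooth bump functions\<close>

text \<open>The powers of \<open>inverse t\<close> make the family closed under differentiation, so that one induction
  over the order of differentiability covers all its members at once.\<close>

definition flat :: "nat \<Rightarrow> real \<Rightarrow> real" where
  "flat n t = (if t > 0 then inverse t ^ n * exp (- inverse t) else 0)"

lemma tendsto_flat_0: "(flat n \<longlongrightarrow> 0) (at 0)"
proof (rule filterlim_split_at)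
  have "((\<lambda>x::real. x ^ n / exp x) \<longlongrightarrow> 0) at_top" by (rule tendsto_power_div_exp_0)
  then have "((\<lambda>t::real. (inverse t) ^ n / exp (inverse t)) \<longlongrightarrow> 0) (at_right 0)"
    using filterlim_inverse_at_top_right by (rule filterlim_compose)
  moreover have "\<forall>\<^sub>F t in at_right (0::real). (inverse t) ^ n / exp (inverse t) = flat n t"
    by (rule eventually_mono[OF eventually_at_right_less])
      (simp add: flat_def exp_minus divide_inverse)
  ultimately show "(flat n \<longlongrightarrow> 0) (at_right 0)"
    by (rule Lim_transform_eventually)
  have "\<forall>\<^sub>F t in at_left (0::real). flat n t = 0"
    unfolding eventually_at_filter by (rule always_eventually) (simp add: flat_def)
  then show "(flat n \<longlongrightarrow> 0) (at_left 0)"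
    by (rule tendsto_eventually)
qed

lemma DERIV_flat: "(flat n has_real_derivative (flat (n + 2) t - n * flat (n + 1) t)) (at t)"
proof -
  consider "t > 0" | "t < 0" | "t = 0" by linarith
  then show ?thesis
  proof cases
    case 1
    have i: "(inverse has_real_derivative - (inverse t ^ Suc (Suc 0))) (at t)"
      using 1 by (intro DERIV_inverse) simp
    have "((\<lambda>t. inverse t ^ n) has_real_derivative - (n * inverse t ^ (n + 1))) (at t)"
      using DERIV_power[OF i, of n] by (cases n) (simp_all add: algebra_simps)
    moreover have "((\<lambda>t. exp (- inverse t)) has_real_derivative
        exp (- inverse t) * (inverse t ^ Suc (Suc 0))) (at t)"
      using DERIV_chain2[OF DERIV_exp DERIV_minus[OF i]] by simp
    ultimately have "((\<lambda>t. inverse t ^ n * exp (- inverse t)) has_real_derivative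
        (- (n * inverse t ^ (n + 1))) * exp (- inverse t)
          + exp (- inverse t) * (inverse t ^ Suc (Suc 0)) * inverse t ^ n) (at t)"
      by (rule DERIV_mult)
    also have "(- (n * inverse t ^ (n + 1))) * exp (- inverse t)
          + exp (- inverse t) * (inverse t ^ Suc (Suc 0)) * inverse t ^ n
        = flat (n + 2) t - n * flat (n + 1) t"
      using 1 by (simp add: flat_def)
    finally have "((\<lambda>t. inverse t ^ n * exp (- inverse t)) has_real_derivative
        (flat (n + 2) t - n * flat (n + 1) t)) (at t)" .
    then show ?thesis
      by (rule has_field_derivative_transform_within_open[of _ _ _ "{0<..}"])
        (use 1 in \<open>auto simp: flat_def\<close>)
  next
    case 2
    have "((\<lambda>t. 0) has_real_derivative (flat (n + 2) t - n * flat (n + 1) t)) (at t)"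
      using 2 by (simp add: flat_def)
    then show ?thesis
      by (rule has_field_derivative_transform_within_open[of _ _ _ "{..<0}"])
        (use 2 in \<open>auto simp: flat_def\<close>)
  next
    case 3
    have "(\<lambda>h. (flat n (0 + h) - flat n 0) / h) = flat (n + 1)"
      by (simp add: flat_def fun_eq_iff field_simps)
    then have "(flat n has_real_derivative 0) (at 0)"
      unfolding DERIV_def using tendsto_flat_0[of "n + 1"] by simp
    then show ?thesis using 3 by (simp add: flat_def)
  qed
qed

lemma smooth_on_flat: "smooth_on UNIV (flat n)"
proof -
  have "Ck_on k UNIV (flat n)" for k
  proof (induction k arbitrary: n)
    case 0
    show ?case
      using DERIV_flat[THEN DERIV_isCont] by (auto intro!: continuous_at_imp_continuous_on)
  next
    case (Suc k)
    show ?case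
    proof (rule Ck_on_SucI)
      show "(flat n has_derivative
          (\<lambda>v. v *\<^sub>R (flat (n + 2) t + (- real n) *\<^sub>R flat (n + 1) t))) (at t)" for t
        using DERIV_flat[of n t] by (simp add: has_field_derivative_def mult_commute_abs)
      show "Ck_on k UNIV (\<lambda>t. v *\<^sub>R (flat (n + 2) t + (- real n) *\<^sub>R flat (n + 1) t))" for v
        by (intro Ck_on_scaleR Ck_on_add Ck_on_const Suc.IH open_UNIV)
    qed simp
  qed
  then show ?thesis by (simp add: smooth_on_def)
qed

lemma smooth_bump_on_ball:
  fixes u0 :: "'e::euclidean_space"
  assumes "r > 0"
  obtains \<psi> :: "'e \<Rightarrow> real" where "smooth_on UNIV \<psi>" "\<psi> u0 = 1"
    "\<And>u. u \<notin> cball u0 r \<Longrightarrow> \<psi> u = 0"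
proof
  let ?q = "\<lambda>u. r\<^sup>2 + (-1) *\<^sub>R ((u + (- u0)) \<bullet> (u + (- u0)))"
  let ?\<psi> = "\<lambda>u. exp (1 / r\<^sup>2) *\<^sub>R flat 0 (?q u)"
  show "smooth_on UNIV ?\<psi>"
    by (intro smooth_on_scaleR smooth_on_compose[OF open_UNIV open_UNIV _ _ smooth_on_flat]
        smooth_on_add smooth_on_inner smooth_on_const smooth_on_id) auto
  show "?\<psi> u0 = 1" using assms by (simp add: flat_def inverse_eq_divide flip: exp_add)
  show "?\<psi> u = 0" if "u \<notin> cball u0 r" for u
  proof -
    have "r < norm (u - u0)" using that by (simp add: dist_norm norm_minus_commute)
    then have "r\<^sup>2 < (norm (u - u0))\<^sup>2" using assms by (simp add: power_strict_mono)
    then show ?thesis by (simp add: flat_def dot_square_norm)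
  qed
qed

subsection \<open>Solving linear systems with smooth coefficients\<close>

lemma linear_diff_bound_Basis:
  fixes G H :: "'e::euclidean_space \<Rightarrow> 'b::real_normed_vector"
  assumes "linear G" "linear H"
  shows "norm (G v - H v) \<le> (\<Sum>b\<in>Basis. norm (G b - H b)) * norm v"
proof -
  have "G v - H v = (\<Sum>b\<in>Basis. (v \<bullet> b) *\<^sub>R (G b - H b))"
    by (subst linear_apply_Basis[OF assms(1)], subst linear_apply_Basis[OF assms(2)])
      (simp add: sum_subtractf scaleR_diff_right)
  also have "norm \<dots> \<le> (\<Sum>b\<in>Basis. norm ((v \<bullet> b) *\<^sub>R (G b - H b)))" by (rule norm_sum)
  also have "\<dots> \<le> (\<Sum>b\<in>Basis. norm (G b - H b) * norm v)"
    proof (rule sum_mono)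
    fix b :: 'e assume "b \<in> Basis"
    then have "\<bar>v \<bullet> b\<bar> * norm (G b - H b) \<le> norm v * norm (G b - H b)"
      by (intro mult_right_mono Basis_le_norm norm_ge_zero)
    then show "norm ((v \<bullet> b) *\<^sub>R (G b - H b)) \<le> norm (G b - H b) * norm v"
      by (simp only: norm_scaleR mult.commute)
  qed
  finally show ?thesis by (simp add: sum_distrib_right)
qed

text \<open>Injectivity at one point gives a lower bound there, which survives a small perturbation of
  the coefficients with half the constant.\<close>

lemma linear_family_bounded_below:
  fixes G :: "'u::t2_space \<Rightarrow> 'e::euclidean_space \<Rightarrow> 'e"
  assumes "open S" "u0 \<in> S" and lin: "\<And>u. u \<in> S \<Longrightarrow> linear (G u)"
    and cont: "\<And>b. b \<in> Basis \<Longrightarrow> isCont (\<lambda>u. G u b) u0"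
    and inj: "\<And>v. G u0 v = 0 \<Longrightarrow> v = 0"
  obtains m where "m > 0" "\<forall>\<^sub>F u in at u0. \<forall>v. m * norm v \<le> norm (G u v)"
proof -
  have "inj (G u0)"
    using linear_injective_0[OF lin[OF assms(2)]] inj by blast
  then obtain B where B: "B > 0" "\<And>v. B * norm v \<le> norm (G u0 v)"
    using linear_inj_bounded_below_pos[OF lin[OF assms(2)]] by metis
  have "((\<lambda>u. \<Sum>b\<in>Basis. norm (G u b - G u0 b)) \<longlongrightarrow> (\<Sum>b\<in>Basis. norm (G u0 b - G u0 b))) (at u0)"
    by (intro tendsto_intros cont[unfolded isCont_def])
  then have "\<forall>\<^sub>F u in at u0. (\<Sum>b\<in>Basis. norm (G u b - G u0 b)) < B / 2"
    using B(1) by (intro order_tendstoD(2)[where a="B/2"]) auto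
  moreover have "\<forall>\<^sub>F u in at u0. u \<in> S"
    using assms(1,2) by (rule eventually_at_in_open')
  ultimately have "\<forall>\<^sub>F u in at u0. \<forall>v. B / 2 * norm v \<le> norm (G u v)"
  proof eventually_elim
    case (elim u)
    show ?case
    proof
      fix v
      have "norm (G u v - G u0 v) \<le> B / 2 * norm v"
        using linear_diff_bound_Basis[OF lin lin, of u u0 v] elim assms(2)
        by (meson less_eq_real_def mult_right_mono norm_ge_zero order_trans)
      then show "B / 2 * norm v \<le> norm (G u v)"
        using B(2)[of v] norm_triangle_ineq2[of "G u0 v" "G u v"]
        by (simp add: norm_minus_commute)
    qed
  qed
  then show ?thesis using that[of "B/2"] B(1) by simp
qed

text \<open>Differentiating \<open>G W = w\<close> formally gives the candidate \<open>L\<close>, since \<open>G u0\<close> is invertible. The remainder of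
  \<open>W\<close> is estimated after applying \<open>G u\<close>, which is bounded below: there it is the remainder of
  \<open>w - G (W u0)\<close> plus \<open>(G u - G u0) (L h)\<close>, and both are \<open>o(h)\<close>.\<close>

lemma has_derivative_linear_solve:
  fixes G :: "'u::euclidean_space \<Rightarrow> 'e::euclidean_space \<Rightarrow> 'e" and W w :: "'u \<Rightarrow> 'e"
  assumes "open S" "u0 \<in> S" and lin: "\<And>u. u \<in> S \<Longrightarrow> linear (G u)"
    and cont: "\<And>b. isCont (\<lambda>u. G u b) u0"
    and inj: "\<And>v. G u0 v = 0 \<Longrightarrow> v = 0"
    and eq: "\<And>u. u \<in> S \<Longrightarrow> G u (W u) = w u"
    and w': "(w has_derivative w') (at u0)"
    and G': "((\<lambda>u. G u (W u0)) has_derivative G') (at u0)"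
  obtains L where "(W has_derivative L) (at u0)" "\<And>v. G u0 (L v) = w' v - G' v"
proof -
  obtain m where m: "m > 0" "\<forall>\<^sub>F u in at u0. \<forall>v. m * norm v \<le> norm (G u v)"
    using linear_family_bounded_below[OF assms(1-3) cont inj] by blast
  obtain R where R: "linear R" "\<And>v. G u0 (R v) = v"
  proof -
    have "inj (G u0)"
      using linear_injective_0[OF lin[OF assms(2)]] inj by blast
    then have "surj (G u0)"
      using linear_injective_imp_surjective[OF lin[OF assms(2)]] by blast
    then show ?thesis
      using that linear_surjective_right_inverse[OF lin[OF assms(2)]]
      by (metis comp_apply id_apply)
  qed
  define L where "L v = R (w' v - G' v)" for v
  define q where "q u = w u - G u (W u0)" for u
  have q': "(q has_derivative (\<lambda>v. w' v - G' v)) (at u0)"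
    unfolding q_def by (rule has_derivative_diff[OF w' G'])
  have linL: "linear L"
    using linear_compose[OF has_derivative_linear[OF q'] R(1)] by (simp add: L_def[abs_def] o_def)
  then obtain C where C: "\<And>v. norm (L v) \<le> C * norm v" "C > 0"
    using linear_bounded_pos by blast
  let ?\<epsilon> = "\<lambda>u. \<Sum>b\<in>Basis. norm (G u b - G u0 b)"
  let ?r = "\<lambda>u. norm (q u - q u0 - (w' (u - u0) - G' (u - u0))) / norm (u - u0)"
  have \<epsilon>: "(?\<epsilon> \<longlongrightarrow> (\<Sum>b\<in>Basis. norm (G u0 b - G u0 b))) (at u0)"
    by (intro tendsto_intros cont[unfolded isCont_def])
  have r: "(?r \<longlongrightarrow> 0) (at u0)"
    using q' by (simp add: has_derivative_iff_norm)
  have lim: "((\<lambda>u. (?r u + ?\<epsilon> u * C) / m) \<longlongrightarrow> 0) (at u0)"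
    using tendsto_divide[OF tendsto_add[OF r tendsto_mult[OF \<epsilon> tendsto_const[of C]]] tendsto_const[of m]]
      m(1) by simp
  have "\<forall>\<^sub>F u in at u0. u \<in> S"
    using assms(1,2) by (rule eventually_at_in_open')
  then have "\<forall>\<^sub>F u in at u0. norm (norm (W u - W u0 - L (u - u0)) / norm (u - u0))
      \<le> (?r u + ?\<epsilon> u * C) / m"
    using m(2) eventually_neq_at_within[of u0 u0 UNIV]
  proof eventually_elim
    case (elim u)
    let ?h = "u - u0"
    have 1: "G u (W u - W u0 - L ?h) =
        (q u - q u0 - (w' ?h - G' ?h)) - (G u (L ?h) - G u0 (L ?h))"
      using elim(1) assms(2) eq R(2) by (simp add: q_def L_def linear_diff[OF lin])
    have "m * norm (W u - W u0 - L ?h) \<le> norm (G u (W u - W u0 - L ?h))" using elim(2) by blast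
    also have "\<dots> \<le> norm (q u - q u0 - (w' ?h - G' ?h)) + norm (G u (L ?h) - G u0 (L ?h))"
      unfolding 1 by (rule norm_triangle_ineq4)
    also have "norm (G u (L ?h) - G u0 (L ?h)) \<le> ?\<epsilon> u * norm (L ?h)"
      using linear_diff_bound_Basis[OF lin lin] elim(1) assms(2) by blast
    also have "\<dots> \<le> ?\<epsilon> u * (C * norm ?h)"
      by (intro mult_left_mono C sum_nonneg norm_ge_zero)
    finally show ?case
      using m(1) elim(3) by (simp add: field_simps)
  qed
  then have "((\<lambda>u. norm (W u - W u0 - L (u - u0)) / norm (u - u0)) \<longlongrightarrow> 0) (at u0)"
    using lim by (rule Lim_null_comparison)
  then have "(W has_derivative L) (at u0)"
    using linL by (simp add: has_derivative_iff_norm linear_linear)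
  then show ?thesis using that R(2) by (simp add: L_def)
qed

text \<open>Differentiating \<open>G W = w\<close> shows that every directional derivative of \<open>W\<close> solves a system
  with the same matrix \<open>G\<close>, whose right-hand side involves \<open>W\<close> but no derivative of \<open>W\<close>; so one order of
  differentiability is gained at each step of the induction.\<close>

lemma Ck_on_linear_solve:
  fixes G :: "'u::euclidean_space \<Rightarrow> 'e::euclidean_space \<Rightarrow> 'e" and W w :: "'u \<Rightarrow> 'e"
  assumes S: "open S" and lin: "\<And>u. u \<in> S \<Longrightarrow> linear (G u)"
    and sm: "\<And>v. smooth_on S (\<lambda>u. G u v)"
    and inj: "\<And>u v. u \<in> S \<Longrightarrow> G u v = 0 \<Longrightarrow> v = 0"
    and "\<And>u. u \<in> S \<Longrightarrow> G u (W u) = w u" "Ck_on k S w"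
  shows "Ck_on k S W"
  using assms(5,6)
proof (induction k arbitrary: W w)
  case 0
  show ?case
    unfolding Ck_on.simps
  proof (rule continuous_at_imp_continuous_on, rule ballI)
    fix u0 assume u0: "u0 \<in> S"
    have cont: "isCont (\<lambda>u. G u v) u0" for v
      using smooth_on_continuous_on[OF sm] S u0 continuous_on_eq_continuous_at by blast
    have cw: "isCont w u0"
      using "0.prems"(2) S u0 continuous_on_eq_continuous_at by auto
    obtain m where m: "m > 0" "\<forall>\<^sub>F u in at u0. \<forall>v. m * norm v \<le> norm (G u v)"
      using linear_family_bounded_below[OF S u0 lin cont inj[OF u0]] by blast
    have "\<forall>\<^sub>F u in at u0. u \<in> S"
      using S u0 by (rule eventually_at_in_open')
    then have "\<forall>\<^sub>F u in at u0. norm (W u - W u0) \<le> norm (w u - G u (W u0)) / m"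
      using m(2)
    proof eventually_elim
      case (elim u)
      have "G u (W u - W u0) = w u - G u (W u0)"
        using elim(1) "0.prems"(1) by (simp add: linear_diff[OF lin])
      then show ?case using elim(2) m(1) by (metis mult.commute pos_le_divide_eq)
    qed
    moreover have "((\<lambda>u. norm (w u - G u (W u0)) / m) \<longlongrightarrow> norm (w u0 - G u0 (W u0)) / m) (at u0)"
      using m(1) by (intro tendsto_intros cont[unfolded isCont_def] cw[unfolded isCont_def]) auto
    then have "((\<lambda>u. norm (w u - G u (W u0)) / m) \<longlongrightarrow> 0) (at u0)"
      using "0.prems"(1)[OF u0] by simp
    ultimately have "((\<lambda>u. W u - W u0) \<longlongrightarrow> 0) (at u0)"
      by (rule Lim_null_comparison)
    then show "isCont W u0" by (simp add: isCont_def LIM_zero_iff)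
  qed
next
  case (Suc k)
  let ?G' = "\<lambda>u x v. frechet_derivative (\<lambda>u'. G u' x) (at u) v"
  have G': "((\<lambda>u'. G u' x) has_derivative ?G' u x) (at u)" if "u \<in> S" for u x
    using smooth_on_has_derivative[OF sm that] .
  have cont: "isCont (\<lambda>u. G u v) u0" if "u0 \<in> S" for v u0
    using smooth_on_continuous_on[OF sm] S that continuous_on_eq_continuous_at by blast
  have G'_expand: "?G' u x v = (\<Sum>b\<in>Basis. (x \<bullet> b) *\<^sub>R ?G' u b v)" if u: "u \<in> S" for u x v
  proof -
    have "((\<lambda>u'. \<Sum>b\<in>Basis. (x \<bullet> b) *\<^sub>R G u' b) has_derivative
        (\<lambda>v. \<Sum>b\<in>Basis. (x \<bullet> b) *\<^sub>R ?G' u b v)) (at u)"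
      by (intro has_derivative_sum has_derivative_scaleR_right G' u)
    then have "((\<lambda>u'. G u' x) has_derivative (\<lambda>v. \<Sum>b\<in>Basis. (x \<bullet> b) *\<^sub>R ?G' u b v)) (at u)"
      by (rule has_derivative_transform_within_open[OF _ S u])
        (simp add: linear_apply_Basis[OF lin, symmetric])
    from fun_cong[OF frechet_derivative_at[OF this], of v] show ?thesis by simp
  qed
  have W: "Ck_on k S W"
    using Suc.IH[OF Suc.prems(1)] Ck_on_SucD[OF Suc.prems(2)] by blast
  have "\<exists>L. (W has_derivative L) (at u) \<and>
      (\<forall>v. G u (L v) = frechet_derivative w (at u) v - ?G' u (W u) v)" if u: "u \<in> S" for u
    using has_derivative_linear_solve[OF S u lin cont[OF u] inj[OF u] Suc.prems(1)
        Ck_on_Suc_has_derivative[OF Suc.prems(2) u] G'[OF u]]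
    by metis
  then obtain L where L: "\<And>u. u \<in> S \<Longrightarrow> (W has_derivative L u) (at u)"
    "\<And>u v. u \<in> S \<Longrightarrow> G u (L u v) = frechet_derivative w (at u) v - ?G' u (W u) v"
    by metis
  show ?case
  proof (rule Ck_on_SucI[OF S L(1)])
    fix v
    show "Ck_on k S (\<lambda>u. L u v)"
    proof (rule Suc.IH)
      show "G u (L u v) = frechet_derivative w (at u) v
          + (-1) *\<^sub>R (\<Sum>b\<in>Basis. (W u \<bullet> b) *\<^sub>R ?G' u b v)" if "u \<in> S" for u
        using L(2)[OF that, of v] G'_expand[OF that, of "W u" v] by simp
      have "Ck_on k S (\<lambda>u. ?G' u b v)" for b
        using smooth_on_frechet_derivative[OF sm] by (simp add: smooth_on_def)
      then show "Ck_on k S (\<lambda>u. frechet_derivative w (at u) v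
          + (-1) *\<^sub>R (\<Sum>b\<in>Basis. (W u \<bullet> b) *\<^sub>R ?G' u b v))"
        by (intro Ck_on_add Ck_on_scaleR Ck_on_sum Ck_on_inner Ck_on_const S W finite_Basis
            Ck_on_Suc_frechet_derivative[OF Suc.prems(2)])
    qed
  qed
qed

section \<open>Charts, coordinate changes and vector fields\<close>

text \<open>The differential of a coordinate change. As tangent vectors at \<open>p\<close> are given by their components in
  \<open>chart_at A p\<close>, the map \<open>dtrans (chart_at A p) c p\<close> yields the components in \<open>c\<close>.\<close>

definition dtrans :: "('m, 'e::real_normed_vector) chart \<Rightarrow> ('m, 'e) chart \<Rightarrow> 'm \<Rightarrow> 'e \<Rightarrow> 'e" where
  "dtrans c d p = frechet_derivative (snd d \<circ> chart_inv c) (at (snd c p))"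

definition function_linear ::
    "('m, 'e::real_normed_vector) chart set \<Rightarrow> (('m \<Rightarrow> 'e) \<Rightarrow> 'm \<Rightarrow> real) \<Rightarrow> bool" where
  "function_linear A T \<longleftrightarrow>
     (\<forall>X Y. vector_field A X \<longrightarrow> vector_field A Y \<longrightarrow>
        T (\<lambda>p. X p + Y p) = (\<lambda>p. T X p + T Y p)) \<and>
     (\<forall>f X. smooth_fun A f \<longrightarrow> vector_field A X \<longrightarrow>
        T (\<lambda>p. f p *\<^sub>R X p) = (\<lambda>p. f p * T X p))"

locale manifold =
  fixes A :: "('m::t2_space, 'e::euclidean_space) chart set"
  assumes atlas: "smooth_atlas A"
begin

lemma chart_at_in_atlas: "chart_at A p \<in> A" and in_chart_at: "p \<in> fst (chart_at A p)"
proof -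
  have "p \<in> (\<Union>c\<in>A. fst c)" using atlas unfolding smooth_atlas_def by simp
  then have "\<exists>c. c \<in> A \<and> p \<in> fst c" by blast
  then have "chart_at A p \<in> A \<and> p \<in> fst (chart_at A p)"
    unfolding chart_at_def by (rule someI_ex)
  then show "chart_at A p \<in> A" "p \<in> fst (chart_at A p)" by auto
qed

lemma
  assumes "c \<in> A"
  shows open_chart_domain: "open (fst c)"
    and open_chart_img: "open (chart_img c)"
    and chart_homeomorphism: "homeomorphism (fst c) (chart_img c) (snd c) (chart_inv c)"
  using assms atlas unfolding smooth_atlas_def by auto

lemma chart_inv_chart: "c \<in> A \<Longrightarrow> p \<in> fst c \<Longrightarrow> chart_inv c (snd c p) = p"
  using homeomorphism_apply1[OF chart_homeomorphism] .

lemma chart_chart_inv: "u \<in> chart_img c \<Longrightarrow> snd c (chart_inv c u) = u"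
  by (rule f_inv_into_f)

lemma chart_inv_in: "u \<in> chart_img c \<Longrightarrow> chart_inv c u \<in> fst c"
  by (rule inv_into_into)

lemma continuous_on_chart_inv: "c \<in> A \<Longrightarrow> continuous_on (chart_img c) (chart_inv c)"
  using chart_homeomorphism unfolding homeomorphism_def by blast

lemma open_chart_image:
  assumes "c \<in> A" "open U" "U \<subseteq> fst c"
  shows "open (snd c ` U)"
proof -
  have "openin (top_of_set (chart_img c)) (snd c ` U)"
    using chart_homeomorphism[OF assms(1)] assms(2,3)
    by (intro homeomorphism_imp_open_map) (auto simp: openin_open_eq open_chart_domain[OF assms(1)])
  then show ?thesis using openin_open_eq open_chart_img[OF assms(1)] by blast
qed

lemma open_overlap: "c \<in> A \<Longrightarrow> d \<in> A \<Longrightarrow> open (snd c ` (fst c \<inter> fst d))"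
  by (intro open_chart_image open_Int open_chart_domain) auto

lemma smooth_transition:
  "c \<in> A \<Longrightarrow> d \<in> A \<Longrightarrow> smooth_on (snd c ` (fst c \<inter> fst d)) (snd d \<circ> chart_inv c)"
  using atlas unfolding smooth_atlas_def by blast

lemma has_derivative_transition:
  assumes "c \<in> A" "d \<in> A" "p \<in> fst c" "p \<in> fst d"
  shows "((snd d \<circ> chart_inv c) has_derivative dtrans c d p) (at (snd c p))"
  unfolding dtrans_def
  by (rule smooth_on_has_derivative[OF smooth_transition[OF assms(1,2)]]) (use assms in auto)

lemma linear_dtrans:
  "c \<in> A \<Longrightarrow> d \<in> A \<Longrightarrow> p \<in> fst c \<Longrightarrow> p \<in> fst d \<Longrightarrow> linear (dtrans c d p)"
  by (rule has_derivative_linear[OF has_derivative_transition])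

lemma dtrans_dtrans:
  assumes "c \<in> A" "d \<in> A" "e \<in> A" "p \<in> fst c" "p \<in> fst d" "p \<in> fst e"
  shows "dtrans d e p (dtrans c d p v) = dtrans c e p v"
proof -
  have 1: "((snd e \<circ> chart_inv d) has_derivative dtrans d e p) (at ((snd d \<circ> chart_inv c) (snd c p)))"
    using has_derivative_transition[OF assms(2,3,5,6)] chart_inv_chart[OF assms(1,4)] by simp
  have "((\<lambda>u. (snd e \<circ> chart_inv d) ((snd d \<circ> chart_inv c) u)) has_derivative
      (\<lambda>v. dtrans d e p (dtrans c d p v))) (at (snd c p))"
    using has_derivative_compose[OF has_derivative_transition[OF assms(1,2,4,5)] 1] .
  then have "((snd e \<circ> chart_inv c) has_derivative (\<lambda>v. dtrans d e p (dtrans c d p v))) (at (snd c p))"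
    by (rule has_derivative_transform_within_open[OF _ open_overlap[OF assms(1,2)]])
      (use assms in \<open>auto simp: chart_inv_chart\<close>)
  then have "(\<lambda>v. dtrans d e p (dtrans c d p v)) = dtrans c e p"
    unfolding dtrans_def by (rule frechet_derivative_at)
  then show ?thesis by (rule fun_cong)
qed

lemma dtrans_self:
  assumes "c \<in> A" "p \<in> fst c"
  shows "dtrans c c p v = v"
proof -
  have "((\<lambda>u. u) has_derivative (\<lambda>v. v)) (at (snd c p))" by (rule has_derivative_ident)
  then have "((snd c \<circ> chart_inv c) has_derivative (\<lambda>v. v)) (at (snd c p))"
    by (rule has_derivative_transform_within_open[OF _ open_chart_img[OF assms(1)]])
      (use assms in \<open>auto simp: chart_chart_inv\<close>)
  then have "(\<lambda>v. v) = dtrans c c p"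
    unfolding dtrans_def by (rule frechet_derivative_at)
  then show ?thesis using fun_cong[of "\<lambda>v. v" "dtrans c c p" v] by simp
qed

lemma dtrans_inverse:
  "c \<in> A \<Longrightarrow> d \<in> A \<Longrightarrow> p \<in> fst c \<Longrightarrow> p \<in> fst d \<Longrightarrow> dtrans d c p (dtrans c d p v) = v"
  by (simp add: dtrans_dtrans dtrans_self)

lemma local_rep_chart:
  "c \<in> A \<Longrightarrow> p \<in> fst c \<Longrightarrow> local_rep A c X (snd c p) = dtrans (chart_at A p) c p (X p)"
  by (simp add: local_rep_def tangent_coord_def dtrans_def chart_inv_chart)

lemma local_rep_change_chart:
  assumes "c \<in> A" "d \<in> A" "p \<in> fst c" "p \<in> fst d"
  shows "local_rep A d X (snd d p) = dtrans c d p (local_rep A c X (snd c p))"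
  using assms by (simp add: local_rep_chart dtrans_dtrans chart_at_in_atlas in_chart_at)

subsection \<open>Closure properties\<close>

lemma smooth_fun_const: "smooth_fun A (\<lambda>p. a)"
  by (simp add: smooth_fun_def o_def smooth_on_const)

lemma smooth_fun_add: "smooth_fun A f \<Longrightarrow> smooth_fun A h \<Longrightarrow> smooth_fun A (\<lambda>p. f p + h p)"
  by (simp add: smooth_fun_def o_def smooth_on_add open_chart_img)

lemma smooth_fun_mult: "smooth_fun A f \<Longrightarrow> smooth_fun A h \<Longrightarrow> smooth_fun A (\<lambda>p. f p * h p)"
  by (simp add: smooth_fun_def o_def smooth_on_mult open_chart_img)

lemma smooth_fun_minus: "smooth_fun A f \<Longrightarrow> smooth_fun A (\<lambda>p. - f p)"
  using smooth_fun_mult[OF smooth_fun_const[of "-1"], of f] by simp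

lemma smooth_fun_diff: "smooth_fun A f \<Longrightarrow> smooth_fun A h \<Longrightarrow> smooth_fun A (\<lambda>p. f p - h p)"
  using smooth_fun_add[of f, OF _ smooth_fun_minus[of h]] by simp

lemma local_rep_add:
  assumes "c \<in> A" "u \<in> chart_img c"
  shows "local_rep A c X u + local_rep A c Y u = local_rep A c (\<lambda>p. X p + Y p) u"
proof -
  obtain p where p: "p \<in> fst c" "u = snd c p" using assms by blast
  show ?thesis unfolding p(2)
    by (simp add: local_rep_chart[OF assms(1) p(1)]
        linear_add[OF linear_dtrans[OF chart_at_in_atlas assms(1) in_chart_at p(1)]])
qed

lemma local_rep_scaleR:
  assumes "c \<in> A" "u \<in> chart_img c"
  shows "(f \<circ> chart_inv c) u *\<^sub>R local_rep A c X u = local_rep A c (\<lambda>p. f p *\<^sub>R X p) u"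
proof -
  obtain p where p: "p \<in> fst c" "u = snd c p" using assms by blast
  show ?thesis unfolding p(2)
    by (simp add: local_rep_chart[OF assms(1) p(1)] chart_inv_chart[OF assms(1) p(1)]
        linear_scale[OF linear_dtrans[OF chart_at_in_atlas assms(1) in_chart_at p(1)]])
qed

lemma vector_field_add:
  assumes "vector_field A X" "vector_field A Y"
  shows "vector_field A (\<lambda>p. X p + Y p)"
  unfolding vector_field_def
proof
  fix c assume c: "c \<in> A"
  show "smooth_on (chart_img c) (local_rep A c (\<lambda>p. X p + Y p))"
    using assms c unfolding vector_field_def
    by (intro smooth_on_cong[OF open_chart_img[OF c] local_rep_add[OF c]]
        smooth_on_add[OF open_chart_img[OF c]]) blast+
qed

lemma vector_field_scaleR:
  assumes "smooth_fun A f" "vector_field A X"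
  shows "vector_field A (\<lambda>p. f p *\<^sub>R X p)"
  unfolding vector_field_def
proof
  fix c assume c: "c \<in> A"
  show "smooth_on (chart_img c) (local_rep A c (\<lambda>p. f p *\<^sub>R X p))"
    using assms c unfolding vector_field_def smooth_fun_def
    by (intro smooth_on_cong[OF open_chart_img[OF c] local_rep_scaleR[OF c]]
        smooth_on_scaleR[OF open_chart_img[OF c]]) blast+
qed

lemma vector_field_minus: "vector_field A X \<Longrightarrow> vector_field A (\<lambda>p. - X p)"
  using vector_field_scaleR[OF smooth_fun_const[of "-1"], of X] by simp

lemma vector_field_diff:
  "vector_field A X \<Longrightarrow> vector_field A Y \<Longrightarrow> vector_field A (\<lambda>p. X p - Y p)"
  using vector_field_add[of X "\<lambda>p. - Y p"] vector_field_minus[of Y] by simp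

lemma vf_deriv_const: "vf_deriv A X (\<lambda>p. a) p = 0"
  by (simp add: vf_deriv_def o_def frechet_derivative_const)

lemma smooth_fun_has_derivative:
  assumes "smooth_fun A f"
  shows "((f \<circ> chart_inv (chart_at A p)) has_derivative
      frechet_derivative (f \<circ> chart_inv (chart_at A p)) (at (snd (chart_at A p) p)))
      (at (snd (chart_at A p) p))"
proof (rule smooth_on_has_derivative)
  show "smooth_on (chart_img (chart_at A p)) (f \<circ> chart_inv (chart_at A p))"
    using assms chart_at_in_atlas unfolding smooth_fun_def by blast
qed (use in_chart_at in blast)

lemma vf_deriv_minus:
  assumes "smooth_fun A f"
  shows "vf_deriv A X (\<lambda>p. - f p) p = - vf_deriv A X f p"
  unfolding vf_deriv_def
  using fun_cong[OF frechet_derivative_at[OF has_derivative_minus[OF smooth_fun_has_derivative[OF assms]]],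
      of p "X p"]
  by (simp add: o_def)

subsection \<open>Extension by zero and localized frames\<close>

text \<open>The closed set \<open>K\<close> matters: a point outside the domain of \<open>c\<close> has a neighbourhood, the complement of
  \<open>K\<close>, on which \<open>f\<close> vanishes. At the other points a coordinate change applies.\<close>

lemma smooth_fun_extend_by_zero:
  assumes c: "c \<in> A" and K: "closed K" "K \<subseteq> fst c"
    and sm: "smooth_on (chart_img c) (f \<circ> chart_inv c)" and out: "\<And>p. p \<notin> K \<Longrightarrow> f p = 0"
  shows "smooth_fun A f"
  unfolding smooth_fun_def
proof (intro ballI smooth_on_local)
  fix d u assume d: "d \<in> A" and u: "u \<in> chart_img d"
  then obtain q where q: "q \<in> fst d" "u = snd d q" by blast
  show "\<exists>U. open U \<and> u \<in> U \<and> smooth_on U (f \<circ> chart_inv d)"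
  proof (cases "q \<in> fst c")
    case True
    let ?U = "snd d ` (fst d \<inter> fst c)"
    have "smooth_on ?U (\<lambda>w. (f \<circ> chart_inv c) ((snd c \<circ> chart_inv d) w))"
      using c d
      by (intro smooth_on_compose[OF open_overlap open_chart_img[OF c] _ smooth_transition sm])
        (auto simp: chart_inv_chart)
    then have "smooth_on ?U (f \<circ> chart_inv d)"
      by (rule smooth_on_cong[OF open_overlap[OF d c], rotated]) (use c d in \<open>auto simp: chart_inv_chart\<close>)
    then show ?thesis using open_overlap[OF d c] q True by (intro exI[of _ ?U]) auto
  next
    case False
    let ?U = "snd d ` (fst d \<inter> - K)"
    have U: "open ?U"
      using d K(1) by (intro open_chart_image open_Int open_chart_domain) (auto simp: open_Compl)
    have "smooth_on ?U (f \<circ> chart_inv d)"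
      by (rule smooth_on_cong[OF U _ smooth_on_const[of _ 0]])
        (use d in \<open>auto simp: chart_inv_chart out\<close>)
    then show ?thesis using U q False K(2) by (intro exI[of _ ?U]) auto
  qed
qed

lemma vector_field_extend_by_zero:
  assumes c: "c \<in> A" and K: "closed K" "K \<subseteq> fst c"
    and sm: "smooth_on (chart_img c) (local_rep A c X)" and out: "\<And>p. p \<notin> K \<Longrightarrow> X p = 0"
  shows "vector_field A X"
  unfolding vector_field_def
proof (intro ballI smooth_on_local)
  fix d u assume d: "d \<in> A" and u: "u \<in> chart_img d"
  then obtain q where q: "q \<in> fst d" "u = snd d q" by blast
  show "\<exists>U. open U \<and> u \<in> U \<and> smooth_on U (local_rep A d X)"
  proof (cases "q \<in> fst c")
    case True
    let ?U = "snd d ` (fst d \<inter> fst c)" and ?t = "snd c \<circ> chart_inv d"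
    have t: "smooth_on ?U (\<lambda>w. ?t w)"
      using smooth_transition[OF d c] by (simp add: o_def)
    have img: "?t ` ?U \<subseteq> snd c ` (fst c \<inter> fst d)" using d by (auto simp: chart_inv_chart)
    have 1: "smooth_on ?U (\<lambda>w. local_rep A c X (?t w))"
      by (rule smooth_on_compose[OF open_overlap[OF d c] open_chart_img[OF c] _ t sm])
        (use img in blast)
    have 2: "smooth_on ?U (\<lambda>w. frechet_derivative (snd d \<circ> chart_inv c) (at (?t w)) b)" for b
      by (rule smooth_on_compose[OF open_overlap[OF d c] open_overlap[OF c d] img t
            smooth_on_frechet_derivative[OF smooth_transition[OF c d]]])
    have "smooth_on ?U (\<lambda>w. \<Sum>b\<in>Basis. (local_rep A c X (?t w) \<bullet> b) *\<^sub>R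
        frechet_derivative (snd d \<circ> chart_inv c) (at (?t w)) b)"
      by (intro smooth_on_sum smooth_on_scaleR smooth_on_inner smooth_on_const 1 2
          finite_Basis open_overlap[OF d c])
    then have "smooth_on ?U (local_rep A d X)"
    proof (rule smooth_on_cong[OF open_overlap[OF d c], rotated])
      fix w assume "w \<in> ?U"
      then obtain p where p: "p \<in> fst d" "p \<in> fst c" "w = snd d p" by blast
      show "(\<Sum>b\<in>Basis. (local_rep A c X (?t w) \<bullet> b) *\<^sub>R
          frechet_derivative (snd d \<circ> chart_inv c) (at (?t w)) b) = local_rep A d X w"
        using linear_apply_Basis[OF linear_dtrans[OF c d p(2,1)], of "local_rep A c X (snd c p)"]
        by (simp add: p(3) chart_inv_chart[OF d p(1)] local_rep_change_chart[OF c d p(2,1), of X]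
            dtrans_def)
    qed
    then show ?thesis using open_overlap[OF d c] q True by (intro exI[of _ ?U]) auto
  next
    case False
    let ?U = "snd d ` (fst d \<inter> - K)"
    have U: "open ?U"
      using d K(1) by (intro open_chart_image open_Int open_chart_domain) (auto simp: open_Compl)
    have "smooth_on ?U (local_rep A d X)"
    proof (rule smooth_on_cong[OF U _ smooth_on_const[of _ 0]])
      fix w assume "w \<in> ?U"
      then obtain p where p: "p \<in> fst d" "p \<notin> K" "w = snd d p" by blast
      show "0 = local_rep A d X w"
        by (simp add: p(3) local_rep_chart[OF d p(1)] out[OF p(2)]
            linear_0[OF linear_dtrans[OF chart_at_in_atlas d in_chart_at p(1)]])
    qed
    then show ?thesis using U q False K(2) by (intro exI[of _ ?U]) auto
  qed
qed

text \<open>The support is compact, hence closed because the manifold is Hausdorff.\<close>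

lemma bump_in_chart:
  assumes c: "c \<in> A" and p: "p \<in> fst c"
  obtains \<psi> K where "closed K" "K \<subseteq> fst c" "smooth_on (chart_img c) (\<psi> \<circ> chart_inv c)"
    "\<psi> p = 1" "\<And>q. q \<notin> K \<Longrightarrow> \<psi> q = (0::real)"
proof -
  obtain r where r: "r > 0" "cball (snd c p) r \<subseteq> chart_img c"
    using open_chart_img[OF c, unfolded open_contains_cball, rule_format, of "snd c p"] p by blast
  obtain \<beta> :: "'e \<Rightarrow> real" where \<beta>: "smooth_on UNIV \<beta>" "\<beta> (snd c p) = 1"
    "\<And>u. u \<notin> cball (snd c p) r \<Longrightarrow> \<beta> u = 0"
    using smooth_bump_on_ball[OF r(1), of "snd c p"] by metis
  define K where "K = chart_inv c ` cball (snd c p) r"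
  define \<psi> where "\<psi> q = (if q \<in> fst c then \<beta> (snd c q) else 0)" for q
  show ?thesis
  proof (rule that[of K \<psi>])
    have "compact K"
      unfolding K_def using continuous_on_subset[OF continuous_on_chart_inv[OF c] r(2)]
      by (intro compact_continuous_image compact_cball)
    then show "closed K" by (rule compact_imp_closed)
    show "K \<subseteq> fst c"
    proof
      fix q assume "q \<in> K"
      then obtain u where "u \<in> chart_img c" "q = chart_inv c u" using r(2) unfolding K_def by blast
      then show "q \<in> fst c" using chart_inv_in by simp
    qed
    show "smooth_on (chart_img c) (\<psi> \<circ> chart_inv c)"
      by (rule smooth_on_cong[OF open_chart_img[OF c] _ smooth_on_subset[OF \<beta>(1)]])
        (auto simp: \<psi>_def chart_inv_chart[OF c])
    show "\<psi> p = 1" using p \<beta>(2) by (simp add: \<psi>_def)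
    show "\<psi> q = 0" if "q \<notin> K" for q
    proof (cases "q \<in> fst c")
      case True
      then have "snd c q \<notin> cball (snd c p) r"
        using that imageI[of "snd c q" "cball (snd c p) r" "chart_inv c"]
        by (auto simp: K_def chart_inv_chart[OF c True])
      then show ?thesis by (simp add: \<psi>_def \<beta>(3))
    qed (simp add: \<psi>_def)
  qed
qed

text \<open>The coordinate vector fields of a chart do not extend to the manifold, but their products with
  a bump function \<open>\<psi>\<close> do, and so do the products of \<open>\<psi>\<close> with the components of a global field.\<close>

lemma localized_frame:
  assumes c: "c \<in> A" and p: "p \<in> fst c"
  obtains \<psi> :: "'m \<Rightarrow> real" and E :: "'e \<Rightarrow> 'm \<Rightarrow> 'e" where
    "smooth_fun A \<psi>" "\<psi> p = 1" "\<And>q. q \<notin> fst c \<Longrightarrow> \<psi> q = 0"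
    "\<And>v. vector_field A (E v)" "\<And>v q. E v q = \<psi> q *\<^sub>R dtrans c (chart_at A q) q v"
    "\<And>X b. vector_field A X \<Longrightarrow> smooth_fun A (\<lambda>q. \<psi> q * (dtrans (chart_at A q) c q (X q) \<bullet> b))"
proof -
  obtain \<psi> K where K: "closed K" "K \<subseteq> fst c" and \<psi>: "smooth_on (chart_img c) (\<psi> \<circ> chart_inv c)"
    "\<psi> p = 1" "\<And>q. q \<notin> K \<Longrightarrow> \<psi> q = (0::real)"
    by (rule bump_in_chart[OF c p]) (rule that)
  define E where "E v q = \<psi> q *\<^sub>R dtrans c (chart_at A q) q v" for v q
  show ?thesis
  proof (rule that[of \<psi> E])
    show "smooth_fun A \<psi>" by (rule smooth_fun_extend_by_zero[OF c K \<psi>(1,3)])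
    show "\<psi> p = 1" by (rule \<psi>(2))
    show "\<psi> q = 0" if "q \<notin> fst c" for q using that K(2) \<psi>(3) by blast
    show "E v q = \<psi> q *\<^sub>R dtrans c (chart_at A q) q v" for v q by (rule E_def)
    show "vector_field A (E v)" for v
    proof (rule vector_field_extend_by_zero[OF c K])
      have "smooth_on (chart_img c) (\<lambda>u. (\<psi> \<circ> chart_inv c) u *\<^sub>R v)"
        by (rule smooth_on_scaleR[OF open_chart_img[OF c] \<psi>(1) smooth_on_const])
      then show "smooth_on (chart_img c) (local_rep A c (E v))"
      proof (rule smooth_on_cong[OF open_chart_img[OF c], rotated])
        fix u assume "u \<in> chart_img c"
        then obtain q where q: "q \<in> fst c" "u = snd c q" by blast
        show "(\<psi> \<circ> chart_inv c) u *\<^sub>R v = local_rep A c (E v) u"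
          by (simp add: q(2) chart_inv_chart[OF c q(1)] local_rep_chart[OF c q(1)] E_def
              linear_scale[OF linear_dtrans[OF chart_at_in_atlas c in_chart_at q(1)]]
              dtrans_inverse[OF c chart_at_in_atlas q(1) in_chart_at])
      qed
      show "E v q = 0" if "q \<notin> K" for q using \<psi>(3)[OF that] by (simp add: E_def)
    qed
    show "smooth_fun A (\<lambda>q. \<psi> q * (dtrans (chart_at A q) c q (X q) \<bullet> b))"
      if X: "vector_field A X" for X b
    proof (rule smooth_fun_extend_by_zero[OF c K])
      have Xc: "smooth_on (chart_img c) (local_rep A c X)"
        using X c unfolding vector_field_def by simp
      have "smooth_on (chart_img c) (\<lambda>u. (\<psi> \<circ> chart_inv c) u * (local_rep A c X u \<bullet> b))"
        by (rule smooth_on_mult[OF open_chart_img[OF c] \<psi>(1)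
              smooth_on_inner[OF open_chart_img[OF c] Xc smooth_on_const]])
      then show "smooth_on (chart_img c)
          ((\<lambda>q. \<psi> q * (dtrans (chart_at A q) c q (X q) \<bullet> b)) \<circ> chart_inv c)"
      proof (rule smooth_on_cong[OF open_chart_img[OF c], rotated])
        fix u assume "u \<in> chart_img c"
        then obtain q where q: "q \<in> fst c" "u = snd c q" by blast
        show "(\<psi> \<circ> chart_inv c) u * (local_rep A c X u \<bullet> b) =
            ((\<lambda>q. \<psi> q * (dtrans (chart_at A q) c q (X q) \<bullet> b)) \<circ> chart_inv c) u"
          by (simp add: q(2) chart_inv_chart[OF c q(1)] local_rep_chart[OF c q(1)])
      qed
    qed (simp add: \<psi>(3))
  qed
qed

lemma exists_vector_field_through:
  obtains X where "vector_field A X" "X p = v"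
proof -
  obtain \<psi> E where \<psi>: "\<psi> p = 1" and E: "\<And>v. vector_field A (E v)"
    "\<And>v q. E v q = \<psi> q *\<^sub>R dtrans (chart_at A p) (chart_at A q) q v"
    by (rule localized_frame[OF chart_at_in_atlas in_chart_at, of p]) (rule that)
  show ?thesis
  proof (rule that[OF E(1)])
    show "E v p = v"
      by (simp add: E(2) \<psi> dtrans_self[OF chart_at_in_atlas in_chart_at])
  qed
qed

subsection \<open>Tensoriality\<close>

lemma function_linear_sum:
  assumes T: "function_linear A T" and "finite I"
    and "\<And>i. i \<in> I \<Longrightarrow> smooth_fun A (f i)" "\<And>i. i \<in> I \<Longrightarrow> vector_field A (E i)" and X: "vector_field A X"
  shows "vector_field A (\<lambda>p. \<Sum>i\<in>I. f i p *\<^sub>R E i p) \<and>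
    T (\<lambda>p. \<Sum>i\<in>I. f i p *\<^sub>R E i p) = (\<lambda>p. \<Sum>i\<in>I. f i p * T (E i) p)"
  using assms(2-4)
proof (induction rule: finite_induct)
  case empty
  have "vector_field A (\<lambda>p. 0 *\<^sub>R X p)"
    by (rule vector_field_scaleR[OF smooth_fun_const X])
  moreover have "T (\<lambda>p. 0 *\<^sub>R X p) = (\<lambda>p. 0 * T X p)"
    using T X smooth_fun_const[of 0] unfolding function_linear_def by blast
  ultimately show ?case by simp
next
  case (insert i I)
  have i: "vector_field A (\<lambda>p. f i p *\<^sub>R E i p)" "T (\<lambda>p. f i p *\<^sub>R E i p) = (\<lambda>p. f i p * T (E i) p)"
    using T insert.prems vector_field_scaleR unfolding function_linear_def by simp_all
  have I: "vector_field A (\<lambda>p. \<Sum>i\<in>I. f i p *\<^sub>R E i p)"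
    "T (\<lambda>p. \<Sum>i\<in>I. f i p *\<^sub>R E i p) = (\<lambda>p. \<Sum>i\<in>I. f i p * T (E i) p)"
    using insert.IH insert.prems by simp_all
  have "T (\<lambda>p. f i p *\<^sub>R E i p + (\<Sum>i\<in>I. f i p *\<^sub>R E i p)) =
      (\<lambda>p. T (\<lambda>p. f i p *\<^sub>R E i p) p + T (\<lambda>p. \<Sum>i\<in>I. f i p *\<^sub>R E i p) p)"
    using T i(1) I(1) unfolding function_linear_def by blast
  then show ?case
    using insert.hyps vector_field_add[OF i(1) I(1)] i(2) I(2) by simp
qed

text \<open>Near \<open>p\<close> a field is a combination of the coordinate fields. Multiplying by \<open>\<psi>\<^sup>2\<close>, one factor for
  the coefficients and one for the frame, turns this into an identity of global fields, to which
  linearity over the functions applies; the coefficients vanish at \<open>p\<close>.\<close>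

lemma function_linear_vanishes:
  assumes T: "function_linear A T" and X: "vector_field A X" and "X p = 0"
  shows "T X p = 0"
proof -
  let ?c = "chart_at A p"
  obtain \<psi> E where \<psi>: "smooth_fun A \<psi>" "\<psi> p = 1" "\<And>q. q \<notin> fst ?c \<Longrightarrow> \<psi> q = 0"
    and E: "\<And>v. vector_field A (E v)" "\<And>v q. E v q = \<psi> q *\<^sub>R dtrans ?c (chart_at A q) q v"
    and co: "\<And>X b. vector_field A X \<Longrightarrow> smooth_fun A (\<lambda>q. \<psi> q * (dtrans (chart_at A q) ?c q (X q) \<bullet> b))"
    by (rule localized_frame[OF chart_at_in_atlas in_chart_at, of p]) (rule that)
  let ?f = "\<lambda>b q. \<psi> q * (dtrans (chart_at A q) ?c q (X q) \<bullet> b)"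
  have "(\<psi> q * \<psi> q) *\<^sub>R X q = (\<Sum>b\<in>Basis. ?f b q *\<^sub>R E b q)" for q
  proof (cases "q \<in> fst ?c")
    case True
    have "X q = dtrans ?c (chart_at A q) q (dtrans (chart_at A q) ?c q (X q))"
      by (simp add: dtrans_inverse chart_at_in_atlas in_chart_at True)
    also have "\<dots> = (\<Sum>b\<in>Basis. (dtrans (chart_at A q) ?c q (X q) \<bullet> b) *\<^sub>R dtrans ?c (chart_at A q) q b)"
      by (rule linear_apply_Basis[OF linear_dtrans])
        (simp_all add: chart_at_in_atlas in_chart_at True)
    finally have "(\<psi> q * \<psi> q) *\<^sub>R X q = (\<psi> q * \<psi> q) *\<^sub>R
        (\<Sum>b\<in>Basis. (dtrans (chart_at A q) ?c q (X q) \<bullet> b) *\<^sub>R dtrans ?c (chart_at A q) q b)"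
      by (rule arg_cong)
    then show ?thesis
      by (simp add: E(2) scaleR_sum_right mult_ac)
  qed (simp add: \<psi>(3))
  then have eq: "(\<lambda>q. (\<psi> q * \<psi> q) *\<^sub>R X q) = (\<lambda>q. \<Sum>b\<in>Basis. ?f b q *\<^sub>R E b q)" by (rule ext)
  have "T (\<lambda>q. (\<psi> q * \<psi> q) *\<^sub>R X q) = (\<lambda>q. \<psi> q * \<psi> q * T X q)"
    using T X smooth_fun_mult[OF \<psi>(1,1)] unfolding function_linear_def by blast
  moreover have "T (\<lambda>q. \<Sum>b\<in>Basis. ?f b q *\<^sub>R E b q) = (\<lambda>q. \<Sum>b\<in>Basis. ?f b q * T (E b) q)"
    by (rule conjunct2[OF function_linear_sum[where f = ?f and E = E, OF T finite_Basis _ _ X]])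
      (rule co[OF X] E(1))+
  ultimately have "\<psi> p * \<psi> p * T X p = (\<Sum>b\<in>Basis. ?f b p * T (E b) p)"
    unfolding eq by (metis (no_types))
  also have "\<dots> = 0"
    using assms(3) by (simp add: linear_0[OF linear_dtrans] chart_at_in_atlas in_chart_at)
  finally show ?thesis by (simp add: \<psi>(2))
qed

lemma function_linear_pointwise:
  assumes T: "function_linear A T" and "vector_field A X" "vector_field A Y" "X p = Y p"
  shows "T X p = T Y p"
proof -
  let ?Y = "\<lambda>q. (-1) *\<^sub>R Y q"
  have Y: "vector_field A ?Y" by (rule vector_field_scaleR[OF smooth_fun_const assms(3)])
  have "T (\<lambda>q. X q + ?Y q) p = 0"
    by (rule function_linear_vanishes[OF T vector_field_add[OF assms(2) Y]]) (simp add: assms(4))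
  moreover have "T (\<lambda>q. X q + ?Y q) = (\<lambda>q. T X q + T ?Y q)"
    using T assms(2) Y unfolding function_linear_def by blast
  moreover have "T ?Y = (\<lambda>q. (-1) * T Y q)"
    using T assms(3) smooth_fun_const[of "-1"] unfolding function_linear_def by blast
  ultimately show ?thesis by simp
qed

text \<open>A form on vector fields that is linear over the functions in each of three arguments is a field of
  trilinear forms.\<close>

lemma trilinear_form_at_point:
  fixes F :: "('m \<Rightarrow> 'e) \<Rightarrow> ('m \<Rightarrow> 'e) \<Rightarrow> ('m \<Rightarrow> 'e) \<Rightarrow> 'm \<Rightarrow> real"
  assumes F1: "\<And>Y Z. vector_field A Y \<Longrightarrow> vector_field A Z \<Longrightarrow> function_linear A (\<lambda>X. F X Y Z)"
    and F2: "\<And>X Z. vector_field A X \<Longrightarrow> vector_field A Z \<Longrightarrow> function_linear A (\<lambda>Y. F X Y Z)"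
    and F3: "\<And>X Y. vector_field A X \<Longrightarrow> vector_field A Y \<Longrightarrow> function_linear A (\<lambda>Z. F X Y Z)"
  obtains S where "trilinear S"
    "\<And>X Y Z. vector_field A X \<Longrightarrow> vector_field A Y \<Longrightarrow> vector_field A Z \<Longrightarrow> F X Y Z p = S (X p) (Y p) (Z p)"
proof -
  define E where "E v = (SOME X. vector_field A X \<and> X p = v)" for v
  have E: "vector_field A (E v)" "E v p = v" for v
  proof -
    have "\<exists>X. vector_field A X \<and> X p = v"
      using exists_vector_field_through[of p v] by blast
    then have "vector_field A (E v) \<and> E v p = v" unfolding E_def by (rule someI_ex)
    then show "vector_field A (E v)" "E v p = v" by auto
  qed
  define S where "S x y z = F (E x) (E y) (E z) p" for x y z
  have FS: "F X Y Z p = S (X p) (Y p) (Z p)"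
    if X: "vector_field A X" and Y: "vector_field A Y" and Z: "vector_field A Z" for X Y Z
  proof -
    have "F X Y Z p = F (E (X p)) Y Z p"
      by (rule function_linear_pointwise[OF F1[OF Y Z] X E(1)]) (simp add: E(2))
    also have "\<dots> = F (E (X p)) (E (Y p)) Z p"
      by (rule function_linear_pointwise[OF F2[OF E(1) Z] Y E(1)]) (simp add: E(2))
    also have "\<dots> = F (E (X p)) (E (Y p)) (E (Z p)) p"
      by (rule function_linear_pointwise[OF F3[OF E(1) E(1)] Z E(1)]) (simp add: E(2))
    finally show ?thesis by (simp add: S_def)
  qed
  have lin: "linear (\<lambda>v. T (E v) p)" if T: "function_linear A T" for T
  proof (rule linearI)
    show "T (E (v + w)) p = T (E v) p + T (E w) p" for v w
    proof -
      have "T (E (v + w)) p = T (\<lambda>q. E v q + E w q) p"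
        by (rule function_linear_pointwise[OF T E(1) vector_field_add[OF E(1) E(1)]]) (simp add: E(2))
      also have "T (\<lambda>q. E v q + E w q) = (\<lambda>q. T (E v) q + T (E w) q)"
        using T E(1) unfolding function_linear_def by blast
      finally show ?thesis .
    qed
    show "T (E (a *\<^sub>R v)) p = a *\<^sub>R T (E v) p" for a v
    proof -
      have "T (E (a *\<^sub>R v)) p = T (\<lambda>q. a *\<^sub>R E v q) p"
        by (rule function_linear_pointwise[OF T E(1) vector_field_scaleR[OF smooth_fun_const E(1)]])
          (simp add: E(2))
      also have "T (\<lambda>q. a *\<^sub>R E v q) = (\<lambda>q. a * T (E v) q)"
        using T E(1) smooth_fun_const[of a] unfolding function_linear_def by blast
      finally show ?thesis by simp
    qed
  qed
  have "trilinear S"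
    unfolding trilinear_def S_def
    using lin[OF F1[OF E(1) E(1)]] lin[OF F2[OF E(1) E(1)]] lin[OF F3[OF E(1) E(1)]] by simp
  then show ?thesis using that FS by blast
qed

subsection \<open>Raising an index\<close>

text \<open>In a localized frame the components of \<open>W\<close> solve a linear system whose matrix is the Gram
  matrix of the frame and whose right-hand side is smooth.\<close>

lemma vector_field_of_smooth_pairings:
  assumes g: "pseudo_riemannian_metric A g"
    and W: "\<And>Z. vector_field A Z \<Longrightarrow> smooth_fun A (\<lambda>p. g p (W p) (Z p))"
  shows "vector_field A W"
  unfolding vector_field_def
proof (intro ballI smooth_on_local)
  fix c u0 assume c: "c \<in> A" and "u0 \<in> chart_img c"
  then obtain p0 where p0: "p0 \<in> fst c" "u0 = snd c p0" by blast
  obtain \<psi> E where \<psi>: "smooth_fun A \<psi>" "\<psi> p0 = 1" and E: "\<And>v. vector_field A (E v)"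
    "\<And>v q. E v q = \<psi> q *\<^sub>R dtrans c (chart_at A q) q v"
    by (rule localized_frame[OF c p0(1)]) (rule that)
  have bil: "bilinear (g p)" for p
    using g unfolding pseudo_riemannian_metric_def by simp
  have "\<forall>p v. (\<forall>w. g p v w = 0) \<longrightarrow> v = 0"
    using g unfolding pseudo_riemannian_metric_def by blast
  then have nondeg: "v = 0" if "\<And>w. g p v w = 0" for p v
    using that by blast
  have g_lin1: "linear (\<lambda>v. g p v w)" and g_lin2: "linear (g p v)" for p v w
    using bil[of p] unfolding bilinear_def by auto
  define S where "S = {u \<in> chart_img c. (\<psi> \<circ> chart_inv c) u \<noteq> 0}"
  have \<psi>c: "smooth_on (chart_img c) (\<psi> \<circ> chart_inv c)"
    using \<psi>(1) c unfolding smooth_fun_def by blast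
  have S: "open S"
    using continuous_open_preimage[OF smooth_on_continuous_on[OF \<psi>c] open_chart_img[OF c], of "-{0}"]
    unfolding S_def by (simp add: vimage_def Int_def open_Compl)
  define G where "G u v = (\<Sum>b\<in>Basis. (\<Sum>d\<in>Basis. (v \<bullet> d) *
      (ap2 g (E d) (E b) \<circ> chart_inv c) u) *\<^sub>R b)" for u v
  define w where "w u = (\<Sum>b\<in>Basis. ((\<psi> \<circ> chart_inv c) u *
      ((\<lambda>p. g p (W p) (E b p)) \<circ> chart_inv c) u) *\<^sub>R b)" for u
  have G_inner: "G (snd c p) v \<bullet> b = \<psi> p * g p (dtrans c (chart_at A p) p v) (E b p)"
    if p: "p \<in> fst c" and b: "b \<in> Basis" for p v b
  proof -
    note lin = linear_dtrans[OF c chart_at_in_atlas p in_chart_at]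
    have "\<psi> p * g p (dtrans c (chart_at A p) p v) (E b p) =
        \<psi> p * (\<Sum>d\<in>Basis. (v \<bullet> d) *\<^sub>R g p (dtrans c (chart_at A p) p d) (E b p))"
      using linear_apply_Basis[OF linear_compose[OF lin, of "\<lambda>x. g p x (E b p)", OF g_lin1], of v]
      by (simp add: o_def)
    also have "\<dots> = (\<Sum>d\<in>Basis. (v \<bullet> d) * g p (E d p) (E b p))"
      unfolding sum_distrib_left
      by (rule sum.cong[OF refl]) (simp add: E(2)[of _ p] linear_scale[OF g_lin1])
    finally show ?thesis
      using b by (simp add: G_def inner_sum_left inner_Basis sum.delta ap2_def chart_inv_chart[OF c p]
          if_distrib cong: if_cong)
  qed
  have "smooth_on S (local_rep A c W)"
    unfolding smooth_on_def
  proof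
    fix k
    show "Ck_on k S (local_rep A c W)"
    proof (rule Ck_on_linear_solve[OF S])
      show "linear (G u)" for u
      proof (rule linearI)
        show "G u (x + y) = G u x + G u y" for x y
          by (simp add: G_def inner_add_left distrib_right sum.distrib scaleR_add_left)
        show "G u (r *\<^sub>R x) = r *\<^sub>R G u x" for r x
          by (simp add: G_def mult.assoc scaleR_sum_right flip: sum_distrib_left)
      qed
      have SV: "S \<subseteq> chart_img c" unfolding S_def by blast
      have "smooth_on S (ap2 g (E d) (E b) \<circ> chart_inv c)" for d b
        using g E(1) c unfolding pseudo_riemannian_metric_def smooth_fun_def
        by (intro smooth_on_subset[OF _ SV]) blast
      then show "smooth_on S (\<lambda>u. G u v)" for v
        unfolding G_def by (intro smooth_on_sum smooth_on_scaleR smooth_on_mult smooth_on_const S finite_Basis)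
      have "smooth_on S ((\<lambda>p. g p (W p) (E b p)) \<circ> chart_inv c)" for b
        using W[OF E(1)[of b]] c unfolding smooth_fun_def
        by (intro smooth_on_subset[OF _ SV]) blast
      then have "smooth_on S w"
        unfolding w_def
        by (intro smooth_on_sum smooth_on_scaleR smooth_on_mult smooth_on_const S finite_Basis
            smooth_on_subset[OF \<psi>c SV])
      then show "Ck_on k S w" by (simp add: smooth_on_def)
    next
      fix u v assume "u \<in> S" and G0: "G u v = 0"
      then obtain p where p: "p \<in> fst c" "u = snd c p" "\<psi> p \<noteq> 0"
        unfolding S_def by (auto simp: chart_inv_chart[OF c])
      note lin = linear_dtrans[OF chart_at_in_atlas c in_chart_at p(1)]
      let ?x = "dtrans c (chart_at A p) p v"
      have *: "g p ?x (dtrans c (chart_at A p) p b) = 0" if "b \<in> Basis" for b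
        using G_inner[OF p(1) that, of v] G0 p(2,3) by (simp add: E(2) linear_scale[OF g_lin2])
      have "g p ?x y = 0" for y
      proof -
        have "y = dtrans c (chart_at A p) p (dtrans (chart_at A p) c p y)"
          by (simp add: dtrans_inverse[OF chart_at_in_atlas c in_chart_at p(1)])
        then have "g p ?x y = (g p ?x \<circ> dtrans c (chart_at A p) p) (dtrans (chart_at A p) c p y)"
          by simp
        also have "\<dots> = (\<Sum>b\<in>Basis. (dtrans (chart_at A p) c p y \<bullet> b) *\<^sub>R
            (g p ?x \<circ> dtrans c (chart_at A p) p) b)"
          by (rule linear_apply_Basis[OF linear_compose[OF linear_dtrans[OF c chart_at_in_atlas p(1) in_chart_at] g_lin2]])
        also have "\<dots> = 0" by (simp add: *)
        finally show ?thesis .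
      qed
      then have "?x = 0" by (rule nondeg)
      then have "dtrans (chart_at A p) c p ?x = 0" by (simp add: linear_0[OF lin])
      then show "v = 0" by (simp add: dtrans_inverse[OF c chart_at_in_atlas p(1) in_chart_at])
    next
      fix u assume "u \<in> S"
      then obtain p where p: "p \<in> fst c" "u = snd c p"
        unfolding S_def by (auto simp: chart_inv_chart[OF c])
      show "G u (local_rep A c W u) = w u"
      proof (rule euclidean_eqI)
        fix b :: 'e assume b: "b \<in> Basis"
        have "w u \<bullet> b = \<psi> p * g p (W p) (E b p)"
          using b by (simp add: w_def p(2) inner_sum_left inner_Basis sum.delta chart_inv_chart[OF c p(1)]
              if_distrib cong: if_cong)
        then show "G u (local_rep A c W u) \<bullet> b = w u \<bullet> b"
          using G_inner[OF p(1) b, of "local_rep A c W u"]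
          by (simp add: p(2) local_rep_chart[OF c p(1)]
              dtrans_inverse[OF chart_at_in_atlas c in_chart_at p(1)])
      qed
    qed
  qed
  moreover have "u0 \<in> S"
    using p0 \<psi>(2) by (simp add: S_def chart_inv_chart[OF c])
  ultimately show "\<exists>U. open U \<and> u0 \<in> U \<and> smooth_on U (local_rep A c W)" using S by blast
qed

end

section \<open>Traces with respect to an indefinite scalar product\<close>

definition metric_trace :: "('e::euclidean_space \<Rightarrow> 'e \<Rightarrow> real) \<Rightarrow> ('e \<Rightarrow> 'e \<Rightarrow> real) \<Rightarrow> real" where
  "metric_trace h B = (\<Sum>i\<in>Basis. \<Sum>j\<in>Basis. gram_inv h i j * B i j)"

lemma theta_metric_trace: "theta h S z = metric_trace h (\<lambda>x y. S x y z)"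
  by (simp add: theta_def metric_trace_def)

lemma metric_trace_add:
  "metric_trace h (\<lambda>x y. B x y + C x y) = metric_trace h B + metric_trace h C"
  by (simp add: metric_trace_def distrib_left sum.distrib)

lemma metric_trace_cmult: "metric_trace h (\<lambda>x y. c * B x y) = c * metric_trace h B"
  by (simp add: metric_trace_def sum_distrib_left mult.left_commute)

lemma metric_trace_mult: "metric_trace h (\<lambda>x y. B x y * c) = metric_trace h B * c"
  using metric_trace_cmult[of h c B] by (simp only: mult.commute[of c])

lemma metric_trace_minus: "metric_trace h (\<lambda>x y. - B x y) = - metric_trace h B"
  using metric_trace_cmult[of h "-1" B] by simp

lemma metric_trace_diff:
  "metric_trace h (\<lambda>x y. B x y - C x y) = metric_trace h B - metric_trace h C"
  using metric_trace_add[of h B "\<lambda>x y. - C x y"] by (simp add: metric_trace_minus)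

lemma metric_trace_zero: "metric_trace h (\<lambda>x y. 0) = 0"
  by (simp add: metric_trace_def)

locale scalar_product =
  fixes h :: "'e::euclidean_space \<Rightarrow> 'e \<Rightarrow> real"
  assumes bil_h: "bilinear h"
    and h_sym: "h v w = h w v"
    and h_nondeg: "(\<And>w. h v w = 0) \<Longrightarrow> v = 0"
begin

lemma linear_h_left: "linear (\<lambda>v. h v w)" and linear_h_right: "linear (h v)"
  using bil_h unfolding bilinear_def by auto

text \<open>The choice in \<open>gram_inv\<close> is not void: nondegeneracy makes the map \<open>H\<close> that represents \<open>h\<close> with
  respect to the Euclidean inner product injective, hence surjective, and the components of preimages of
  the basis vectors form an inverse of the Gram matrix.\<close>

lemma gram_inv_inverse:
  assumes "i \<in> Basis" "j \<in> Basis"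
  shows "(\<Sum>k\<in>Basis. gram_inv h i k * h k j) = (if i = j then 1 else 0)"
proof -
  define H where "H x = (\<Sum>b\<in>Basis. h x b *\<^sub>R b)" for x
  have linH: "linear H"
    by (rule linearI)
      (simp_all add: H_def linear_add[OF linear_h_left] linear_scale[OF linear_h_left]
        scaleR_add_left sum.distrib scaleR_sum_right)
  have H_inner: "H x \<bullet> b = h x b" if "b \<in> Basis" for x b
    using that by (simp add: H_def inner_sum_left inner_Basis sum.delta if_distrib cong: if_cong)
  have "v = 0" if "H v = 0" for v
  proof (rule h_nondeg)
    fix w
    have "h v w = (\<Sum>b\<in>Basis. (w \<bullet> b) *\<^sub>R h v b)" by (rule linear_apply_Basis[OF linear_h_right])
    also have "\<dots> = 0" by (simp add: that flip: H_inner)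
    finally show "h v w = 0" .
  qed
  then have "inj H" using linear_injective_0[OF linH] by blast
  then have "surj H" by (rule linear_injective_imp_surjective[OF linH]) (rule refl)
  then have R: "H (inv H v) = v" for v by (rule surj_f_inv_f)
  have "(\<Sum>k\<in>Basis. (inv H i \<bullet> k) * h k j) = (if i = j then 1 else 0)"
    if "i \<in> Basis" "j \<in> Basis" for i j
  proof -
    have "(\<Sum>k\<in>Basis. (inv H i \<bullet> k) * h k j) = h (inv H i) j"
      using linear_apply_Basis[OF linear_h_left, of "inv H i" j] by simp
    also have "\<dots> = i \<bullet> j" using H_inner[OF that(2), of "inv H i"] R by simp
    finally show ?thesis using that by (simp add: inner_Basis)
  qed
  then have "\<exists>m. \<forall>i\<in>Basis. \<forall>j\<in>Basis. (\<Sum>k\<in>Basis. m i k * h k j) = (if i = j then 1 else 0)"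
    by (intro exI[of _ "\<lambda>i k. inv H i \<bullet> k"]) simp
  then have "\<forall>i\<in>Basis. \<forall>j\<in>Basis. (\<Sum>k\<in>Basis. gram_inv h i k * h k j) = (if i = j then 1 else 0)"
    unfolding gram_inv_def by (rule someI_ex)
  then show ?thesis using assms by blast
qed

text \<open>The rows of \<open>gram_inv h\<close> are the vectors \<open>h\<close>-dual to the standard basis. All properties of the trace,
  in particular the symmetry of \<open>gram_inv h\<close>, follow from this description.\<close>

definition dual_basis :: "'e \<Rightarrow> 'e" where
  "dual_basis i = (\<Sum>k\<in>Basis. gram_inv h i k *\<^sub>R k)"

lemma h_dual_basis:
  assumes "i \<in> Basis"
  shows "h (dual_basis i) v = i \<bullet> v"
proof -
  have *: "h (dual_basis i) b = (if i = b then 1 else 0)" if "b \<in> Basis" for b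
    using gram_inv_inverse[OF assms that]
    by (simp add: dual_basis_def linear_sum[OF linear_h_left] linear_scale[OF linear_h_left])
  have "h (dual_basis i) v = (\<Sum>b\<in>Basis. (v \<bullet> b) *\<^sub>R h (dual_basis i) b)"
    by (rule linear_apply_Basis[OF linear_h_right])
  also have "\<dots> = (\<Sum>b\<in>Basis. if i = b then v \<bullet> b else 0)"
    by (rule sum.cong[OF refl]) (simp add: *)
  also have "\<dots> = i \<bullet> v" using assms by (simp add: sum.delta inner_commute)
  finally show ?thesis .
qed

lemma gram_inv_eq: "i \<in> Basis \<Longrightarrow> j \<in> Basis \<Longrightarrow> gram_inv h i j = dual_basis i \<bullet> j"
  by (simp add: dual_basis_def inner_sum_left inner_Basis sum.delta if_distrib cong: if_cong)

lemma gram_inv_sym: "i \<in> Basis \<Longrightarrow> j \<in> Basis \<Longrightarrow> gram_inv h i j = gram_inv h j i"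
  using h_dual_basis[of i "dual_basis j"] h_dual_basis[of j "dual_basis i"]
    h_sym[of "dual_basis i" "dual_basis j"]
  by (simp add: gram_inv_eq inner_commute)

lemma metric_trace_swap: "metric_trace h (\<lambda>x y. B y x) = metric_trace h B"
proof -
  have "metric_trace h (\<lambda>x y. B y x) = (\<Sum>i\<in>Basis. \<Sum>j\<in>Basis. gram_inv h j i * B j i)"
    unfolding metric_trace_def by (intro sum.cong refl) (simp add: gram_inv_sym)
  also have "\<dots> = metric_trace h B"
    unfolding metric_trace_def by (rule sum.swap)
  finally show ?thesis .
qed

lemma h_dual_basis_sum: "h (dual_basis i) z = (\<Sum>k\<in>Basis. gram_inv h i k * h k z)"
  unfolding dual_basis_def
  by (simp only: linear_sum[OF linear_h_left] linear_scale[OF linear_h_left] real_scaleR_def)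

lemma metric_trace_contract:
  assumes "linear w"
  shows "metric_trace h (\<lambda>x y. w x * h y z) = w z"
proof -
  have "metric_trace h (\<lambda>x y. w x * h y z) = (\<Sum>i\<in>Basis. w i * h (dual_basis i) z)"
    unfolding metric_trace_def h_dual_basis_sum sum_distrib_left
    by (intro sum.cong refl mult.left_commute)
  also have "\<dots> = (\<Sum>i\<in>Basis. (z \<bullet> i) *\<^sub>R w i)"
    by (rule sum.cong[OF refl]) (simp add: h_dual_basis inner_commute)
  also have "\<dots> = w z" by (rule linear_apply_Basis[OF assms, symmetric])
  finally show ?thesis .
qed

lemma metric_trace_contract':
  assumes "linear w"
  shows "metric_trace h (\<lambda>x y. h x z * w y) = w z"
proof -
  have "metric_trace h (\<lambda>x y. h x z * w y) = metric_trace h (\<lambda>x y. w y * h x z)"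
    by (simp only: mult.commute)
  also have "\<dots> = metric_trace h (\<lambda>x y. w x * h y z)"
    by (rule metric_trace_swap[of "\<lambda>x y. w x * h y z"])
  finally show ?thesis by (simp only: metric_trace_contract[OF assms])
qed

lemma metric_trace_self: "metric_trace h h = real DIM('e)"
proof -
  have "metric_trace h h = (\<Sum>i\<in>Basis. h (dual_basis i) i)"
    unfolding metric_trace_def h_dual_basis_sum
    by (intro sum.cong refl arg_cong2[of _ _ _ _ "(*)"] h_sym)
  then show ?thesis by (simp add: h_dual_basis)
qed

lemma metric_trace_skew:
  assumes "\<And>x y. B x y = - B y x"
  shows "metric_trace h B = 0"
proof -
  have "metric_trace h B = metric_trace h (\<lambda>x y. - B y x)"
    by (rule arg_cong[of _ _ "metric_trace h"]) (intro ext, rule assms)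
  also have "\<dots> = - metric_trace h B"
    by (simp only: metric_trace_minus metric_trace_swap[of B])
  finally show ?thesis by simp
qed

text \<open>The vector that represents a linear form with respect to \<open>h\<close>.\<close>

definition sharp :: "('e \<Rightarrow> real) \<Rightarrow> 'e" where
  "sharp w = (\<Sum>i\<in>Basis. w i *\<^sub>R dual_basis i)"

lemma h_sharp:
  assumes "linear w"
  shows "h (sharp w) z = w z"
proof -
  have "h (sharp w) z = (\<Sum>i\<in>Basis. w i * h (dual_basis i) z)"
    unfolding sharp_def
    by (simp only: linear_sum[OF linear_h_left] linear_scale[OF linear_h_left] real_scaleR_def)
  also have "\<dots> = (\<Sum>i\<in>Basis. (z \<bullet> i) *\<^sub>R w i)"
    by (rule sum.cong[OF refl]) (simp add: h_dual_basis inner_commute)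
  also have "\<dots> = w z" by (rule linear_apply_Basis[OF assms, symmetric])
  finally show ?thesis .
qed

lemma h_eqI:
  assumes "\<And>z. h v z = h w z"
  shows "v = w"
proof -
  have "v - w = 0"
    by (rule h_nondeg) (simp add: linear_diff[OF linear_h_left] assms)
  then show ?thesis by simp
qed

lemma linear_theta:
  assumes "trilinear S"
  shows "linear (theta h S)"
proof (rule linearI)
  have lin: "linear (S x y)" for x y using assms by (simp add: trilinear_def)
  show "theta h S (a + b) = theta h S a + theta h S b" for a b
    by (simp add: theta_metric_trace linear_add[OF lin] metric_trace_add)
  show "theta h S (r *\<^sub>R a) = r *\<^sub>R theta h S a" for r a
    by (simp add: theta_metric_trace linear_scale[OF lin] metric_trace_cmult)
qed

end

section \<open>Pointwise algebra of almost contact metric structures\<close>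

lemma
  assumes "trilinear S"
  shows trilinear_add: "S (a + b) y z = S a y z + S b y z" "S x (a + b) z = S x a z + S x b z"
      "S x y (a + b) = S x y a + S x y b"
    and trilinear_diff: "S (a - b) y z = S a y z - S b y z" "S x (a - b) z = S x a z - S x b z"
      "S x y (a - b) = S x y a - S x y b"
    and trilinear_minus: "S (- a) y z = - S a y z" "S x (- a) z = - S x a z" "S x y (- a) = - S x y a"
    and trilinear_scale: "S (r *\<^sub>R a) y z = r * S a y z" "S x (r *\<^sub>R a) z = r * S x a z"
      "S x y (r *\<^sub>R a) = r * S x y a"
    and trilinear_0: "S 0 y z = 0" "S x 0 z = 0" "S x y 0 = 0"
proof -
  have l: "linear (\<lambda>a. S a y z)" "linear (\<lambda>a. S x a z)" "linear (\<lambda>a. S x y a)" for x y z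
    using assms by (auto simp: trilinear_def)
  show "S (a + b) y z = S a y z + S b y z" by (rule linear_add[OF l(1)])
  show "S x (a + b) z = S x a z + S x b z" by (rule linear_add[OF l(2)])
  show "S x y (a + b) = S x y a + S x y b" by (rule linear_add[OF l(3)])
  show "S (a - b) y z = S a y z - S b y z" by (rule linear_diff[OF l(1)])
  show "S x (a - b) z = S x a z - S x b z" by (rule linear_diff[OF l(2)])
  show "S x y (a - b) = S x y a - S x y b" by (rule linear_diff[OF l(3)])
  show "S (- a) y z = - S a y z" by (rule linear_neg[OF l(1)])
  show "S x (- a) z = - S x a z" by (rule linear_neg[OF l(2)])
  show "S x y (- a) = - S x y a" by (rule linear_neg[OF l(3)])
  show "S (r *\<^sub>R a) y z = r * S a y z" using linear_scale[OF l(1)] by (simp only: real_scaleR_def)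
  show "S x (r *\<^sub>R a) z = r * S x a z" using linear_scale[OF l(2)] by (simp only: real_scaleR_def)
  show "S x y (r *\<^sub>R a) = r * S x y a" using linear_scale[OF l(3)] by (simp only: real_scaleR_def)
  show "S 0 y z = 0" by (rule linear_0[OF l(1)])
  show "S x 0 z = 0" by (rule linear_0[OF l(2)])
  show "S x y 0 = 0" by (rule linear_0[OF l(3)])
qed

definition class_equation :: "('e \<Rightarrow> 'e) \<Rightarrow> ('e \<Rightarrow> 'e \<Rightarrow> 'e \<Rightarrow> real) \<Rightarrow> bool" where
  "class_equation f S \<longleftrightarrow>
     (\<forall>x y z. S (f x) y z + S (f y) x z + S x y (f z) + S y x (f z) = 0)"

locale contact_space = scalar_product h
  for h :: "'e::euclidean_space \<Rightarrow> 'e \<Rightarrow> real" +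
  fixes f :: "'e \<Rightarrow> 'e" and x0 :: 'e and e :: "'e \<Rightarrow> real"
  assumes lin_f: "linear f" and lin_e: "linear e"
    and f_f: "f (f v) = e v *\<^sub>R x0 - v" and f_x0: "f x0 = 0"
    and e_f: "e (f v) = 0" and e_x0: "e x0 = 1"
    and h_f_f: "h (f v) (f w) = h v w + e v * e w"
    and e_h: "e v = - h x0 v"
begin

lemmas h_simps = linear_add[OF linear_h_left] linear_add[OF linear_h_right]
  linear_neg[OF linear_h_left] linear_neg[OF linear_h_right]
  linear_diff[OF linear_h_left] linear_diff[OF linear_h_right]
  linear_scale[OF linear_h_left] linear_scale[OF linear_h_right]
  linear_0[OF linear_h_left] linear_0[OF linear_h_right]

lemmas f_simps = linear_add[OF lin_f] linear_neg[OF lin_f] linear_diff[OF lin_f]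
  linear_scale[OF lin_f] linear_0[OF lin_f]

lemmas e_simps = linear_add[OF lin_e] linear_neg[OF lin_e] linear_diff[OF lin_e]
  linear_scale[OF lin_e] linear_0[OF lin_e]

lemma h_x0: "h x0 v = - e v" "h v x0 = - e v"
  using e_h[of v] h_sym[of v x0] by linarith+

lemma h_f_left: "h (f v) w = - h v (f w)"
  using h_f_f[of v "f w"] by (simp add: f_f h_simps h_x0 e_f)

lemma f_f_f: "f (f (f v)) = - f v"
  by (simp add: f_f[of "f v"] e_f)

text \<open>For the tensor \<open>F\<close> of a manifold, \<open>K x y\<close> is \<open>g (\<nabla>\<^sub>x \<xi>) y\<close>.\<close>

definition K :: "('e \<Rightarrow> 'e \<Rightarrow> 'e \<Rightarrow> real) \<Rightarrow> 'e \<Rightarrow> 'e \<Rightarrow> real" where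
  "K S x y = S x (f y) x0"

context
  fixes S assumes S: "F_type f x0 e S"
begin

lemma F_trilinear: "trilinear S" and F_skew: "S x y z = - S x z y"
  using S unfolding F_type_def by blast+

lemmas S_simps = trilinear_add[OF F_trilinear] trilinear_minus[OF F_trilinear]
  trilinear_diff[OF F_trilinear]  trilinear_scale[OF F_trilinear] trilinear_0[OF F_trilinear]

lemma F_diag: "S x y y = 0"
  using F_skew[of x y y] by linarith

lemma F_x0_last: "S x y x0 = - K S x (f y)"
  using F_diag[of x x0] by (simp add: K_def f_f S_simps)

lemma F_x0_middle: "S x x0 y = K S x (f y)"
  using F_skew[of x x0 y] F_x0_last[of x y] by simp

lemma K_f_f_right: "K S x (f (f y)) = - K S x y"
  by (simp add: K_def f_f_f S_simps)

lemma F_f_middle: "S x (f y) z = S x y (f z) + K S x y * e z + e y * K S x z"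
proof -
  have "S x (f y) z = - S x (f (f y)) (f z) + S x x0 z * e (f y) + S x (f y) x0 * e z"
    using S unfolding F_type_def by blast
  then show ?thesis
    by (simp add: e_f f_f[of y] S_simps F_x0_middle K_f_f_right) (simp add: K_def)
qed

lemma K_add_left: "K S (a + b) y = K S a y + K S b y"
  and K_scale_left: "K S (r *\<^sub>R a) y = r * K S a y"
  and K_diff_left: "K S (a - b) y = K S a y - K S b y"
  and K_0_left: "K S 0 y = 0"
  and K_0_right: "K S x 0 = 0"
  by (simp_all add: K_def S_simps f_simps)

lemma class_equation_K_x0:
  assumes "class_equation f S"
  shows "K S x0 y = 0"
proof -
  have "S (f x0) x0 y + S (f x0) x0 y + S x0 x0 (f y) + S x0 x0 (f y) = 0"
    using assms unfolding class_equation_def by blast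
  then show ?thesis by (simp add: f_x0 S_simps F_x0_middle K_f_f_right K_0_left)
qed

text \<open>With \<open>z = \<xi>\<close> the class equation is skew-symmetry of \<open>K\<close> on vectors \<open>f x\<close>, \<open>f y\<close>; with
  \<open>x = y = \<xi>\<close> it gives \<open>K \<xi> y = 0\<close>, which extends the skew-symmetry to all vectors.\<close>

lemma class_equation_K_skew:
  assumes "class_equation f S"
  shows "K S x y = - K S y x"
proof -
  note K0 = class_equation_K_x0[OF assms]
  have hor: "K S a b = K S (f (f a)) (f (f b))" for a b
    using f_f[of a] by (simp add: K_f_f_right K_add_left K_diff_left K_scale_left K0)
  have "S (f a) b x0 + S (f b) a x0 + S a b (f x0) + S b a (f x0) = 0" for a b
    using assms unfolding class_equation_def by blast
  then have "K S (f a) (f b) + K S (f b) (f a) = 0" for a b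
    by (simp add: f_x0 S_simps F_x0_last) (smt (verit))
  from this[of "f x" "f y"] show ?thesis using hor[of x y] hor[of y x] by simp
qed

text \<open>With \<open>x = \<xi>\<close> the class equation does not make \<open>F(\<xi>,\<cdot>,\<cdot>)\<close> vanish, but expresses it by \<open>K\<close>; it
  vanishes iff \<open>K\<close> is invariant under \<open>f\<close>.\<close>

lemma class_equation_F_x0:
  assumes "class_equation f S"
  shows "S x0 y (f z) = K S y z - K S (f y) (f z)"
proof -
  have "S (f x0) y z + S (f y) x0 z + S x0 y (f z) + S y x0 (f z) = 0"
    using assms unfolding class_equation_def by blast
  then show ?thesis by (simp add: f_x0 S_simps F_x0_middle K_f_f_right)
qed

subsection \<open>The Nijenhuis tensor\<close>

definition Nij :: "'e \<Rightarrow> 'e \<Rightarrow> 'e \<Rightarrow> real" where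
  "Nij x y z = S (f x) y z - S (f y) x z + S x y (f z) - S y x (f z)
     + (K S x y - K S y x) * e z"

definition c_form :: "'e \<Rightarrow> 'e \<Rightarrow> 'e \<Rightarrow> real" where
  "c_form x y z = S (f x) y z + S x y (f z) + K S x y * e z"

lemma c_form_skew23: "c_form x y z = - c_form x z y"
  using F_f_middle[of x y z] F_skew[of x "f y" z] F_skew[of "f x" y z]
  by (simp add: c_form_def algebra_simps)

lemma Nij_c_form: "Nij x y z = c_form x y z - c_form y x z"
  by (simp add: Nij_def c_form_def algebra_simps)

text \<open>When \<open>K\<close> is skew, the class equation says that \<open>c\<close> is skew in its first two arguments. As
  \<open>c\<close> is always skew in the last two, this makes \<open>c\<close> alternating and \<open>N = 2c\<close>; conversely a \<open>3\<close>-form \<open>N\<close>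
  vanishes on \<open>(x, y, y)\<close>, which gives \<open>c y x y = 0\<close>.\<close>

lemma class_equation_iff_Nij:
  "class_equation f S \<longleftrightarrow>
     (\<forall>x y z. Nij x y z = - Nij y x z \<and> Nij x y z = - Nij x z y) \<and> (\<forall>x y. K S x y + K S y x = 0)"
proof
  assume ce: "class_equation f S"
  note K = class_equation_K_skew[OF ce]
  have c12: "c_form x y z = - c_form y x z" for x y z
  proof -
    have "S (f x) y z + S (f y) x z + S x y (f z) + S y x (f z) = 0"
      using ce unfolding class_equation_def by blast
    moreover have "K S x y * e z = - (K S y x * e z)" by (subst K) simp
    ultimately show ?thesis unfolding c_form_def by linarith
  qed
  then have N: "Nij x y z = 2 * c_form x y z" for x y z
    using Nij_c_form[of x y z] c12[of x y z] by linarith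
  have "Nij x y z = - Nij y x z \<and> Nij x y z = - Nij x z y" for x y z
    unfolding N using c12[of x y z] c_form_skew23[of x y z] by linarith
  moreover have "K S x y + K S y x = 0" for x y using K[of x y] by linarith
  ultimately show "(\<forall>x y z. Nij x y z = - Nij y x z \<and> Nij x y z = - Nij x z y) \<and>
      (\<forall>x y. K S x y + K S y x = 0)" by blast
next
  assume *: "(\<forall>x y z. Nij x y z = - Nij y x z \<and> Nij x y z = - Nij x z y) \<and>
      (\<forall>x y. K S x y + K S y x = 0)"
  have c0: "c_form y x y = 0" for x y
  proof -
    have "Nij x y y = - Nij x y y" using * by blast
    then show ?thesis
      using Nij_c_form[of x y y] c_form_skew23[of x y y] c_form_skew23[of y x y] by linarith
  qed
  have add: "c_form (a + b) y (a + b) = c_form a y a + c_form a y b + c_form b y a + c_form b y b" for a b y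
    by (simp add: c_form_def S_simps f_simps K_add_left e_simps algebra_simps)
  have c13: "c_form x y z = - c_form z y x" for x y z
    using add[of x z y] c0[of "x + z" y] c0[of x y] c0[of z y] by linarith
  have c12: "c_form x y z = - c_form y x z" for x y z
    using c13[of x y z] c_form_skew23[of z y x] c13[of z x y] by linarith
  have K: "K S x y + K S y x = 0" for x y using * by blast
  show "class_equation f S"
    unfolding class_equation_def
  proof (intro allI)
    fix x y z
    have "K S x y * e z + K S y x * e z = 0" by (simp add: K flip: distrib_right)
    then show "S (f x) y z + S (f y) x z + S x y (f z) + S y x (f z) = 0"
      using c12[of x y z] unfolding c_form_def by linarith
  qed
qed

subsection \<open>The torsion form\<close>

definition T1 :: "'e \<Rightarrow> 'e \<Rightarrow> 'e \<Rightarrow> real" where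
  "T1 x y z = S x y (f z) - S y x (f z) - S (f z) x y + 2 * S x (f y) x0 * e z"

lemma trilinear_T1: "trilinear T1"
  unfolding trilinear_def T1_def
  by (intro conjI allI linearI) (simp_all add: S_simps f_simps e_simps algebra_simps)

lemma T1_skew12:
  assumes "class_equation f S"
  shows "T1 x y z = - T1 y x z"
proof -
  have "S x (f y) x0 * e z = - (S y (f x) x0 * e z)"
    using class_equation_K_skew[OF assms, of x y] unfolding K_def by (simp only: minus_mult_left)
  then show ?thesis using F_skew[of "f z" x y] unfolding T1_def by linarith
qed

text \<open>The class equation at \<open>(x, y, y)\<close> gives \<open>T1 x y y = 0\<close>; the rest is polarization.\<close>

lemma T1_skew23:
  assumes "class_equation f S"
  shows "T1 x y z = - T1 x z y"
proof -
  have 0: "T1 x y y = 0" for x y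
  proof -
    have "S (f x) y y + S (f y) x y + S x y (f y) + S y x (f y) = 0"
      using assms unfolding class_equation_def by blast
    moreover have "S x (f y) y = S x y (f y) + K S x y * e y + e y * K S x y" by (rule F_f_middle)
    moreover have "S x (f y) y = - S x y (f y)" by (rule F_skew)
    ultimately show ?thesis
      using F_diag[of "f x" y] unfolding T1_def K_def mult.commute[of "e y"] by linarith
  qed
  have "T1 x (y + z) (y + z) = T1 x y y + T1 x y z + T1 x z y + T1 x z z"
    by (simp add: trilinear_add[OF trilinear_T1])
  then show ?thesis by (simp add: 0)
qed

text \<open>This expresses that \<open>\<nabla> + T\<^sub>1/2\<close> makes \<open>\<xi>\<close> parallel.\<close>

lemma T1_x0:
  assumes "class_equation f S"
  shows "T1 x x0 z = - 2 * K S x z"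
  using class_equation_F_x0[OF assms, of x z] class_equation_K_skew[OF assms, of "f x" "f z"]
  by (simp add: T1_def f_x0 f_simps S_simps F_x0_middle F_x0_last K_f_f_right K_0_right)

text \<open>This expresses that \<open>\<nabla> + T\<^sub>1/2\<close> makes \<open>\<phi>\<close> parallel. Up to terms in \<open>\<eta>\<close>, which cancel by the formula for
  \<open>F(\<xi>,\<cdot>,\<cdot>)\<close>, replacing \<open>z\<close> by \<open>f z\<close> removes \<open>f\<close> from all three terms of \<open>T\<^sub>1\<close>.\<close>

lemma T1_parallel:
  assumes "class_equation f S"
  shows "2 * S x y z + T1 x (f y) z + T1 x y (f z) = 0"
proof -
  have F0: "S x0 a b = - K S a (f b) - K S (f a) b" for a b
  proof -
    have "S x0 a (f (f b)) = K S a (f b) - K S (f a) (f (f b))"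
      by (rule class_equation_F_x0[OF assms])
    moreover have "S x0 a x0 = 0"
      by (simp add: F_x0_last class_equation_K_x0[OF assms])
    moreover have "S x0 a (f (f b)) = e b * S x0 a x0 - S x0 a b" by (simp add: f_f S_simps)
    ultimately show ?thesis by (simp only: K_f_f_right)
  qed
  have T: "T1 x y (f z) = - S x y z + S y x z + S z x y" for x y z
  proof -
    have "T1 x y (f z) = - S x y z + S y x z + S z x y
        + e z * (S x y x0 - S y x x0 - S x0 x y)"
      by (simp add: T1_def f_f[of z] S_simps e_f algebra_simps)
    moreover have "S x y x0 - S y x x0 - S x0 x y = 0"
      using F0[of x y] class_equation_K_skew[OF assms, of y "f x"]
      by (simp add: F_x0_last)
    ultimately show ?thesis by simp
  qed
  show ?thesis
    using T[of x y z] T[of x z y] T1_skew23[OF assms, of x "f y" z] F_skew[of x y z] F_skew[of y x z]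
      F_skew[of z x y] by linarith
qed

end

end

section \<open>The five basic classes\<close>

context contact_space
begin

lemma F_type_lincomb:
  assumes "F_type f x0 e S" "F_type f x0 e S'"
  shows "F_type f x0 e (\<lambda>x y z. a * S x y z + b * S' x y z)"
proof -
  note s = trilinear_add[OF F_trilinear[OF assms(1)]] trilinear_add[OF F_trilinear[OF assms(2)]]
    trilinear_scale[OF F_trilinear[OF assms(1)]] trilinear_scale[OF F_trilinear[OF assms(2)]]
  have "trilinear (\<lambda>x y z. a * S x y z + b * S' x y z)"
    unfolding trilinear_def by (intro conjI allI linearI) (simp_all add: s algebra_simps)
  moreover have "a * S x y z + b * S' x y z = - (a * S x z y + b * S' x z y)" for x y z
    by (simp add: F_skew[OF assms(1), of x y z] F_skew[OF assms(2), of x y z])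
  moreover have "a * S x y z + b * S' x y z = - (a * S x (f y) (f z) + b * S' x (f y) (f z)) +
      (a * S x x0 z + b * S' x x0 z) * e y + (a * S x y x0 + b * S' x y x0) * e z" for x y z
  proof -
    have "S x y z = - S x (f y) (f z) + S x x0 z * e y + S x y x0 * e z"
      "S' x y z = - S' x (f y) (f z) + S' x x0 z * e y + S' x y x0 * e z"
      using assms unfolding F_type_def by blast+
    then have "a * S x y z + b * S' x y z =
        a * (- S x (f y) (f z) + S x x0 z * e y + S x y x0 * e z)
        + b * (- S' x (f y) (f z) + S' x x0 z * e y + S' x y x0 * e z)" by (simp only:)
    then show ?thesis by (simp add: algebra_simps)
  qed
  ultimately show ?thesis unfolding F_type_def by blast
qed

text \<open>The vertical part of \<open>F\<close>, built from \<open>B = F(\<cdot>, \<cdot>, \<xi>)\<close>, lies in \<open>P\<^sub>2 \<oplus> P\<^sub>4\<close>.\<close>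

definition vertical :: "('e \<Rightarrow> 'e \<Rightarrow> real) \<Rightarrow> 'e \<Rightarrow> 'e \<Rightarrow> 'e \<Rightarrow> real" where
  "vertical B x y z = B x y * e z - B x z * e y"

lemma F_type_vertical:
  assumes "bilinear B" "\<And>x. B x x0 = 0"
  shows "F_type f x0 e (vertical B)"
proof -
  have l: "linear (\<lambda>x. B x y)" "linear (B x)" for x y
    using assms(1) unfolding bilinear_def by auto
  note s = linear_add[OF l(1)] linear_add[OF l(2)] linear_scale[OF l(1)] linear_scale[OF l(2)]
  have "trilinear (vertical B)"
    unfolding trilinear_def vertical_def
    by (intro conjI allI linearI) (simp_all add: s e_simps algebra_simps)
  then show ?thesis
    unfolding F_type_def by (simp add: vertical_def e_f e_x0 assms(2))
qed

lemma theta_vertical: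
  assumes "bilinear B" "\<And>z. B x0 z = 0"
  shows "theta h (vertical B) z = metric_trace h B * e z"
proof -
  have l: "linear (\<lambda>x. B x z)" using assms(1) unfolding bilinear_def by auto
  have "metric_trace h (\<lambda>x y. B x z * e y) = metric_trace h (\<lambda>x y. - (B x z * h y x0))"
    by (simp add: h_x0)
  also have "\<dots> = 0"
    by (simp add: metric_trace_minus metric_trace_contract[OF l] assms(2))
  finally show ?thesis
    unfolding theta_metric_trace vertical_def metric_trace_diff metric_trace_mult by simp
qed

text \<open>Invariance of \<open>B\<close> under \<open>f\<close> means \<open>B (f x) y = - B x (f y)\<close>, and the terms cancel by symmetry.\<close>

lemma class_equation_vertical:
  assumes B: "bilinear B" "\<And>x y. B x y = B y x" "\<And>x y. B x y = B (f x) (f y)"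
  shows "class_equation f (vertical B)"
proof -
  have l: "linear (\<lambda>x. B x y)" "linear (B x)" for x y
    using assms(1) unfolding bilinear_def by auto
  have x0: "B x0 y = 0" for y
    using B(3)[of x0 y] by (simp add: f_x0 linear_0[OF l(1)])
  have Bf: "B (f x) y = - B x (f y)" for x y
    using B(3)[of "f x" y] by (simp add: f_f linear_diff[OF l(1)] linear_scale[OF l(1)] x0)
  show ?thesis
    unfolding class_equation_def vertical_def e_f
  proof (intro allI)
    fix x y z
    show "B (f x) y * e z - B (f x) z * e y + (B (f y) x * e z - B (f y) z * e x)
        + (B x y * 0 - B x (f z) * e y) + (B y x * 0 - B y (f z) * e x) = 0"
      unfolding Bf[of x y] Bf[of x z] Bf[of y z] B(2)[of "f y" x] by simp
  qed
qed

text \<open>As \<open>\<xi>\<close> is time-like, adding \<open>\<eta> \<otimes> \<eta>\<close> makes \<open>\<xi>\<close> orthogonal to every vector.\<close>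

definition h_horizontal :: "'e \<Rightarrow> 'e \<Rightarrow> real" where
  "h_horizontal x y = h x y + e x * e y"

lemma bilinear_h_horizontal: "bilinear (\<lambda>x y. c * h_horizontal x y)"
  unfolding bilinear_def h_horizontal_def
  by (intro conjI allI linearI) (simp_all add: h_simps e_simps algebra_simps)

lemma h_horizontal_x0: "h_horizontal x x0 = 0" "h_horizontal x0 x = 0"
  by (simp_all add: h_horizontal_def h_x0 e_x0)

lemma h_horizontal_eq: "h_horizontal x y = h (f x) (f y)"
  by (simp add: h_horizontal_def h_f_f)

lemma metric_trace_h_horizontal: "metric_trace h h_horizontal = real DIM('e) - 1"
proof -
  have "metric_trace h (\<lambda>x y. e x * e y) = metric_trace h (\<lambda>x y. - (e x * h y x0))"
    by (simp add: h_x0)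
  also have "\<dots> = - 1"
    by (simp add: metric_trace_minus metric_trace_contract[OF lin_e] e_x0)
  finally show ?thesis
    unfolding h_horizontal_def[abs_def] metric_trace_add metric_trace_self by simp
qed

lemma vertical_h_horizontal:
  "vertical (\<lambda>x y. c * h_horizontal x y) x y z = c * (h x y * e z - h x z * e y)"
  by (simp add: vertical_def h_horizontal_def algebra_simps)

text \<open>The tensor of class \<open>P\<^sub>9\<close> with prescribed trace \<open>t\<close>, up to the factor \<open>c = 1/(4n)\<close>.\<close>

definition P9_tensor :: "real \<Rightarrow> ('e \<Rightarrow> real) \<Rightarrow> 'e \<Rightarrow> 'e \<Rightarrow> 'e \<Rightarrow> real" where
  "P9_tensor c t x y z = c * (h (f x) y * t (f z) - h (f x) z * t (f y)
     - h (f x) (f y) * t (f (f z)) + h (f x) (f z) * t (f (f y)))"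

lemma h_f_x0: "h (f x) x0 = 0"
  by (simp add: h_x0 e_f)

lemma h_f_f_f: "h (f x) (f (f y)) = - h (f x) y" "h (f (f x)) y = - h (f x) (f y)"
  by (simp_all add: h_f_left f_f_f h_simps)

lemma P9_tensor_identities:
  assumes t: "linear t"
  shows "P9_tensor c t x0 y z = 0" and "P9_tensor c t x y x0 = 0"
    and "P9_tensor c t (f x) (f y) z = P9_tensor c t x y z"
    and "P9_tensor c t (f x) y z + P9_tensor c t x y (f z) = 0"
  unfolding P9_tensor_def
  by (simp_all add: f_x0 f_f_f h_f_f_f h_f_x0 h_simps f_simps linear_neg[OF t] linear_0[OF t] algebra_simps)

lemma F_type_P9_tensor:
  assumes t: "linear t"
  shows "F_type f x0 e (P9_tensor c t)"
proof -
  have tri: "trilinear (P9_tensor c t)"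
    unfolding trilinear_def P9_tensor_def
    by (intro conjI allI linearI)
      (simp_all add: h_simps f_simps linear_add[OF t] linear_scale[OF t] algebra_simps)
  have skew: "P9_tensor c t x y z = - P9_tensor c t x z y" for x y z
    by (simp add: P9_tensor_def algebra_simps)
  have last: "P9_tensor c t x y x0 = 0" for x y by (rule P9_tensor_identities[OF t])
  have middle: "P9_tensor c t x x0 y = 0" for x y using skew[of x x0 y] last[of x y] by linarith
  have inv: "P9_tensor c t x y z = - P9_tensor c t x (f y) (f z)" for x y z
    unfolding P9_tensor_def
    by (simp add: f_f_f h_f_f_f h_simps linear_neg[OF t] algebra_simps)
  show ?thesis
    unfolding F_type_def last middle
  proof (intro conjI allI)
    show "P9_tensor c t x y z = - P9_tensor c t x (f y) (f z) + 0 * e y + 0 * e z" for x y z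
      using inv[of x y z] by linarith
  qed (rule tri, rule skew)
qed

text \<open>The four terms contribute \<open>0\<close>, \<open>1\<close>, \<open>-(DIM - 1)\<close> and \<open>1\<close> times \<open>t (f (f z))\<close>; for
  \<open>DIM = 4 n + 3\<close> they add up to \<open>-4 n t (f (f z)) = 4 n t z\<close>.\<close>

lemma theta_P9_tensor:
  assumes t: "linear t" and t0: "t x0 = 0"
  shows "theta h (P9_tensor c t) z = c * (real DIM('e) - 3) * t z"
proof -
  have t_ff: "t (f (f z)) = - t z"
    by (simp add: f_f linear_diff[OF t] linear_scale[OF t] t0)
  have ltf: "linear (\<lambda>y. t (f y))" "linear (\<lambda>y. t (f (f y)))"
    using linear_compose[OF lin_f t] linear_compose[OF lin_f linear_compose[OF lin_f t]]
    by (simp_all add: o_def)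
  have 1: "metric_trace h (\<lambda>x y. h (f x) y) = 0"
  proof (rule metric_trace_skew)
    show "h (f x) y = - h (f y) x" for x y by (simp only: h_f_left h_sym[of x])
  qed
  have 2: "metric_trace h (\<lambda>x y. h (f x) z * t (f y)) = - t (f (f z))"
    using metric_trace_contract'[OF ltf(1), of "f z"] by (simp add: h_f_left metric_trace_minus)
  have 3: "metric_trace h (\<lambda>x y. h (f x) (f y)) = real DIM('e) - 1"
    using metric_trace_h_horizontal by (simp only: h_horizontal_eq[abs_def])
  have 4: "metric_trace h (\<lambda>x y. h (f x) (f z) * t (f (f y))) = t (f (f z))"
  proof -
    have "metric_trace h (\<lambda>x y. h x x0 * t (f (f y))) = 0"
      using metric_trace_contract'[OF ltf(2), of x0] by (simp add: f_x0 f_simps linear_0[OF t])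
    then have "metric_trace h (\<lambda>x y. h x x0 * t (f (f y)) * (- e z)) = 0"
      by (simp only: metric_trace_mult mult_zero_left)
    moreover have "h (f x) (f z) * t (f (f y)) = h x z * t (f (f y)) + h x x0 * t (f (f y)) * (- e z)" for x y
      by (simp add: h_f_f h_x0 algebra_simps)
    ultimately show ?thesis
      by (simp only: metric_trace_add metric_trace_contract'[OF ltf(2)] add_0_right)
  qed
  have "theta h (P9_tensor c t) z = c * (0 * t (f z) - - t (f (f z))
      - (real DIM('e) - 1) * t (f (f z)) + t (f (f z)))"
    unfolding theta_metric_trace P9_tensor_def metric_trace_cmult metric_trace_add metric_trace_diff
      metric_trace_mult 1 2 3 4 ..
  then show ?thesis by (simp add: t_ff algebra_simps)
qed

subsection \<open>Members of the basic classes satisfy the class equation\<close>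

lemma class_P2_equation:
  assumes "class_P2 n x0 e h S"
  shows "class_equation f S" and "S x0 y z = 0"
proof -
  let ?c = "theta h S x0 / (2 * (2 * real n + 1))"
  have S: "S = vertical (\<lambda>x y. ?c * h_horizontal x y)"
    using assms unfolding class_P2_def by (intro ext) (simp only: vertical_h_horizontal)
  show "class_equation f S"
  proof (subst S, rule class_equation_vertical[OF bilinear_h_horizontal])
    show "?c * h_horizontal x y = ?c * h_horizontal y x" for x y
      by (simp add: h_horizontal_def h_sym[of x y] mult.commute)
    show "?c * h_horizontal x y = ?c * h_horizontal (f x) (f y)" for x y
      by (simp add: h_horizontal_def e_f h_f_f)
  qed
  show "S x0 y z = 0" by (subst S) (simp add: vertical_def h_horizontal_x0)
qed

lemma class_P4_equation:
  assumes "class_P4 f x0 e h S" and F: "F_type f x0 e S"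
  shows "class_equation f S" and "S x0 y z = 0"
proof -
  note s = trilinear_add[OF F_trilinear[OF F]] trilinear_scale[OF F_trilinear[OF F]]
    trilinear_0[OF F_trilinear[OF F]]
  have B: "S x y x0 = S y x x0" "S x y x0 = S (f x) (f y) x0" for x y
    using assms(1) unfolding class_P4_def by blast+
  have S: "S = vertical (\<lambda>x y. S x y x0)"
    using assms(1) unfolding class_P4_def vertical_def by (intro ext) blast
  have bil: "bilinear (\<lambda>x y. S x y x0)"
    unfolding bilinear_def by (intro conjI allI linearI) (simp_all add: s)
  show "class_equation f S"
    by (subst S, rule class_equation_vertical[OF bil B])
  have "S x0 y x0 = 0" for y using B(2)[of x0 y] by (simp add: f_x0 s)
  then show "S x0 y z = 0" using fun_cong[OF fun_cong[OF fun_cong[OF S]], of x0 y z]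
    by (simp add: vertical_def)
qed

lemma class_P9_equation:
  assumes "class_P9 n f h S" and F: "F_type f x0 e S"
  shows "class_equation f S" and "S x0 y z = 0"
proof -
  note t = linear_theta[OF F_trilinear[OF F]]
  have S: "S = P9_tensor (1 / (4 * real n)) (theta h S)"
    using assms(1) unfolding class_P9_def P9_tensor_def by (intro ext) blast
  have c: "S (f x) y z + S x y (f z) = 0" for x y z
    using P9_tensor_identities(4)[OF t, of "1 / (4 * real n)" x y z] unfolding S[symmetric] .
  show "class_equation f S"
    unfolding class_equation_def
  proof (intro allI)
    show "S (f x) y z + S (f y) x z + S x y (f z) + S y x (f z) = 0" for x y z
      using c[of x y z] c[of y x z] by linarith
  qed
  show "S x0 y z = 0"
    using P9_tensor_identities(1)[OF t, of "1 / (4 * real n)" y z] unfolding S[symmetric] .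
qed

lemma class_P10_equation:
  assumes "class_P10 f x0 h S" and F: "F_type f x0 e S"
  shows "class_equation f S" and "S x0 y z = 0"
proof -
  have P: "S x0 y z = 0" "S x y x0 = 0" "S x y z = S (f x) (f y) z" for x y z
    using assms(1) unfolding class_P10_def by blast+
  have c: "S (f x) y z + S x y (f z) = 0" for x y z
  proof -
    have "S (f x) y z = S (f (f x)) (f y) z" by (rule P(3))
    also have "\<dots> = - S x (f y) z"
      by (simp add: f_f[of x] trilinear_diff[OF F_trilinear[OF F]] trilinear_scale[OF F_trilinear[OF F]] P(1))
    also have "S x (f y) z = S x y (f z)"
      using F_f_middle[OF F, of x y z] by (simp add: K_def P(2))
    finally show ?thesis by simp
  qed
  show "class_equation f S"
    unfolding class_equation_def
  proof (intro allI)
    show "S (f x) y z + S (f y) x z + S x y (f z) + S y x (f z) = 0" for x y z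
      using c[of x y z] c[of y x z] by linarith
  qed
  show "S x0 y z = 0" by (rule P(1))
qed

lemma class_P11_equation:
  assumes "class_P11 x0 S" and F: "F_type f x0 e S"
  shows "class_equation f S" and "S x0 y z = 0"
proof -
  have P: "S x0 y z = 0" "S x y x0 = 0" "S x y z = - S y x z" for x y z
    using assms(1) unfolding class_P11_def by blast+
  have fm: "S x (f y) z = S x y (f z)" for x y z
    using F_f_middle[OF F, of x y z] by (simp add: K_def P(2))
  show "class_equation f S"
    unfolding class_equation_def
  proof (intro allI)
    fix x y z
    show "S (f x) y z + S (f y) x z + S x y (f z) + S y x (f z) = 0"
      using P(3)[of "f x" y z] P(3)[of "f y" x z] P(3)[of x y "f z"] fm[of x y z] fm[of y x z]
      by linarith
  qed
  show "S x0 y z = 0" by (rule P(1))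
qed

subsection \<open>Decomposition\<close>

text \<open>In dimension \<open>3\<close> there are no horizontal tensors: the horizontal plane is spanned by some \<open>u\<close> and \<open>f u\<close>,
  and \<open>R x u (f u) = R x (f u) u\<close> while \<open>R\<close> is skew in these arguments.\<close>

lemma horizontal_vanishes_dim3:
  assumes dim: "DIM('e) = 3" and tri: "trilinear R"
    and skew: "\<And>x y z. R x y z = - R x z y" and last: "\<And>x y. R x y x0 = 0"
    and fm: "\<And>x y z. R x (f y) z = R x y (f z)"
  shows "R x y z = 0"
proof -
  have "\<exists>v. f v \<noteq> 0"
  proof (rule ccontr)
    assume "\<nexists>v. f v \<noteq> 0"
    then have "v = e v *\<^sub>R x0" for v using f_f[of v] by auto
    then have "v \<in> span {x0}" for v unfolding span_singleton by blast
    then have "dim (UNIV :: 'e set) \<le> card {x0}"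
      by (intro dim_le_card) auto
    then show False using dim by simp
  qed
  then obtain v where v: "f v \<noteq> 0" by blast
  define u where "u = f v"
  have ffu: "f (f u) = - u" unfolding u_def by (rule f_f_f)
  have eu: "e u = 0" "e (f u) = 0" unfolding u_def by (rule e_f)+
  define L :: "real \<times> real \<times> real \<Rightarrow> 'e" where
    "L = (\<lambda>(a, b, c). a *\<^sub>R x0 + b *\<^sub>R u + c *\<^sub>R f u)"
  have linL: "linear L"
    by (rule linearI) (auto simp: L_def algebra_simps)
  have "p = 0" if "L p = 0" for p
  proof -
    obtain a b c where p: "p = (a, b, c)" by (cases p)
    have L0: "a *\<^sub>R x0 + b *\<^sub>R u + c *\<^sub>R f u = 0" using that by (simp add: p L_def)
    have "e (a *\<^sub>R x0 + b *\<^sub>R u + c *\<^sub>R f u) = 0" unfolding L0 by (rule linear_0[OF lin_e])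
    then have a: "a = 0" by (simp add: e_simps e_x0 eu)
    have 1: "b *\<^sub>R u + c *\<^sub>R f u = 0" using L0 a by simp
    have "f (b *\<^sub>R u + c *\<^sub>R f u) = 0" unfolding 1 by (rule linear_0[OF lin_f])
    then have 2: "b *\<^sub>R f u - c *\<^sub>R u = 0" by (simp add: f_simps ffu)
    have "(b * b + c * c) *\<^sub>R u = b *\<^sub>R (b *\<^sub>R u + c *\<^sub>R f u) - c *\<^sub>R (b *\<^sub>R f u - c *\<^sub>R u)"
      by (simp add: algebra_simps)
    also have "\<dots> = 0" unfolding 1 2 by simp
    finally have "b * b + c * c = 0" using v unfolding u_def by simp
    then have "b = 0 \<and> c = 0" by (simp add: sum_squares_eq_zero_iff)
    then show ?thesis using a by (simp add: p zero_prod_def)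
  qed
  then have inj: "inj L" using linear_injective_0[OF linL] by blast
  have "dim (range L) = dim (UNIV :: (real \<times> real \<times> real) set)"
    by (rule dim_image_eq[OF linL]) (use inj in simp)
  then have "dim (range L) = DIM('e)" by (simp add: dim)
  then have "span (range L) = UNIV" by (simp only: dim_eq_full)
  moreover have "span (range L) = range L"
    by (rule span_eq_iff[THEN iffD2], rule linear_subspace_image[OF linL subspace_UNIV])
  ultimately have surj: "\<exists>p. w = L p" for w by (metis UNIV_I imageE)
  note s = trilinear_add[OF tri] trilinear_scale[OF tri] trilinear_minus[OF tri]
  have diag: "R x y y = 0" for x y using skew[of x y y] by linarith
  have mid: "R x x0 y = 0" for x y using skew[of x x0 y] last[of x y] by linarith
  have ufu: "R x u (f u) = 0" "R x (f u) u = 0" for x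
    using fm[of x u u] skew[of x u "f u"] by linarith+
  obtain p q where "y = L p" "z = L q" using surj by metis
  moreover obtain a b c where "p = (a, b, c)" by (cases p)
  moreover obtain a' b' c' where "q = (a', b', c')" by (cases q)
  ultimately have "y = a *\<^sub>R x0 + b *\<^sub>R u + c *\<^sub>R f u" "z = a' *\<^sub>R x0 + b' *\<^sub>R u + c' *\<^sub>R f u"
    by (simp_all add: L_def)
  then show ?thesis by (simp add: s diag mid last ufu)
qed

text \<open>The horizontal part \<open>H\<close> satisfies \<open>H (f x) (f y) z + H (f y) (f x) z = H x y z + H y x z\<close>, so its
  anti-invariant part under \<open>(x, y) \<mapsto> (f x, f y)\<close> is a \<open>3\<close>-form (class \<open>P\<^sub>1\<^sub>1\<close>); removing from the invariant
  part the \<open>P\<^sub>9\<close>-tensor with the same trace leaves a tensor of class \<open>P\<^sub>1\<^sub>0\<close>.\<close>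

lemma horizontal_decomposition:
  assumes dim: "DIM('e) = 4 * n + 3" and H: "F_type f x0 e H" and ce: "class_equation f H"
    and first: "\<And>y z. H x0 y z = 0" and last: "\<And>x y. H x y x0 = 0"
  obtains S9 S10 S11 where
    "F_type f x0 e S9" "F_type f x0 e S10" "F_type f x0 e S11"
    "class_P9 n f h S9" "class_P10 f x0 h S10" "class_P11 x0 S11"
    "\<And>x y z. H x y z = S9 x y z + S10 x y z + S11 x y z"
proof -
  note s = trilinear_add[OF F_trilinear[OF H]] trilinear_scale[OF F_trilinear[OF H]]
    trilinear_diff[OF F_trilinear[OF H]] trilinear_minus[OF F_trilinear[OF H]] trilinear_0[OF F_trilinear[OF H]]
  have middle: "H x x0 y = 0" for x y using F_skew[OF H, of x x0 y] last[of x y] by linarith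
  have fm: "H x (f y) z = H x y (f z)" for x y z
    using F_f_middle[OF H, of x y z] by (simp add: K_def last)
  define J where "J x y z = H (f x) (f y) z" for x y z
  have JJ: "H (f (f x)) (f (f y)) z = H x y z" for x y z
    by (simp add: f_f s first middle)
  have J: "F_type f x0 e J"
  proof -
    have "trilinear J"
      unfolding trilinear_def J_def by (intro conjI allI linearI) (simp_all add: s f_simps)
    moreover have "J x y z = - J x z y" for x y z
      unfolding J_def fm[of "f x" z y] by (rule F_skew[OF H])
    moreover have "J x y z = - J x (f y) (f z) + J x x0 z * e y + J x y x0 * e z" for x y z
    proof -
      have "J x (f y) (f z) = - H (f x) y (f z)" unfolding J_def by (simp add: f_f[of y] s middle)
      then show ?thesis by (simp add: J_def f_x0 s last fm)
    qed
    ultimately show ?thesis unfolding F_type_def by blast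
  qed
  define S11 where "S11 x y z = 1/2 * H x y z + (- 1/2) * J x y z" for x y z
  define R where "R x y z = 1/2 * H x y z + 1/2 * J x y z" for x y z
  have FS11: "F_type f x0 e S11" and FR: "F_type f x0 e R"
    unfolding S11_def[abs_def] R_def[abs_def] by (rule F_type_lincomb[OF H J])+
  have P11: "class_P11 x0 S11"
    unfolding class_P11_def
  proof (intro conjI allI)
    show "S11 x0 y z = 0" for y z by (simp add: S11_def J_def first f_x0 s)
    show "S11 x y x0 = 0" for x y by (simp add: S11_def J_def last)
    fix x y z
    have "H (f x) y (f z) + H (f y) x (f z) + H x y (f (f z)) + H y x (f (f z)) = 0"
      using ce unfolding class_equation_def by blast
    then have "H (f x) (f y) z + H (f y) (f x) z = H x y z + H y x z"
      by (simp add: f_f[of z] s last fm)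
    then show "S11 x y z = - S11 y x z" by (simp add: S11_def J_def)
  qed
  have R_J: "R (f x) (f y) z = R x y z" for x y z by (simp add: R_def J_def JJ)
  have R0: "R x0 y z = 0" for y z by (simp add: R_def J_def first f_x0 s)
  have R_last: "R x y x0 = 0" for x y by (simp add: R_def J_def last)
  let ?t = "theta h R" and ?c = "1 / (4 * real n)"
  note lin_t = linear_theta[OF F_trilinear[OF FR]]
  have t0: "?t x0 = 0" unfolding theta_metric_trace R_last by (rule metric_trace_zero)
  define S9 where "S9 = P9_tensor ?c ?t"
  define S10 where "S10 x y z = 1 * R x y z + (- 1) * S9 x y z" for x y z
  have FS9: "F_type f x0 e S9" unfolding S9_def by (rule F_type_P9_tensor[OF lin_t])
  have FS10: "F_type f x0 e S10" unfolding S10_def[abs_def] by (rule F_type_lincomb[OF FR FS9])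
  have theta9: "theta h S9 = ?t"
  proof
    fix z
    show "theta h S9 z = ?t z"
    proof (cases "n = 0")
      case True
      have "R x y z = 0" for x y z
      proof (rule horizontal_vanishes_dim3[OF _ F_trilinear[OF FR] F_skew[OF FR] R_last])
        show "DIM('e) = 3" using dim True by simp
        show "R x (f y) z = R x y (f z)" for x y z
          using F_f_middle[OF FR, of x y z] by (simp add: K_def R_last)
      qed
      then have "?t z = 0" by (simp add: theta_metric_trace metric_trace_zero)
      then show ?thesis using theta_P9_tensor[OF lin_t t0, of ?c z] by (simp add: S9_def)
    next
      case False
      then show ?thesis using theta_P9_tensor[OF lin_t t0, of ?c z] dim by (simp add: S9_def)
    qed
  qed
  have P9: "class_P9 n f h S9"
    unfolding class_P9_def theta9 by (simp add: S9_def P9_tensor_def)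
  have P10: "class_P10 f x0 h S10"
    unfolding class_P10_def
  proof (intro conjI allI)
    note id9 = P9_tensor_identities[OF lin_t, of ?c, folded S9_def]
    show "S10 x0 y z = 0" for y z by (simp add: S10_def R0 id9)
    show "S10 x y x0 = 0" for x y by (simp add: S10_def R_last id9)
    show "S10 x y z = S10 (f x) (f y) z" for x y z by (simp add: S10_def R_J id9)
    have "theta h S10 z = ?t z - theta h S9 z" for z
      unfolding theta_metric_trace S10_def metric_trace_add metric_trace_cmult by simp
    then show "theta h S10 z = 0" for z by (simp add: theta9)
  qed
  have "H x y z = S9 x y z + S10 x y z + S11 x y z" for x y z
    by (simp add: S10_def S11_def R_def)
  then show ?thesis using that FS9 FS10 FS11 P9 P10 P11 by blast
qed

text \<open>The vertical part of \<open>F\<close> is split by the trace of \<open>B\<close>: \<open>\<kappa>\<close> is the factor for which \<open>\<kappa>\<close> times the horizontal metric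
  has the same trace as \<open>B\<close>, so that the difference meets the condition \<open>\<theta> = 0\<close> of \<open>P\<^sub>4\<close>. The rest of \<open>F\<close> is horizontal,
  and it still satisfies the class equation because the vertical part does.\<close>

lemma five_classes_decomposition:
  assumes dim: "DIM('e) = 4 * n + 3" and F: "F_type f x0 e S" and ce: "class_equation f S"
    and first: "\<And>y z. S x0 y z = 0"
  obtains S2 S4 S9 S10 S11 where "\<forall>S\<in>{S2, S4, S9, S10, S11}. F_type f x0 e S"
    "class_P2 n x0 e h S2" "class_P4 f x0 e h S4" "class_P9 n f h S9"
    "class_P10 f x0 h S10" "class_P11 x0 S11"
    "\<And>x y z. S x y z = S2 x y z + S4 x y z + S9 x y z + S10 x y z + S11 x y z"
proof -
  note s = trilinear_add[OF F_trilinear[OF F]] trilinear_scale[OF F_trilinear[OF F]]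
  note Ksk = class_equation_K_skew[OF F ce]
  have K_inv: "K S x y = K S (f x) (f y)" for x y
    using class_equation_F_x0[OF F ce, of x y] first[of x "f y"] by simp
  define B where "B x y = S x y x0" for x y
  have bilB: "bilinear B"
    unfolding bilinear_def B_def by (intro conjI allI linearI) (simp_all add: s)
  have B_K: "B x y = - K S x (f y)" for x y unfolding B_def by (rule F_x0_last[OF F])
  have B_sym: "B x y = B y x" for x y
    using K_inv[of x "f y"] Ksk[of "f x" y] by (simp add: B_K K_f_f_right[OF F])
  have B_inv: "B x y = B (f x) (f y)" for x y
    using K_inv[of x "f y"] by (simp add: B_K)
  have B_last: "B x x0 = 0" for x unfolding B_def by (rule F_diag[OF F])
  have B_first: "B x0 x = 0" for x unfolding B_def by (rule first)
  define \<kappa> where "\<kappa> = metric_trace h B / (2 * (2 * real n + 1))"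
  have n: "2 * (2 * real n + 1) \<noteq> 0" by (simp add: add_eq_0_iff)
  define B2 where "B2 x y = \<kappa> * h_horizontal x y" for x y
  define B4 where "B4 x y = B x y - B2 x y" for x y
  have bilB2: "bilinear B2" unfolding B2_def[abs_def] by (rule bilinear_h_horizontal)
  have l: "linear (\<lambda>x. B x y)" "linear (B x)" "linear (\<lambda>x. B2 x y)" "linear (B2 x)" for x y
    using bilB bilB2 unfolding bilinear_def by auto
  have bilB4: "bilinear B4"
    unfolding bilinear_def B4_def
    by (intro conjI allI linear_compose_sub l)
  have B2_0: "B2 x x0 = 0" "B2 x0 x = 0" for x by (simp_all add: B2_def h_horizontal_x0)
  have trB2: "metric_trace h B2 = metric_trace h B"
    unfolding B2_def[abs_def] metric_trace_cmult metric_trace_h_horizontal \<kappa>_def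
    using n dim by (simp add: field_simps)
  have P2: "class_P2 n x0 e h (vertical B2)"
    unfolding class_P2_def theta_vertical[OF bilB2 B2_0(2)] trB2 e_x0
    by (simp only: B2_def[abs_def] vertical_h_horizontal \<kappa>_def mult_1_right) blast
  have P4: "class_P4 f x0 e h (vertical B4)"
    unfolding class_P4_def
  proof (intro conjI allI)
    have v: "vertical B4 x y x0 = B4 x y" for x y
      by (simp add: vertical_def e_x0 B4_def B2_0 B_last)
    show "vertical B4 x y z = vertical B4 x y x0 * e z - vertical B4 x z x0 * e y" for x y z
      unfolding v by (rule vertical_def)
    show "vertical B4 x y x0 = vertical B4 y x x0" for x y
      unfolding v B4_def B2_def h_horizontal_def
      by (simp only: B_sym[of x y] h_sym[of x y] mult.commute[of "e x"])
    show "vertical B4 x y x0 = vertical B4 (f x) (f y) x0" for x y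
      unfolding v B4_def B2_def using B_inv[of x y] by (simp add: h_horizontal_def e_f h_f_f)
    have "metric_trace h B4 = 0"
      unfolding B4_def[abs_def] metric_trace_diff trB2 by simp
    then show "theta h (vertical B4) z = 0" for z
      by (subst theta_vertical[OF bilB4]) (simp_all add: B4_def B_first B2_0)
  qed
  have FV: "F_type f x0 e (vertical B)" by (rule F_type_vertical[OF bilB B_last])
  define H where "H x y z = 1 * S x y z + (- 1) * vertical B x y z" for x y z
  have FH: "F_type f x0 e H" unfolding H_def[abs_def] by (rule F_type_lincomb[OF F FV])
  have ceH: "class_equation f H"
    unfolding class_equation_def
  proof (intro allI)
    fix x y z
    have "S (f x) y z + S (f y) x z + S x y (f z) + S y x (f z) = 0"
      using ce unfolding class_equation_def by blast
    moreover have "vertical B (f x) y z + vertical B (f y) x z + vertical B x y (f z) + vertical B y x (f z) = 0"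
      using class_equation_vertical[OF bilB B_sym B_inv] unfolding class_equation_def by blast
    ultimately show "H (f x) y z + H (f y) x z + H x y (f z) + H y x (f z) = 0"
      unfolding H_def by linarith
  qed
  have H_first: "H x0 y z = 0" for y z by (simp add: H_def first vertical_def B_first)
  have H_last: "H x y x0 = 0" for x y by (simp add: H_def vertical_def B_last e_x0) (simp add: B_def)
  obtain S9 S10 S11 where dec: "F_type f x0 e S9" "F_type f x0 e S10" "F_type f x0 e S11"
    "class_P9 n f h S9" "class_P10 f x0 h S10" "class_P11 x0 S11"
    "\<And>x y z. H x y z = S9 x y z + S10 x y z + S11 x y z"
    by (rule horizontal_decomposition[OF dim FH ceH H_first H_last]) (rule that)
  have F2: "F_type f x0 e (vertical B2)" by (rule F_type_vertical[OF bilB2 B2_0(1)])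
  have F4: "F_type f x0 e (vertical B4)"
    by (rule F_type_vertical[OF bilB4]) (simp add: B4_def B_last B2_0)
  have sum: "S x y z = vertical B2 x y z + vertical B4 x y z + S9 x y z + S10 x y z + S11 x y z" for x y z
  proof -
    have "vertical B x y z = vertical B2 x y z + vertical B4 x y z"
      by (simp add: vertical_def B4_def algebra_simps)
    then show ?thesis using dec(7)[of x y z] unfolding H_def by linarith
  qed
  show ?thesis
    by (rule that[OF _ P2 P4 dec(4-6) sum]) (use F2 F4 dec(1-3) in simp)
qed

end

section \<open>Almost contact metric manifolds\<close>

locale contact_manifold = manifold A
  for A :: "('m::t2_space, 'e::euclidean_space) chart set" +
  fixes \<phi> :: "'m \<Rightarrow> 'e \<Rightarrow> 'e" and \<xi> :: "'m \<Rightarrow> 'e" and \<eta> :: "'m \<Rightarrow> 'e \<Rightarrow> real"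
    and g :: "'m \<Rightarrow> 'e \<Rightarrow> 'e \<Rightarrow> real" and D :: "('m, 'e) connection"
  assumes acm: "almost_contact_metric A \<phi> \<xi> \<eta> g"
    and lc: "levi_civita A g D"
begin

lemma ap1_apply: "ap1 T X p = T p (X p)"
  by (simp add: ap1_def)

abbreviation vf :: "('m \<Rightarrow> 'e) \<Rightarrow> bool" where "vf \<equiv> vector_field A"

lemma metric: "pseudo_riemannian_metric A g"
  and endo: "endo_field A \<phi>" and form: "one_form A \<eta>" and vf_\<xi>: "vf \<xi>"
  using acm unfolding almost_contact_metric_def by blast+

lemma contact_space: "contact_space (g p) (\<phi> p) (\<xi> p) (\<eta> p)"
proof (intro contact_space.intro scalar_product.intro contact_space_axioms.intro)
  show "bilinear (g p)" using metric unfolding pseudo_riemannian_metric_def by blast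
  show "g p v w = g p w v" for v w using metric unfolding pseudo_riemannian_metric_def by blast
  have "\<forall>v. (\<forall>w. g p v w = 0) \<longrightarrow> v = 0" using metric unfolding pseudo_riemannian_metric_def by blast
  then show "\<And>v. (\<And>w. g p v w = 0) \<Longrightarrow> v = 0" by blast
  show "linear (\<phi> p)" using endo unfolding endo_field_def by blast
  show "linear (\<eta> p)" using form unfolding one_form_def by blast
  have "\<phi> p (\<phi> p v) = - v + \<eta> p v *\<^sub>R \<xi> p" for v
    using acm unfolding almost_contact_metric_def by blast
  then show "\<phi> p (\<phi> p v) = \<eta> p v *\<^sub>R \<xi> p - v" for v by simp
  show "\<phi> p (\<xi> p) = 0" "\<eta> p (\<phi> p v) = 0" "\<eta> p (\<xi> p) = 1"
    "g p (\<phi> p v) (\<phi> p w) = g p v w + \<eta> p v * \<eta> p w" "\<eta> p v = - g p (\<xi> p) v" for v w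
    using acm unfolding almost_contact_metric_def by blast+
qed

sublocale pt: contact_space "g p" "\<phi> p" "\<xi> p" "\<eta> p" for p
  by (rule contact_space)

lemma vf_\<phi>: "vf X \<Longrightarrow> vf (ap1 \<phi> X)"
  using endo unfolding endo_field_def by blast

lemma smooth_\<eta>: "vf X \<Longrightarrow> smooth_fun A (ap1 \<eta> X)"
  using form unfolding one_form_def by blast

lemma smooth_g: "vf X \<Longrightarrow> vf Y \<Longrightarrow> smooth_fun A (ap2 g X Y)"
  using metric unfolding pseudo_riemannian_metric_def by blast

lemma D_connection: "affine_connection A D"
  and D_metric: "parallel_metric A D g"
  and D_torsion: "vf X \<Longrightarrow> vf Y \<Longrightarrow> torsion A D X Y = (\<lambda>p. 0)"
  using lc unfolding levi_civita_def by blast+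

subsection \<open>Affine connections\<close>

context
  fixes D' assumes D': "affine_connection A D'"
begin

lemma conn_vf: "vf X \<Longrightarrow> vf Y \<Longrightarrow> vf (D' X Y)"
  and conn_add_left: "vf X \<Longrightarrow> vf X' \<Longrightarrow> vf Y \<Longrightarrow> D' (\<lambda>p. X p + X' p) Y = (\<lambda>p. D' X Y p + D' X' Y p)"
  and conn_scale_left: "smooth_fun A k \<Longrightarrow> vf X \<Longrightarrow> vf Y \<Longrightarrow> D' (\<lambda>p. k p *\<^sub>R X p) Y = (\<lambda>p. k p *\<^sub>R D' X Y p)"
  and conn_add_right: "vf X \<Longrightarrow> vf Y \<Longrightarrow> vf Y' \<Longrightarrow> D' X (\<lambda>p. Y p + Y' p) = (\<lambda>p. D' X Y p + D' X Y' p)"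
  and conn_leibniz: "smooth_fun A k \<Longrightarrow> vf X \<Longrightarrow> vf Y \<Longrightarrow>
    D' X (\<lambda>p. k p *\<^sub>R Y p) = (\<lambda>p. vf_deriv A X k p *\<^sub>R Y p + k p *\<^sub>R D' X Y p)"
  using D' unfolding affine_connection_def by blast+

lemma conn_minus_right:
  assumes "vf X" "vf Y"
  shows "D' X (\<lambda>p. - Y p) = (\<lambda>p. - D' X Y p)"
  using conn_leibniz[OF smooth_fun_const[of "-1"] assms] by (simp add: vf_deriv_const)

lemma conn_zero_right:
  assumes "vf X"
  shows "D' X (\<lambda>p. 0) = (\<lambda>p. 0)"
  using conn_leibniz[OF smooth_fun_const[of 0] assms assms] by (simp add: vf_deriv_const)

lemma conn_metric:
  assumes "parallel_metric A D' g" "vf X" "vf Y" "vf Z"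
  shows "vf_deriv A X (ap2 g Y Z) p = g p (D' X Y p) (Z p) + g p (Y p) (D' X Z p)"
proof -
  have "cov_metric A D' g X Y Z p = 0" using assms unfolding parallel_metric_def by simp
  then show ?thesis by (simp add: cov_metric_def)
qed

end

lemmas D_vf = conn_vf[OF D_connection]

lemma lie_bracket_eq: "vf X \<Longrightarrow> vf Y \<Longrightarrow> lie_bracket A X Y p = D X Y p - D Y X p"
  using fun_cong[OF D_torsion, of X Y p] by (simp add: torsion_def)

text \<open>\<open>g(\<xi>,\<xi>)\<close> is constant.\<close>

lemma D_\<xi>_orthogonal:
  assumes "vf X"
  shows "g p (\<xi> p) (D X \<xi> p) = 0"
proof -
  have c: "ap2 g \<xi> \<xi> = (\<lambda>p. -1)" by (simp add: ap2_def pt.h_x0 pt.e_x0)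
  have "g p (D X \<xi> p) (\<xi> p) + g p (\<xi> p) (D X \<xi> p) = vf_deriv A X (ap2 g \<xi> \<xi>) p"
    by (rule conn_metric[OF D_connection D_metric assms vf_\<xi> vf_\<xi>, symmetric])
  also have "\<dots> = 0" unfolding c by (rule vf_deriv_const)
  finally show ?thesis by (simp only: pt.h_sym[of p "D X \<xi> p"])
qed

lemma cov_form_eq:
  assumes "vf X" "vf Y"
  shows "cov_form A D \<eta> X Y p = - g p (D X \<xi> p) (Y p)"
proof -
  have "ap1 \<eta> Y = (\<lambda>p. - ap2 g \<xi> Y p)" by (simp add: ap1_def ap2_def pt.h_x0)
  then have "vf_deriv A X (ap1 \<eta> Y) p = - (g p (D X \<xi> p) (Y p) + g p (\<xi> p) (D X Y p))"
    by (simp only: vf_deriv_minus[OF smooth_g[OF vf_\<xi> assms(2)]]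
        conn_metric[OF D_connection D_metric assms(1) vf_\<xi> assms(2)])
  then show ?thesis by (simp add: cov_form_def pt.h_x0)
qed

subsection \<open>The tensor \<open>F\<close>\<close>

abbreviation "F \<equiv> fund_F D \<phi> g"

lemma F_eq: "F X Y Z p = g p (D X (ap1 \<phi> Y) p) (Z p) - g p (\<phi> p (D X Y p)) (Z p)"
  by (simp add: fund_F_def cov_endo_def pt.h_simps)

lemma function_linear_F:
  "vf Y \<Longrightarrow> vf Z \<Longrightarrow> function_linear A (\<lambda>X. F X Y Z)"
  "vf X \<Longrightarrow> vf Z \<Longrightarrow> function_linear A (\<lambda>Y. F X Y Z)"
  "vf X \<Longrightarrow> vf Y \<Longrightarrow> function_linear A (\<lambda>Z. F X Y Z)"
proof -
  show "function_linear A (\<lambda>X. F X Y Z)" if "vf Y" "vf Z"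
    unfolding function_linear_def F_eq[abs_def]
    using that
    by (simp add: conn_add_left[OF D_connection] conn_scale_left[OF D_connection] vf_\<phi>
        pt.h_simps pt.f_simps algebra_simps)
  show "function_linear A (\<lambda>Z. F X Y Z)" if "vf X" "vf Y"
    unfolding function_linear_def F_eq[abs_def] by (simp add: pt.h_simps algebra_simps)
  show "function_linear A (\<lambda>Y. F X Y Z)" if "vf X" "vf Z"
    unfolding function_linear_def
  proof (intro conjI allI impI)
    fix Y Y' assume Y: "vf Y" "vf Y'"
    have a: "ap1 \<phi> (\<lambda>p. Y p + Y' p) = (\<lambda>p. ap1 \<phi> Y p + ap1 \<phi> Y' p)"
      by (simp add: ap1_def pt.f_simps)
    show "F X (\<lambda>p. Y p + Y' p) Z = (\<lambda>p. F X Y Z p + F X Y' Z p)"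
      unfolding F_eq[abs_def] a
      by (simp add: conn_add_right[OF D_connection \<open>vf X\<close>] Y vf_\<phi> pt.h_simps pt.f_simps algebra_simps)
  next
    fix k Y assume k: "smooth_fun A k" and Y: "vf Y"
    have a: "ap1 \<phi> (\<lambda>p. k p *\<^sub>R Y p) = (\<lambda>p. k p *\<^sub>R ap1 \<phi> Y p)"
      by (simp add: ap1_def pt.f_simps)
    show "F X (\<lambda>p. k p *\<^sub>R Y p) Z = (\<lambda>p. k p * F X Y Z p)"
      unfolding F_eq[abs_def] a
      by (simp add: conn_leibniz[OF D_connection k \<open>vf X\<close>] Y vf_\<phi> pt.h_simps pt.f_simps algebra_simps)
        (simp add: ap1_apply)
  qed
qed

text \<open>Differentiate \<open>g(Y, \<phi> Z) = - g(\<phi> Y, Z)\<close>.\<close>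

lemma F_skew_vf:
  assumes X: "vf X" and Y: "vf Y" and Z: "vf Z"
  shows "F X Y Z p = - F X Z Y p"
proof -
  have e: "ap2 g Y (ap1 \<phi> Z) = (\<lambda>p. - ap2 g (ap1 \<phi> Y) Z p)"
    by (simp add: ap1_def ap2_def pt.h_f_left)
  have "vf_deriv A X (ap2 g Y (ap1 \<phi> Z)) p = - vf_deriv A X (ap2 g (ap1 \<phi> Y) Z) p"
    unfolding e by (rule vf_deriv_minus[OF smooth_g[OF vf_\<phi>[OF Y] Z]])
  then have 1: "g p (D X Y p) (ap1 \<phi> Z p) + g p (Y p) (D X (ap1 \<phi> Z) p)
      = - (g p (D X (ap1 \<phi> Y) p) (Z p) + g p (ap1 \<phi> Y p) (D X Z p))"
    by (simp only: conn_metric[OF D_connection D_metric] X Y Z vf_\<phi>)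
  have "g p (\<phi> p (D X Y p)) (Z p) = - g p (D X Y p) (ap1 \<phi> Z p)"
    by (simp add: ap1_apply pt.h_f_left)
  moreover have "g p (\<phi> p (D X Z p)) (Y p) = - g p (ap1 \<phi> Y p) (D X Z p)"
    by (simp add: ap1_apply pt.h_f_left) (simp add: pt.h_sym[of p "D X Z p"] pt.h_f_left)
  ultimately show ?thesis
    unfolding F_eq using 1 pt.h_sym[of p "Y p" "D X (ap1 \<phi> Z) p"] by linarith
qed

text \<open>Differentiate \<open>\<phi> \<xi> = 0\<close>.\<close>

lemma F_\<phi>_\<xi>:
  assumes X: "vf X" and Y: "vf Y"
  shows "F X (ap1 \<phi> Y) \<xi> p = g p (D X \<xi> p) (Y p)"
proof -
  have "ap1 \<phi> \<xi> = (\<lambda>p. 0)" by (simp add: ap1_def pt.f_x0)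
  then have "D X (ap1 \<phi> \<xi>) = (\<lambda>p. 0)" using conn_zero_right[OF D_connection X] by simp
  then have "F X \<xi> (ap1 \<phi> Y) p = - g p (\<phi> p (D X \<xi> p)) (\<phi> p (Y p))"
    by (simp add: F_eq pt.h_simps ap1_apply)
  also have "\<dots> = - g p (D X \<xi> p) (Y p)"
    using D_\<xi>_orthogonal[OF X, of p] by (simp add: pt.h_f_f pt.h_x0)
  finally show ?thesis using F_skew_vf[OF X vf_\<phi>[OF Y] vf_\<xi>, of p] by simp
qed

text \<open>Differentiate \<open>\<phi>\<^sup>2 = - I + \<eta> \<otimes> \<xi>\<close>.\<close>

lemma F_\<phi>_middle:
  assumes X: "vf X" and Y: "vf Y" and Z: "vf Z"
  shows "F X (ap1 \<phi> Y) Z p = F X Y (ap1 \<phi> Z) p + g p (D X \<xi> p) (Y p) * \<eta> p (Z p)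
    + \<eta> p (Y p) * g p (D X \<xi> p) (Z p)"
proof -
  have e: "ap1 \<phi> (ap1 \<phi> Y) = (\<lambda>p. - Y p + ap1 \<eta> Y p *\<^sub>R \<xi> p)"
    by (simp add: ap1_def pt.f_f)
  have D: "D X (ap1 \<phi> (ap1 \<phi> Y)) p =
      - D X Y p + (vf_deriv A X (ap1 \<eta> Y) p *\<^sub>R \<xi> p + ap1 \<eta> Y p *\<^sub>R D X \<xi> p)"
    unfolding e
    by (simp only: conn_add_right[OF D_connection X vector_field_minus[OF Y]
          vector_field_scaleR[OF smooth_\<eta>[OF Y] vf_\<xi>]]
        conn_minus_right[OF D_connection X Y] conn_leibniz[OF D_connection smooth_\<eta>[OF Y] X vf_\<xi>])
  have d: "vf_deriv A X (ap1 \<eta> Y) p = \<eta> p (D X Y p) - g p (D X \<xi> p) (Y p)"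
    using cov_form_eq[OF X Y, of p] by (simp add: cov_form_def)
  show ?thesis
    unfolding F_eq D d
    by (simp add: ap1_apply pt.h_simps pt.h_x0 pt.h_f_left pt.f_f algebra_simps)
qed

text \<open>The value of \<open>F\<close> at \<open>p\<close>. The choice exists by tensoriality, and it is unique because every tangent vector is the
  value of a global field.\<close>

definition Fp :: "'m \<Rightarrow> 'e \<Rightarrow> 'e \<Rightarrow> 'e \<Rightarrow> real" where
  "Fp p = (SOME S. trilinear S \<and>
     (\<forall>X Y Z. vf X \<longrightarrow> vf Y \<longrightarrow> vf Z \<longrightarrow> F X Y Z p = S (X p) (Y p) (Z p)))"

lemma trilinear_Fp: "trilinear (Fp p)"
  and F_Fp: "vf X \<Longrightarrow> vf Y \<Longrightarrow> vf Z \<Longrightarrow> F X Y Z p = Fp p (X p) (Y p) (Z p)"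
proof -
  have "\<exists>S. trilinear S \<and> (\<forall>X Y Z. vf X \<longrightarrow> vf Y \<longrightarrow> vf Z \<longrightarrow> F X Y Z p = S (X p) (Y p) (Z p))"
    by (rule trilinear_form_at_point[OF function_linear_F, of p]) blast+
  then have "trilinear (Fp p) \<and>
      (\<forall>X Y Z. vf X \<longrightarrow> vf Y \<longrightarrow> vf Z \<longrightarrow> F X Y Z p = Fp p (X p) (Y p) (Z p))"
    unfolding Fp_def by (rule someI_ex)
  then show "trilinear (Fp p)"
    "vf X \<Longrightarrow> vf Y \<Longrightarrow> vf Z \<Longrightarrow> F X Y Z p = Fp p (X p) (Y p) (Z p)" by blast+
qed

lemma Kp: "vf X \<Longrightarrow> vf Y \<Longrightarrow> pt.K p (Fp p) (X p) (Y p) = g p (D X \<xi> p) (Y p)"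
  using F_\<phi>_\<xi>[of X Y p] F_Fp[of X "ap1 \<phi> Y" \<xi> p] vf_\<phi> vf_\<xi> by (simp add: pt.K_def ap1_apply)

lemma F_type_Fp: "F_type (\<phi> p) (\<xi> p) (\<eta> p) (Fp p)"
proof -
  have skew: "Fp p x y z = - Fp p x z y" for x y z
  proof -
    obtain X where X: "vf X" "X p = x" by (rule exists_vector_field_through)
    obtain Y where Y: "vf Y" "Y p = y" by (rule exists_vector_field_through)
    obtain Z where Z: "vf Z" "Z p = z" by (rule exists_vector_field_through)
    show ?thesis using F_skew_vf[OF X(1) Y(1) Z(1), of p] by (simp add: F_Fp X Y Z)
  qed
  have mid: "Fp p x (\<phi> p y) z = Fp p x y (\<phi> p z) + Fp p x (\<phi> p y) (\<xi> p) * \<eta> p z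
      + \<eta> p y * Fp p x (\<phi> p z) (\<xi> p)" for x y z
  proof -
    obtain X where X: "vf X" "X p = x" by (rule exists_vector_field_through)
    obtain Y where Y: "vf Y" "Y p = y" by (rule exists_vector_field_through)
    obtain Z where Z: "vf Z" "Z p = z" by (rule exists_vector_field_through)
    show ?thesis
      using F_\<phi>_middle[OF X(1) Y(1) Z(1), of p]
        Kp[OF X(1) Y(1), of p] Kp[OF X(1) Z(1), of p]
      by (simp add: F_Fp X Y Z vf_\<phi> ap1_apply pt.K_def)
  qed
  note s = trilinear_add[OF trilinear_Fp] trilinear_scale[OF trilinear_Fp] trilinear_diff[OF trilinear_Fp]
  have "Fp p x y z = - Fp p x (\<phi> p y) (\<phi> p z) + Fp p x (\<xi> p) z * \<eta> p y + Fp p x y (\<xi> p) * \<eta> p z" for x y z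
  proof -
    have "Fp p x (\<xi> p) (\<xi> p) = 0" using skew[of x "\<xi> p" "\<xi> p"] by linarith
    then show ?thesis
      using mid[of x y "\<phi> p z"] skew[of x z "\<xi> p"]
      by (simp add: pt.f_f pt.e_f s algebra_simps)
  qed
  then show ?thesis using skew trilinear_Fp unfolding F_type_def by blast
qed

text \<open>Identities between fields hold iff the corresponding pointwise identities do, because every tangent
  vector is a value of a global field.\<close>

lemma F_equation_iff: "F_equation A D \<phi> g \<longleftrightarrow> (\<forall>p. class_equation (\<phi> p) (Fp p))"
proof
  assume E: "F_equation A D \<phi> g"
  show "\<forall>p. class_equation (\<phi> p) (Fp p)"
    unfolding class_equation_def
  proof (intro allI)
    fix p x y z
    obtain X where X: "vf X" "X p = x" by (rule exists_vector_field_through)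
    obtain Y where Y: "vf Y" "Y p = y" by (rule exists_vector_field_through)
    obtain Z where Z: "vf Z" "Z p = z" by (rule exists_vector_field_through)
    have "F (ap1 \<phi> X) Y Z p + F (ap1 \<phi> Y) X Z p + F X Y (ap1 \<phi> Z) p + F Y X (ap1 \<phi> Z) p = 0"
      using E X(1) Y(1) Z(1) unfolding F_equation_def by blast
    then show "Fp p (\<phi> p x) y z + Fp p (\<phi> p y) x z + Fp p x y (\<phi> p z) + Fp p y x (\<phi> p z) = 0"
      by (simp add: F_Fp X Y Z vf_\<phi> ap1_apply)
  qed
next
  assume "\<forall>p. class_equation (\<phi> p) (Fp p)"
  then show "F_equation A D \<phi> g"
    unfolding class_equation_def F_equation_def by (simp add: F_Fp vf_\<phi> ap1_apply)
qed

text \<open>Since \<open>\<nabla>\<close> is metric and torsion-free, \<open>L\<^sub>\<xi> g\<close> is twice the symmetric part of \<open>\<nabla> \<xi>\<close>.\<close>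

lemma killing_iff: "killing A g \<xi> \<longleftrightarrow> (\<forall>p x y. pt.K p (Fp p) x y + pt.K p (Fp p) y x = 0)"
proof -
  have L: "lie_deriv_metric A \<xi> g X Y p = pt.K p (Fp p) (X p) (Y p) + pt.K p (Fp p) (Y p) (X p)"
    if "vf X" "vf Y" for X Y p
    using conn_metric[OF D_connection D_metric vf_\<xi> that, of p] pt.h_sym[of p "X p" "D Y \<xi> p"]
    by (simp add: lie_deriv_metric_def lie_bracket_eq that vf_\<xi> pt.h_simps Kp)
  show ?thesis
  proof
    assume k: "killing A g \<xi>"
    show "\<forall>p x y. pt.K p (Fp p) x y + pt.K p (Fp p) y x = 0"
    proof (intro allI)
      fix p x y
      obtain X where X: "vf X" "X p = x" by (rule exists_vector_field_through)
      obtain Y where Y: "vf Y" "Y p = y" by (rule exists_vector_field_through)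
      have "lie_deriv_metric A \<xi> g X Y = (\<lambda>p. 0)" using k X(1) Y(1) unfolding killing_def by blast
      then show "pt.K p (Fp p) x y + pt.K p (Fp p) y x = 0"
        using L[OF X(1) Y(1), of p] by (simp add: X Y)
    qed
  next
    assume "\<forall>p x y. pt.K p (Fp p) x y + pt.K p (Fp p) y x = 0"
    then show "killing A g \<xi>" unfolding killing_def using vf_\<xi> by (simp add: L fun_eq_iff)
  qed
qed

lemma class_equation_imp_killing:
  assumes "\<forall>p. class_equation (\<phi> p) (Fp p)"
  shows "killing A g \<xi>"
  unfolding killing_iff
proof (intro allI)
  show "pt.K p (Fp p) x y + pt.K p (Fp p) y x = 0" for p x y
    using pt.class_equation_K_skew[OF F_type_Fp assms[rule_format], of p x y] by linarith
qed

subsection \<open>The Nijenhuis tensors\<close>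

text \<open>In \<open>{\<phi>,\<phi>}\<close> all terms cancel in which \<open>\<nabla>\<close> differentiates \<open>X\<close> or \<open>Y\<close> and not \<open>\<phi>\<close>; what is left is the left-hand side
  of the class equation.\<close>

lemma g_sym_phi_phi:
  assumes X: "vf X" and Y: "vf Y"
  shows "g p (sym_phi_phi D \<phi> X Y p) z = Fp p (\<phi> p (X p)) (Y p) z + Fp p (\<phi> p (Y p)) (X p) z
    + Fp p (X p) (Y p) (\<phi> p z) + Fp p (Y p) (X p) (\<phi> p z)"
proof -
  obtain Z where Z: "vf Z" "Z p = z" by (rule exists_vector_field_through)
  have "F (ap1 \<phi> X) Y Z p + F (ap1 \<phi> Y) X Z p + F X Y (ap1 \<phi> Z) p + F Y X (ap1 \<phi> Z) p
      = g p (sym_phi_phi D \<phi> X Y p) (Z p)"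
    unfolding F_eq sym_phi_phi_def sym_bracket_def ap1_apply[of \<phi> Z]
    by (simp add: pt.h_simps pt.f_simps pt.h_f_left)
  then show ?thesis by (simp add: F_Fp X Y Z vf_\<phi> ap1_apply)
qed

lemma sym_phi_phi_iff:
  "(\<forall>X Y. vf X \<longrightarrow> vf Y \<longrightarrow> sym_phi_phi D \<phi> X Y = (\<lambda>p. 0)) \<longleftrightarrow> (\<forall>p. class_equation (\<phi> p) (Fp p))"
proof
  assume 0: "\<forall>X Y. vf X \<longrightarrow> vf Y \<longrightarrow> sym_phi_phi D \<phi> X Y = (\<lambda>p. 0)"
  show "\<forall>p. class_equation (\<phi> p) (Fp p)"
    unfolding class_equation_def
  proof (intro allI)
    fix p x y z
    obtain X where X: "vf X" "X p = x" by (rule exists_vector_field_through)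
    obtain Y where Y: "vf Y" "Y p = y" by (rule exists_vector_field_through)
    have "sym_phi_phi D \<phi> X Y = (\<lambda>p. 0)" using 0 X(1) Y(1) by blast
    then show "Fp p (\<phi> p x) y z + Fp p (\<phi> p y) x z + Fp p x y (\<phi> p z) + Fp p y x (\<phi> p z) = 0"
      using g_sym_phi_phi[OF X(1) Y(1), of p z] by (simp add: X Y pt.h_simps)
  qed
next
  assume ce: "\<forall>p. class_equation (\<phi> p) (Fp p)"
  show "\<forall>X Y. vf X \<longrightarrow> vf Y \<longrightarrow> sym_phi_phi D \<phi> X Y = (\<lambda>p. 0)"
  proof (intro allI impI ext)
    fix X Y p assume XY: "vf X" "vf Y"
    show "sym_phi_phi D \<phi> X Y p = 0"
    proof (rule pt.h_nondeg[of p])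
      show "g p (sym_phi_phi D \<phi> X Y p) w = 0" for w
        unfolding g_sym_phi_phi[OF XY] using ce unfolding class_equation_def by blast
    qed
  qed
qed

lemma nijenhuis3_eq:
  assumes X: "vf X" and Y: "vf Y" and Z: "vf Z"
  shows "nijenhuis3 A D \<phi> \<xi> \<eta> g X Y Z p = pt.Nij p (Fp p) (X p) (Y p) (Z p)"
proof -
  have "g p (phi_phi A \<phi> X Y p) (Z p) =
      F (ap1 \<phi> X) Y Z p - F (ap1 \<phi> Y) X Z p + F X Y (ap1 \<phi> Z) p - F Y X (ap1 \<phi> Z) p"
    unfolding F_eq phi_phi_def ap1_apply[of \<phi> Z]
    by (simp add: lie_bracket_eq X Y vf_\<phi> pt.h_simps pt.f_simps pt.h_f_left)
  then have 1: "g p (phi_phi A \<phi> X Y p) (Z p) = Fp p (\<phi> p (X p)) (Y p) (Z p)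
      - Fp p (\<phi> p (Y p)) (X p) (Z p) + Fp p (X p) (Y p) (\<phi> p (Z p)) - Fp p (Y p) (X p) (\<phi> p (Z p))"
    by (simp add: F_Fp X Y Z vf_\<phi> ap1_apply)
  have 2: "d_form A D \<eta> X Y p = pt.K p (Fp p) (Y p) (X p) - pt.K p (Fp p) (X p) (Y p)"
    by (simp add: d_form_def cov_form_eq X Y Kp)
  have "nijenhuis3 A D \<phi> \<xi> \<eta> g X Y Z p
      = g p (phi_phi A \<phi> X Y p) (Z p) - d_form A D \<eta> X Y p * \<eta> p (Z p)"
    by (simp add: nijenhuis3_def nijenhuis_def pt.h_simps pt.h_x0)
  then show ?thesis
    unfolding 1 2 pt.Nij_def[OF F_type_Fp] by (simp add: algebra_simps)
qed

lemma nijenhuis_3form_iff: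
  "is_3form A (nijenhuis3 A D \<phi> \<xi> \<eta> g) \<longleftrightarrow>
    (\<forall>p x y z. pt.Nij p (Fp p) x y z = - pt.Nij p (Fp p) y x z \<and>
      pt.Nij p (Fp p) x y z = - pt.Nij p (Fp p) x z y)"
proof
  assume *: "is_3form A (nijenhuis3 A D \<phi> \<xi> \<eta> g)"
  show "\<forall>p x y z. pt.Nij p (Fp p) x y z = - pt.Nij p (Fp p) y x z \<and>
      pt.Nij p (Fp p) x y z = - pt.Nij p (Fp p) x z y"
  proof (intro allI)
    fix p x y z
    obtain X where X: "vf X" "X p = x" by (rule exists_vector_field_through)
    obtain Y where Y: "vf Y" "Y p = y" by (rule exists_vector_field_through)
    obtain Z where Z: "vf Z" "Z p = z" by (rule exists_vector_field_through)
    have "nijenhuis3 A D \<phi> \<xi> \<eta> g X Y Z p = - nijenhuis3 A D \<phi> \<xi> \<eta> g Y X Z p \<and>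
        nijenhuis3 A D \<phi> \<xi> \<eta> g X Y Z p = - nijenhuis3 A D \<phi> \<xi> \<eta> g X Z Y p"
      using * X(1) Y(1) Z(1) unfolding is_3form_def by blast
    then show "pt.Nij p (Fp p) x y z = - pt.Nij p (Fp p) y x z \<and>
        pt.Nij p (Fp p) x y z = - pt.Nij p (Fp p) x z y"
      unfolding nijenhuis3_eq[OF X(1) Y(1) Z(1)] nijenhuis3_eq[OF Y(1) X(1) Z(1)]
        nijenhuis3_eq[OF X(1) Z(1) Y(1)] X(2) Y(2) Z(2) .
  qed
next
  assume *: "\<forall>p x y z. pt.Nij p (Fp p) x y z = - pt.Nij p (Fp p) y x z \<and>
      pt.Nij p (Fp p) x y z = - pt.Nij p (Fp p) x z y"
  show "is_3form A (nijenhuis3 A D \<phi> \<xi> \<eta> g)"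
    unfolding is_3form_def
  proof (intro allI impI)
    fix X Y Z p assume X: "vf X" and Y: "vf Y" and Z: "vf Z"
    show "nijenhuis3 A D \<phi> \<xi> \<eta> g X Y Z p = - nijenhuis3 A D \<phi> \<xi> \<eta> g Y X Z p \<and>
        nijenhuis3 A D \<phi> \<xi> \<eta> g X Y Z p = - nijenhuis3 A D \<phi> \<xi> \<eta> g X Z Y p"
      unfolding nijenhuis3_eq[OF X Y Z] nijenhuis3_eq[OF Y X Z] nijenhuis3_eq[OF X Z Y]
      by (rule *[rule_format])
  qed
qed

end

context contact_manifold
begin

subsection \<open>The classification\<close>

lemma F_\<xi>_iff:
  "(\<forall>Y Z. vf Y \<longrightarrow> vf Z \<longrightarrow> F \<xi> Y Z = (\<lambda>p. 0)) \<longleftrightarrow> (\<forall>p y z. Fp p (\<xi> p) y z = 0)"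
proof
  assume 0: "\<forall>Y Z. vf Y \<longrightarrow> vf Z \<longrightarrow> F \<xi> Y Z = (\<lambda>p. 0)"
  show "\<forall>p y z. Fp p (\<xi> p) y z = 0"
  proof (intro allI)
    fix p y z
    obtain Y where Y: "vf Y" "Y p = y" by (rule exists_vector_field_through)
    obtain Z where Z: "vf Z" "Z p = z" by (rule exists_vector_field_through)
    have "F \<xi> Y Z = (\<lambda>p. 0)" using 0 Y(1) Z(1) by blast
    then show "Fp p (\<xi> p) y z = 0" using F_Fp[OF vf_\<xi> Y(1) Z(1), of p] by (simp add: Y Z)
  qed
next
  assume "\<forall>p y z. Fp p (\<xi> p) y z = 0"
  then show "\<forall>Y Z. vf Y \<longrightarrow> vf Z \<longrightarrow> F \<xi> Y Z = (\<lambda>p. 0)"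
    by (simp add: fun_eq_iff F_Fp vf_\<xi>)
qed

lemma in_class_iff:
  assumes dim: "DIM('e) = 4 * n + 3"
  shows "in_class_P2_P4_P9_P10_P11 n A D \<phi> \<xi> \<eta> g \<longleftrightarrow>
    (\<forall>p. class_equation (\<phi> p) (Fp p)) \<and> (\<forall>p y z. Fp p (\<xi> p) y z = 0)"
proof
  assume cl: "in_class_P2_P4_P9_P10_P11 n A D \<phi> \<xi> \<eta> g"
  have "class_equation (\<phi> p) (Fp p) \<and> (\<forall>y z. Fp p (\<xi> p) y z = 0)" for p
  proof -
    obtain S2 S4 S9 S10 S11 where
      Ft: "\<forall>S\<in>{S2, S4, S9, S10, S11}. F_type (\<phi> p) (\<xi> p) (\<eta> p) S"
      and P: "class_P2 n (\<xi> p) (\<eta> p) (g p) S2" "class_P4 (\<phi> p) (\<xi> p) (\<eta> p) (g p) S4"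
        "class_P9 n (\<phi> p) (g p) S9" "class_P10 (\<phi> p) (\<xi> p) (g p) S10" "class_P11 (\<xi> p) S11"
      and sum: "\<forall>X Y Z. vf X \<longrightarrow> vf Y \<longrightarrow> vf Z \<longrightarrow> F X Y Z p =
        S2 (X p) (Y p) (Z p) + S4 (X p) (Y p) (Z p) + S9 (X p) (Y p) (Z p) +
        S10 (X p) (Y p) (Z p) + S11 (X p) (Y p) (Z p)"
      using cl unfolding in_class_P2_P4_P9_P10_P11_def by meson
    have t: "F_type (\<phi> p) (\<xi> p) (\<eta> p) S4" "F_type (\<phi> p) (\<xi> p) (\<eta> p) S9"
      "F_type (\<phi> p) (\<xi> p) (\<eta> p) S10" "F_type (\<phi> p) (\<xi> p) (\<eta> p) S11"
      using Ft by simp_all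
    have eq: "Fp p x y z = S2 x y z + S4 x y z + S9 x y z + S10 x y z + S11 x y z" for x y z
    proof -
      obtain X where X: "vf X" "X p = x" by (rule exists_vector_field_through)
      obtain Y where Y: "vf Y" "Y p = y" by (rule exists_vector_field_through)
      obtain Z where Z: "vf Z" "Z p = z" by (rule exists_vector_field_through)
      show ?thesis using sum[rule_format, OF X(1) Y(1) Z(1)] by (simp add: F_Fp X Y Z)
    qed
    note ce = pt.class_P2_equation(1)[OF P(1)] pt.class_P4_equation(1)[OF P(2) t(1)]
      pt.class_P9_equation(1)[OF P(3) t(2)] pt.class_P10_equation(1)[OF P(4) t(3)]
      pt.class_P11_equation(1)[OF P(5) t(4)]
    have "class_equation (\<phi> p) (Fp p)"
      unfolding class_equation_def
    proof (intro allI)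
      show "Fp p (\<phi> p x) y z + Fp p (\<phi> p y) x z + Fp p x y (\<phi> p z) + Fp p y x (\<phi> p z) = 0" for x y z
        using ce[unfolded class_equation_def, rule_format, of x y z] unfolding eq by linarith
    qed
    moreover have "Fp p (\<xi> p) y z = 0" for y z
      unfolding eq
      by (simp add: pt.class_P2_equation(2)[OF P(1)] pt.class_P4_equation(2)[OF P(2) t(1)]
          pt.class_P9_equation(2)[OF P(3) t(2)] pt.class_P10_equation(2)[OF P(4) t(3)]
          pt.class_P11_equation(2)[OF P(5) t(4)])
    ultimately show ?thesis by blast
  qed
  then show "(\<forall>p. class_equation (\<phi> p) (Fp p)) \<and> (\<forall>p y z. Fp p (\<xi> p) y z = 0)" by blast
next
  assume *: "(\<forall>p. class_equation (\<phi> p) (Fp p)) \<and> (\<forall>p y z. Fp p (\<xi> p) y z = 0)"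
  show "in_class_P2_P4_P9_P10_P11 n A D \<phi> \<xi> \<eta> g"
    unfolding in_class_P2_P4_P9_P10_P11_def
  proof
    fix p
    have ce: "class_equation (\<phi> p) (Fp p)" and first: "\<And>y z. Fp p (\<xi> p) y z = 0" using * by blast+
    obtain S2 S4 S9 S10 S11 where
      dec: "\<forall>S\<in>{S2, S4, S9, S10, S11}. F_type (\<phi> p) (\<xi> p) (\<eta> p) S"
        "class_P2 n (\<xi> p) (\<eta> p) (g p) S2" "class_P4 (\<phi> p) (\<xi> p) (\<eta> p) (g p) S4"
        "class_P9 n (\<phi> p) (g p) S9" "class_P10 (\<phi> p) (\<xi> p) (g p) S10" "class_P11 (\<xi> p) S11"
      and sum: "\<And>x y z. Fp p x y z = S2 x y z + S4 x y z + S9 x y z + S10 x y z + S11 x y z"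
      by (rule pt.five_classes_decomposition[OF dim F_type_Fp ce first]) (rule that)
    show "\<exists>S2 S4 S9 S10 S11.
        (\<forall>S\<in>{S2, S4, S9, S10, S11}. F_type (\<phi> p) (\<xi> p) (\<eta> p) S) \<and>
        class_P2 n (\<xi> p) (\<eta> p) (g p) S2 \<and> class_P4 (\<phi> p) (\<xi> p) (\<eta> p) (g p) S4 \<and>
        class_P9 n (\<phi> p) (g p) S9 \<and> class_P10 (\<phi> p) (\<xi> p) (g p) S10 \<and> class_P11 (\<xi> p) S11 \<and>
        (\<forall>X Y Z. vf X \<longrightarrow> vf Y \<longrightarrow> vf Z \<longrightarrow> F X Y Z p =
          S2 (X p) (Y p) (Z p) + S4 (X p) (Y p) (Z p) + S9 (X p) (Y p) (Z p) +
          S10 (X p) (Y p) (Z p) + S11 (X p) (Y p) (Z p))"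
      by (rule exI[of _ S2], rule exI[of _ S4], rule exI[of _ S9], rule exI[of _ S10], rule exI[of _ S11])
        (intro conjI dec allI impI, simp only: F_Fp sum)
  qed
qed

subsection \<open>Natural connections with totally skew-symmetric torsion\<close>

definition natural_skew :: "('m, 'e) connection \<Rightarrow> bool" where
  "natural_skew D' \<longleftrightarrow> natural_connection A \<phi> \<xi> \<eta> g D' \<and> is_3form A (torsion3 A D' g)"

text \<open>For two metric connections the difference is skew in its last two arguments. If moreover the torsion
  is a \<open>3\<close>-form, the difference from the Levi-Civita connection is invariant under cyclic permutations,
  hence equal to half the torsion.\<close>

lemma contorsion_eq_torsion:
  assumes D': "natural_skew D'" and X: "vf X" and Y: "vf Y" and Z: "vf Z"
  shows "torsion3 A D' g X Y Z p = 2 * g p (D' X Y p) (Z p) - 2 * g p (D X Y p) (Z p)"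
proof -
  let ?a = "\<lambda>X Y Z. g p (D' X Y p) (Z p) - g p (D X Y p) (Z p)"
  have con: "affine_connection A D'" "parallel_metric A D' g"
    using D' unfolding natural_skew_def natural_connection_def by blast+
  have a: "?a X Y Z = - ?a X Z Y" if "vf X" "vf Y" "vf Z" for X Y Z
    using conn_metric[OF con that, of p] conn_metric[OF D_connection D_metric that, of p]
      pt.h_sym[of p "Y p" "D' X Z p"] pt.h_sym[of p "Y p" "D X Z p"] by linarith
  have T: "torsion3 A D' g X Y Z p = ?a X Y Z - ?a Y X Z" if "vf X" "vf Y" "vf Z" for X Y Z
    by (simp add: torsion3_def torsion_def lie_bracket_eq that pt.h_simps)
  have T_skew: "torsion3 A D' g X Y Z p = - torsion3 A D' g X Z Y p" if "vf X" "vf Y" "vf Z" for X Y Z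
    using D' that unfolding natural_skew_def is_3form_def by blast
  have cyc: "?a Z X Y = ?a Y Z X" if "vf X" "vf Y" "vf Z" for X Y Z
    using T_skew[OF that] T[OF that] T[OF that(1,3,2)] a[OF that] a[OF that(2,1,3)] by linarith
  show ?thesis
    using T[OF X Y Z] cyc[OF X Y Z] cyc[OF Y Z X] a[OF Y X Z] by linarith
qed

lemma natural_skew_torsion_skew:
  assumes "natural_skew D'" "vf X" "vf Y" "vf Z"
  shows "torsion3 A D' g X Y Z p = - torsion3 A D' g Y X Z p"
    and "torsion3 A D' g X Y Z p = - torsion3 A D' g X Z Y p"
  using assms unfolding natural_skew_def is_3form_def by blast+

lemma natural_skew_commutes:
  assumes "natural_skew D'" "vf X" "vf Y"
  shows "D' X (ap1 \<phi> Y) p = \<phi> p (D' X Y p)"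
proof -
  have "cov_endo D' \<phi> X Y = (\<lambda>p. 0)"
    using assms unfolding natural_skew_def natural_connection_def by blast
  from fun_cong[OF this, of p] show ?thesis by (simp add: cov_endo_def)
qed

text \<open>The condition \<open>\<nabla>\<^sup>* \<phi> = 0\<close> expresses \<open>F\<close> by the torsion; in the class equation all terms
  in the torsion then cancel in pairs.\<close>

lemma natural_skew_imp_F_equation:
  assumes D': "natural_skew D'"
  shows "F_equation A D \<phi> g"
  unfolding F_equation_def
proof (intro allI impI)
  fix X Y Z p assume X: "vf X" and Y: "vf Y" and Z: "vf Z"
  let ?T = "\<lambda>X Y Z. torsion3 A D' g X Y Z p"
  have par: "2 * F X Y Z p + ?T X (ap1 \<phi> Y) Z + ?T X Y (ap1 \<phi> Z) = 0" if "vf X" "vf Y" "vf Z" for X Y Z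
    using contorsion_eq_torsion[OF D' that(1) vf_\<phi>[OF that(2)] that(3), of p]
      contorsion_eq_torsion[OF D' that(1,2) vf_\<phi>[OF that(3)], of p]
    by (simp add: F_eq natural_skew_commutes[OF D' that(1,2)] ap1_apply pt.h_f_left)
  note sk = natural_skew_torsion_skew(1)[OF D', of _ _ _ p]
  note v = vf_\<phi>[OF X] vf_\<phi>[OF Y] vf_\<phi>[OF Z]
  show "F (ap1 \<phi> X) Y Z p + F (ap1 \<phi> Y) X Z p + F X Y (ap1 \<phi> Z) p + F Y X (ap1 \<phi> Z) p = 0"
    using par[OF v(1) Y Z] par[OF v(2) X Z] par[OF X Y v(3)] par[OF Y X v(3)]
      sk[OF v(1,2) Z] sk[OF v(1) Y v(3)] sk[OF v(2) X v(3)] sk[OF X Y vf_\<phi>[OF v(3)]]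
    by linarith
qed

text \<open>The difference \<open>b\<close> of two such connections is a \<open>3\<close>-form for which \<open>\<phi>\<close> is skew in the last two
  arguments. Moving \<open>\<phi>\<close> around the three slots changes the sign three times, so \<open>b\<close> vanishes as soon as
  \<open>\<phi>\<close> is applied to an argument; and \<open>b(X, Y, \<xi>) = 0\<close> since \<open>\<xi>\<close> is parallel.\<close>

lemma natural_skew_unique:
  assumes D1: "natural_skew D1" and D2: "natural_skew D2" and X: "vf X" and Y: "vf Y"
  shows "D1 X Y = D2 X Y"
proof
  fix p
  let ?b = "\<lambda>X Y Z. g p (D1 X Y p) (Z p) - g p (D2 X Y p) (Z p)"
  have b: "2 * g p (D1 X Y p) (Z p) - 2 * g p (D2 X Y p) (Z p)
      = torsion3 A D1 g X Y Z p - torsion3 A D2 g X Y Z p"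
    if "vf X" "vf Y" "vf Z" for X Y Z
    using contorsion_eq_torsion[OF D1 that, of p] contorsion_eq_torsion[OF D2 that, of p] by linarith
  have b12: "?b X Y Z = - ?b Y X Z" and b23: "?b X Y Z = - ?b X Z Y" if "vf X" "vf Y" "vf Z" for X Y Z
    using b[OF that] b[OF that(2,1,3)] b[OF that(1,3,2)]
      natural_skew_torsion_skew[OF D1 that, of p] natural_skew_torsion_skew[OF D2 that, of p]
    by linarith+
  have b\<phi>: "?b X (ap1 \<phi> Y) Z = - ?b X Y (ap1 \<phi> Z)" if "vf X" "vf Y" for X Y Z
    by (simp add: natural_skew_commutes[OF D1 that] natural_skew_commutes[OF D2 that] ap1_apply pt.h_f_left)
  have 0: "?b X Y (ap1 \<phi> Z) = 0" if "vf X" "vf Y" "vf Z" for X Y Z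
  proof -
    note v = vf_\<phi>[OF that(1)] vf_\<phi>[OF that(2)] vf_\<phi>[OF that(3)]
    show ?thesis
      using b\<phi>[OF that(1,2), of Z] b12[OF v(1) that(2,3)] b\<phi>[OF that(2,1), of Z] b12[OF that(1,2) v(3)]
        b23[OF v(1) that(2,3)] b12[OF v(1) that(3,2)] b\<phi>[OF that(3,1), of Y]
        b12[OF that(3,1) v(2)] b23[OF that(1,3) v(2)]
      by linarith
  qed
  have \<xi>: "?b X Y \<xi> = 0"
  proof -
    have "D1 X \<xi> = (\<lambda>p. 0)" "D2 X \<xi> = (\<lambda>p. 0)"
      using D1 D2 X unfolding natural_skew_def natural_connection_def by blast+
    then show ?thesis using b23[OF X Y vf_\<xi>] by simp
  qed
  show "D1 X Y p = D2 X Y p"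
  proof (rule pt.h_eqI)
    fix z
    obtain Z where Z: "vf Z" "Z p = z" by (rule exists_vector_field_through)
    have "?b X Y (ap1 \<phi> (ap1 \<phi> Z)) = 0" by (rule 0[OF X Y vf_\<phi>[OF Z(1)]])
    then show "g p (D1 X Y p) z = g p (D2 X Y p) z"
      using \<xi> by (simp add: ap1_apply Z(2) pt.f_f pt.h_simps pt.h_x0)
  qed
qed

subsection \<open>Existence\<close>

abbreviation "T1p p \<equiv> pt.T1 p (Fp p)"

text \<open>Half of the form \<open>T\<^sub>1\<close>, as a vector-valued bilinear map.\<close>

definition Q :: "'m \<Rightarrow> 'e \<Rightarrow> 'e \<Rightarrow> 'e" where
  "Q p x y = pt.sharp p (\<lambda>z. 1/2 * T1p p x y z)"

definition D1 :: "('m, 'e) connection" where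
  "D1 X Y p = D X Y p + Q p (X p) (Y p)"

lemma trilinear_T1p: "trilinear (T1p p)"
  by (rule pt.trilinear_T1[OF F_type_Fp])

lemma g_Q: "g p (Q p x y) z = 1/2 * T1p p x y z"
proof -
  have "linear (\<lambda>z. 1/2 * T1p p x y z)"
    by (rule linearI) (simp_all add: trilinear_add[OF trilinear_T1p] trilinear_scale[OF trilinear_T1p])
  then show ?thesis unfolding Q_def by (rule pt.h_sharp)
qed

lemma Q_add_scale:
  "Q p (x + x') y = Q p x y + Q p x' y" "Q p (a *\<^sub>R x) y = a *\<^sub>R Q p x y"
  "Q p x (y + y') = Q p x y + Q p x y'" "Q p x (a *\<^sub>R y) = a *\<^sub>R Q p x y"
  by (rule pt.h_eqI[of p],
      simp add: g_Q pt.h_simps trilinear_add[OF trilinear_T1p] trilinear_scale[OF trilinear_T1p])+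

lemma T1_form_eq:
  assumes X: "vf X" and Y: "vf Y" and Z: "vf Z"
  shows "T1_form D \<phi> \<xi> \<eta> g X Y Z p = T1p p (X p) (Y p) (Z p)"
  unfolding T1_form_def pt.T1_def[OF F_type_Fp] by (simp add: F_Fp X Y Z vf_\<phi> vf_\<xi> ap1_apply)

lemma smooth_F:
  assumes X: "vf X" and Y: "vf Y" and Z: "vf Z"
  shows "smooth_fun A (F X Y Z)"
proof -
  have v: "vf (cov_endo D \<phi> X Y)"
    unfolding cov_endo_def
    using vector_field_diff[OF D_vf[OF X vf_\<phi>[OF Y]] vf_\<phi>[OF D_vf[OF X Y]]] by (simp only: ap1_apply)
  have "F X Y Z = ap2 g (cov_endo D \<phi> X Y) Z" by (simp add: fund_F_def ap2_def)
  then show ?thesis using smooth_g[OF v Z] by simp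
qed

text \<open>The term \<open>F(\<phi> z, x, y)\<close> of \<open>T\<^sub>1\<close> differentiates in the direction \<open>z\<close>, so \<open>Q\<close> is not a composition of \<open>\<nabla>\<close> and
  \<open>\<phi>\<close>; its smoothness is obtained by raising the index of \<open>T\<^sub>1\<close>.\<close>

lemma vector_field_Q:
  assumes X: "vf X" and Y: "vf Y"
  shows "vf (\<lambda>p. Q p (X p) (Y p))"
proof (rule vector_field_of_smooth_pairings[OF metric])
  fix Z assume Z: "vf Z"
  note v = vf_\<phi>[OF X] vf_\<phi>[OF Y] vf_\<phi>[OF Z]
  have "(\<lambda>p. g p (Q p (X p) (Y p)) (Z p)) = (\<lambda>p. 1/2 * (F X Y (ap1 \<phi> Z) p - F Y X (ap1 \<phi> Z) p
      - F (ap1 \<phi> Z) X Y p + 2 * F X (ap1 \<phi> Y) \<xi> p * ap1 \<eta> Z p))"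
    by (simp add: g_Q T1_form_eq[OF X Y Z, symmetric] T1_form_def ap1_apply)
  moreover have "smooth_fun A \<dots>"
    by (intro smooth_fun_mult smooth_fun_add smooth_fun_diff smooth_fun_const smooth_F smooth_\<eta> X Y Z v vf_\<xi>)
  ultimately show "smooth_fun A (\<lambda>p. g p (Q p (X p) (Y p)) (Z p))" by (simp only:)
qed

lemma affine_connection_D1: "affine_connection A D1"
  unfolding affine_connection_def
proof (intro conjI allI impI)
  show "vf (D1 X Y)" if "vf X" "vf Y" for X Y
    unfolding D1_def[abs_def] by (rule vector_field_add[OF D_vf[OF that] vector_field_Q[OF that]])
  show "D1 (\<lambda>p. X p + X' p) Y = (\<lambda>p. D1 X Y p + D1 X' Y p)" if "vf X" "vf X'" "vf Y" for X X' Y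
    by (simp add: fun_eq_iff D1_def conn_add_left[OF D_connection that] Q_add_scale)
  show "D1 (\<lambda>p. k p *\<^sub>R X p) Y = (\<lambda>p. k p *\<^sub>R D1 X Y p)" if "smooth_fun A k" "vf X" "vf Y" for k X Y
    by (simp add: fun_eq_iff D1_def conn_scale_left[OF D_connection that] Q_add_scale scaleR_add_right)
  show "D1 X (\<lambda>p. Y p + Y' p) = (\<lambda>p. D1 X Y p + D1 X Y' p)" if "vf X" "vf Y" "vf Y'" for X Y Y'
    by (simp add: fun_eq_iff D1_def conn_add_right[OF D_connection that] Q_add_scale)
  show "D1 X (\<lambda>p. k p *\<^sub>R Y p) = (\<lambda>p. vf_deriv A X k p *\<^sub>R Y p + k p *\<^sub>R D1 X Y p)"
    if "smooth_fun A k" "vf X" "vf Y" for k X Y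
    by (simp add: fun_eq_iff D1_def conn_leibniz[OF D_connection that] Q_add_scale scaleR_add_right)
qed

lemma torsion3_D1:
  assumes ce: "\<forall>p. class_equation (\<phi> p) (Fp p)" and X: "vf X" and Y: "vf Y" and Z: "vf Z"
  shows "torsion3 A D1 g X Y Z p = T1p p (X p) (Y p) (Z p)"
  using pt.T1_skew12[OF F_type_Fp ce[rule_format], of p "X p" "Y p" "Z p"]
  by (simp add: torsion3_def torsion_def D1_def lie_bracket_eq X Y pt.h_simps g_Q)

lemma natural_skew_D1:
  assumes ce: "\<forall>p. class_equation (\<phi> p) (Fp p)"
  shows "natural_skew D1"
proof -
  note ce_p = ce[rule_format]
  note skew12 = pt.T1_skew12[OF F_type_Fp ce_p] and skew23 = pt.T1_skew23[OF F_type_Fp ce_p]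
  note T\<xi> = pt.T1_x0[OF F_type_Fp ce_p]
  have Kz: "g p (D X \<xi> p) z = pt.K p (Fp p) (X p) z" if "vf X" for X p z
  proof -
    obtain Z where Z: "vf Z" "Z p = z" by (rule exists_vector_field_through)
    show ?thesis using Kp[OF that Z(1), of p] by (simp add: Z(2))
  qed
  have "cov_endo D1 \<phi> X Y p = 0" if X: "vf X" and Y: "vf Y" for X Y p
  proof (rule pt.h_nondeg[of p])
    fix z
    obtain Z where Z: "vf Z" "Z p = z" by (rule exists_vector_field_through)
    have "g p (cov_endo D1 \<phi> X Y p) z = F X Y Z p + g p (Q p (X p) (\<phi> p (Y p))) z
        + g p (Q p (X p) (Y p)) (\<phi> p z)"
      by (simp add: cov_endo_def D1_def F_eq Z(2) pt.h_simps pt.f_simps ap1_apply pt.h_f_left)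
    also have "\<dots> = 0"
      using pt.T1_parallel[OF F_type_Fp ce_p, of p "X p" "Y p" z] by (simp add: g_Q F_Fp X Y Z)
    finally show "g p (cov_endo D1 \<phi> X Y p) z = 0" .
  qed
  moreover have "D1 X \<xi> p = 0" if X: "vf X" for X p
  proof (rule pt.h_nondeg[of p])
    show "g p (D1 X \<xi> p) z = 0" for z
      using T\<xi>[of p "X p" z] by (simp add: D1_def pt.h_simps g_Q Kz[OF X])
  qed
  moreover have "cov_form A D1 \<eta> X Y p = 0" if X: "vf X" and Y: "vf Y" for X Y p
  proof -
    have "cov_form A D1 \<eta> X Y p = cov_form A D \<eta> X Y p - \<eta> p (Q p (X p) (Y p))"
      by (simp add: cov_form_def D1_def pt.e_simps)
    also have "\<eta> p (Q p (X p) (Y p)) = - g p (Q p (X p) (Y p)) (\<xi> p)" by (simp add: pt.h_x0)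
    also have "\<dots> = - (1/2 * T1p p (X p) (Y p) (\<xi> p))" by (simp only: g_Q)
    finally show ?thesis
      using T\<xi>[of p "X p" "Y p"] skew23[of p "X p" "\<xi> p" "Y p"] cov_form_eq[OF X Y, of p] Kp[OF X Y, of p]
      by linarith
  qed
  moreover have "cov_metric A D1 g X Y Z p = 0" if X: "vf X" and Y: "vf Y" and Z: "vf Z" for X Y Z p
  proof -
    have "g p (Y p) (Q p (X p) (Z p)) = 1/2 * T1p p (X p) (Z p) (Y p)"
      unfolding pt.h_sym[of p "Y p"] by (rule g_Q)
    then show ?thesis
      using skew23[of p "X p" "Y p" "Z p"] conn_metric[OF D_connection D_metric X Y Z, of p]
      by (simp add: cov_metric_def D1_def pt.h_simps g_Q)
  qed
  ultimately have "natural_connection A \<phi> \<xi> \<eta> g D1"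
    unfolding natural_connection_def parallel_metric_def
    using affine_connection_D1 by (simp add: fun_eq_iff)
  moreover have "is_3form A (torsion3 A D1 g)"
    unfolding is_3form_def
  proof (intro allI impI)
    fix X Y Z p assume X: "vf X" and Y: "vf Y" and Z: "vf Z"
    show "torsion3 A D1 g X Y Z p = - torsion3 A D1 g Y X Z p \<and>
        torsion3 A D1 g X Y Z p = - torsion3 A D1 g X Z Y p"
      unfolding torsion3_D1[OF ce X Y Z] torsion3_D1[OF ce Y X Z] torsion3_D1[OF ce X Z Y]
      by (rule conjI[OF skew12 skew23])
  qed
  ultimately show ?thesis unfolding natural_skew_def by blast
qed

lemma class_equation_iff_natural_skew:
  "(\<forall>p. class_equation (\<phi> p) (Fp p)) \<longleftrightarrow>
    (\<exists>D1. natural_skew D1 \<and>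
      (\<forall>D'. natural_skew D' \<longrightarrow> (\<forall>X Y. vf X \<longrightarrow> vf Y \<longrightarrow> D' X Y = D1 X Y)) \<and>
      (\<forall>X Y Z. vf X \<longrightarrow> vf Y \<longrightarrow> vf Z \<longrightarrow> torsion3 A D1 g X Y Z = T1_form D \<phi> \<xi> \<eta> g X Y Z))"
  (is "?E \<longleftrightarrow> ?N")
proof
  assume ce: ?E
  show ?N
  proof (intro exI[of _ D1] conjI allI impI)
    show "natural_skew D1" by (rule natural_skew_D1[OF ce])
    show "D' X Y = D1 X Y" if "natural_skew D'" "vf X" "vf Y" for D' X Y
      by (rule natural_skew_unique[OF that(1) natural_skew_D1[OF ce] that(2,3)])
    show "torsion3 A D1 g X Y Z = T1_form D \<phi> \<xi> \<eta> g X Y Z" if "vf X" "vf Y" "vf Z" for X Y Z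
      by (rule ext) (simp only: torsion3_D1[OF ce that] T1_form_eq[OF that])
  qed
next
  assume ?N
  then obtain D' where "natural_skew D'" by blast
  then show ?E using natural_skew_imp_F_equation F_equation_iff by blast
qed

end

theorem theorem15p7:
  fixes A :: "('m::{t2_space, second_countable_topology}, 'e::euclidean_space) chart set"
    and n :: nat
    and \<phi> :: "'m \<Rightarrow> 'e \<Rightarrow> 'e" and \<xi> :: "'m \<Rightarrow> 'e" and \<eta> :: "'m \<Rightarrow> 'e \<Rightarrow> real"
    and g :: "'m \<Rightarrow> 'e \<Rightarrow> 'e \<Rightarrow> real"
    and D :: "('m, 'e) connection"
  assumes "smooth_atlas A"
    and "DIM('e) = 4 * n + 3"
    and "almost_contact_metric A \<phi> \<xi> \<eta> g"
    and "levi_civita A g D"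
  defines "class_eq \<equiv> F_equation A D \<phi> g"
    and "natural_skew \<equiv> \<lambda>D'. natural_connection A \<phi> \<xi> \<eta> g D' \<and> is_3form A (torsion3 A D' g)"
  shows "(in_class_P2_P4_P9_P10_P11 n A D \<phi> \<xi> \<eta> g \<longleftrightarrow>
            class_eq \<and>
            (\<forall>Y Z. vector_field A Y \<longrightarrow> vector_field A Z \<longrightarrow> fund_F D \<phi> g \<xi> Y Z = (\<lambda>p. 0))) \<and>
         (class_eq \<longleftrightarrow>
            (\<forall>X Y. vector_field A X \<longrightarrow> vector_field A Y \<longrightarrow>
               assoc_nijenhuis A D \<phi> \<xi> g X Y = (\<lambda>p. 0)) \<and> killing A g \<xi>) \<and>
         (class_eq \<longleftrightarrow>
            (\<forall>X Y. vector_field A X \<longrightarrow> vector_field A Y \<longrightarrow>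
               sym_phi_phi D \<phi> X Y = (\<lambda>p. 0)) \<and> killing A g \<xi>) \<and>
         (class_eq \<longleftrightarrow> is_3form A (nijenhuis3 A D \<phi> \<xi> \<eta> g) \<and> killing A g \<xi>) \<and>
         (class_eq \<longleftrightarrow>
            (\<exists>D1. natural_skew D1 \<and>
               (\<forall>D'. natural_skew D' \<longrightarrow>
                  (\<forall>X Y. vector_field A X \<longrightarrow> vector_field A Y \<longrightarrow> D' X Y = D1 X Y)) \<and>
               (\<forall>X Y Z. vector_field A X \<longrightarrow> vector_field A Y \<longrightarrow> vector_field A Z \<longrightarrow>
                  torsion3 A D1 g X Y Z = T1_form D \<phi> \<xi> \<eta> g X Y Z)))"
proof -
  interpret C: contact_manifold A \<phi> \<xi> \<eta> g D
    by unfold_locales (rule assms)+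
  have ns: "natural_skew = C.natural_skew"
    unfolding natural_skew_def C.natural_skew_def[abs_def] ..
  have ce: "class_eq \<longleftrightarrow> (\<forall>p. class_equation (\<phi> p) (C.Fp p))"
    unfolding class_eq_def by (rule C.F_equation_iff)
  have i: "in_class_P2_P4_P9_P10_P11 n A D \<phi> \<xi> \<eta> g \<longleftrightarrow> class_eq \<and>
      (\<forall>Y Z. vector_field A Y \<longrightarrow> vector_field A Z \<longrightarrow> fund_F D \<phi> g \<xi> Y Z = (\<lambda>p. 0))"
    unfolding ce C.F_\<xi>_iff by (rule C.in_class_iff[OF assms(2)])
  have iii: "class_eq \<longleftrightarrow> (\<forall>X Y. vector_field A X \<longrightarrow> vector_field A Y \<longrightarrow>
      sym_phi_phi D \<phi> X Y = (\<lambda>p. 0)) \<and> killing A g \<xi>"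
    unfolding ce C.sym_phi_phi_iff using C.class_equation_imp_killing by blast
  \<comment> \<open>When \<open>\<xi>\<close> is Killing, the two symmetric tensors coincide.\<close>
  have assoc: "assoc_nijenhuis A D \<phi> \<xi> g X Y = sym_phi_phi D \<phi> X Y"
    if "killing A g \<xi>" "vector_field A X" "vector_field A Y" for X Y
  proof -
    have "lie_deriv_metric A \<xi> g X Y = (\<lambda>p. 0)" using that unfolding killing_def by blast
    then show ?thesis by (simp add: assoc_nijenhuis_def)
  qed
  have ii: "class_eq \<longleftrightarrow> (\<forall>X Y. vector_field A X \<longrightarrow> vector_field A Y \<longrightarrow>
      assoc_nijenhuis A D \<phi> \<xi> g X Y = (\<lambda>p. 0)) \<and> killing A g \<xi>"
    unfolding iii using assoc by metis
  have iv: "class_eq \<longleftrightarrow> is_3form A (nijenhuis3 A D \<phi> \<xi> \<eta> g) \<and> killing A g \<xi>"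
    unfolding ce C.nijenhuis_3form_iff C.killing_iff
      C.pt.class_equation_iff_Nij[OF C.F_type_Fp] by blast
  show ?thesis
    using i ii iii iv C.class_equation_iff_natural_skew[folded ce ns] by blast
qed

end
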